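(* Let $H\le G$ be finite groups and $K$ an algebraically closed field of characteristic $0$, and consider the filtrations $K\subset K[H]$ and $K\subset K[G]$. Then $\mathrm{Irr}_1F(K[G])$ (the set of isomorphism classes of irreducible gliders of length $1$, viewed in $\overline{R}_1(\widetilde G)$ with the multiplication of that ring) is a monoid and $$\overline R_1(\widetilde G)\cong\mathbb{Z}[\mathrm{Irr}_1F(K[G])]$$ is an integral semigroup algebra. Furthermore, $\mathcal{I}nd_H^G(\cdot):\overline R_1(\widetilde H)\to\overline R_1(\widetilde G)$ and $\mathcal{R}es^G_H(\cdot):\overline R_1(\widetilde G)\to\overline R_1(\widetilde H)$ are ring morphisms (not necessarily unital) sending basis elements (irreducible gliders of length $1$) to basis elements, and $\mathcal{I}nd_H^G$ is a monomorphism.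
   Context: A glider of length at most $1$ of $G$ (for $K\subset K[G]$) is a $K[G]$-module $\Omega$ with finite-dimensional $K$-subspaces $M_{-1}\subseteq M_0\subseteq\Omega$ with $K[G]M_{-1}\subseteq M_0$; it has length $0$ if $M_{-1}=0$ and length $1$ otherwise. A morphism to $(N_{-1}\subseteq N_0)$ is a $K$-linear $f:M_0\to N_0$ with $f(M_{-1})\subseteq N_{-1}$ and $f(xm)=xf(m)$ for $x\in K[G]$, $m\in M_{-1}$. Direct sums and tensor products over $K$ (diagonal $G$-action) are formed levelwise. A glider of length $1$ is irreducible if every proper subglider (subspaces $N_{-1}\subseteq M_{-1}$, $N_0\subseteq M_0$ with $N_{-1}\subseteq N_0$, $K[G]N_{-1}\subseteq N_0$) has $N_{-1}=0$; equivalently $\dim M_{-1}=1$ and $M_0=K[G]M_{-1}$. $\overline{R}_1(\widetilde G)$ is the subring generated by the classes of irreducible gliders of length $1$ in the quotient of the split Grothendieck ring of gliders of length $\le 1$ (free abelian group on isomorphism classes modulo $[M\oplus N]=[M]+[N]$, product induced by $\otimes$) by the ideal additively generated by gliders of length $0$. For $H\le G$, $\mathcal{I}nd_H^G$ sends the class of $(M_{-1}\subseteq M_0)$ with $M_0$ a $K[H]$-module to the class of $(1\otimes M_{-1}\subseteq K[G]\otimes_{K[H]}M_0)$, and $\mathcal{R}es^G_H$ sends the class of $(M_{-1}\subseteq M_0)$ with $M_0$ a $K[G]$-module to the class of $(M_{-1}\subseteq M_0)$ with $M_0$ regarded as a $K[H]$-module. *)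

theory Defs
  imports
    "HOL-Library.Poly_Mapping"
    "HOL-Algebra.QuotRing"
    "HOL-Algebra.Generated_Groups"
    "HOL-Algebra.Generated_Rings"
    "HOL-Computational_Algebra.Polynomial"
begin

section \<open>Free modules and monoid algebras\<close>

text \<open>
  The finitely supported functions \<^typ>\<open>'b \<Rightarrow>\<^sub>0 'k\<close> form the free module over \<^typ>\<open>'k\<close> with basis
  \<^typ>\<open>'b\<close>. Every vector space over \<^typ>\<open>'k\<close> is (isomorphic to) a subspace of such a space.
\<close>

definition pscale :: "'r::comm_ring_1 \<Rightarrow> ('b \<Rightarrow>\<^sub>0 'r) \<Rightarrow> ('b \<Rightarrow>\<^sub>0 'r)" where
  "pscale c v = Poly_Mapping.map ((*) c) v"

lemma lookup_pscale: "Poly_Mapping.lookup (pscale c v) b = c * Poly_Mapping.lookup v b"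
  by (simp add: pscale_def Poly_Mapping.map.rep_eq when_def)

interpretation pm: vector_space "pscale :: 'k::field \<Rightarrow> ('b \<Rightarrow>\<^sub>0 'k) \<Rightarrow> ('b \<Rightarrow>\<^sub>0 'k)"
  by unfold_locales
    (auto intro!: poly_mapping_eqI simp: lookup_pscale lookup_add algebra_simps)

definition basis_extend :: "('b \<Rightarrow> 'c \<Rightarrow>\<^sub>0 'r::comm_ring_1) \<Rightarrow> ('b \<Rightarrow>\<^sub>0 'r) \<Rightarrow> ('c \<Rightarrow>\<^sub>0 'r)" where
  "basis_extend \<phi> v = (\<Sum>b\<in>Poly_Mapping.keys v. pscale (Poly_Mapping.lookup v b) (\<phi> b))"

definition monoid_algebra ::
  "'r::comm_ring_1 itself \<Rightarrow> ('m, 'x) monoid_scheme \<Rightarrow> ('m \<Rightarrow>\<^sub>0 'r) ring" where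
  "monoid_algebra R M =
     \<lparr>carrier = {f. Poly_Mapping.keys f \<subseteq> carrier M},
      monoid.mult = (\<lambda>f g. basis_extend (\<lambda>a. basis_extend (\<lambda>b. Poly_Mapping.single (a \<otimes>\<^bsub>M\<^esub> b) 1) g) f),
      one = Poly_Mapping.single \<one>\<^bsub>M\<^esub> 1,
      zero = 0,
      add = (+)\<rparr>"

text \<open>
  The tensor product over \<^typ>\<open>'k\<close> of the free spaces on \<^typ>\<open>'a\<close> and \<^typ>\<open>'b\<close> is the free space on
  \<^typ>\<open>'a \<times> 'b\<close>; over a field, the tensor product of two subspaces is the span of the pure
  tensors of their elements.
\<close>

definition pure_tensor :: "('a \<Rightarrow>\<^sub>0 'k::field) \<Rightarrow> ('b \<Rightarrow>\<^sub>0 'k) \<Rightarrow> ('a \<times> 'b \<Rightarrow>\<^sub>0 'k)" where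
  "pure_tensor v w = basis_extend (\<lambda>a. basis_extend (\<lambda>b. Poly_Mapping.single (a, b) 1) w) v"

definition tensor_space :: "('a \<Rightarrow>\<^sub>0 'k::field) set \<Rightarrow> ('b \<Rightarrow>\<^sub>0 'k) set \<Rightarrow> ('a \<times> 'b \<Rightarrow>\<^sub>0 'k) set" where
  "tensor_space V W = pm.span {pure_tensor v w | v w. v \<in> V \<and> w \<in> W}"

text \<open>The direct sum of the free spaces on \<^typ>\<open>'a\<close> and \<^typ>\<open>'b\<close> is the free space on \<^typ>\<open>'a + 'b\<close>.\<close>

definition pm_inl :: "('a \<Rightarrow>\<^sub>0 'k::field) \<Rightarrow> ('a + 'b \<Rightarrow>\<^sub>0 'k)" where
  "pm_inl = basis_extend (\<lambda>a. Poly_Mapping.single (Inl a) 1)"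

definition pm_inr :: "('b \<Rightarrow>\<^sub>0 'k::field) \<Rightarrow> ('a + 'b \<Rightarrow>\<^sub>0 'k)" where
  "pm_inr = basis_extend (\<lambda>b. Poly_Mapping.single (Inr b) 1)"

definition dsum_space :: "('a \<Rightarrow>\<^sub>0 'k::field) set \<Rightarrow> ('b \<Rightarrow>\<^sub>0 'k) set \<Rightarrow> ('a + 'b \<Rightarrow>\<^sub>0 'k) set" where
  "dsum_space V W = {pm_inl v + pm_inr w | v w. v \<in> V \<and> w \<in> W}"


section \<open>Modules over the group algebra and gliders\<close>

text \<open>
  A \<open>K[G]\<close>-module is a subspace \<open>\<Omega>\<close> of a free space with a linear action of \<open>G\<close>. Each group
  element is taken to act by a linear endomorphism of the whole ambient space (any linear
  map on \<open>\<Omega>\<close> extends to one); only its restriction to \<open>\<Omega>\<close> matters.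
\<close>

definition kg_module ::
  "('g, 'x) monoid_scheme \<Rightarrow> ('b \<Rightarrow>\<^sub>0 'k::field) set \<Rightarrow> ('g \<Rightarrow> ('b \<Rightarrow>\<^sub>0 'k) \<Rightarrow> ('b \<Rightarrow>\<^sub>0 'k)) \<Rightarrow> bool" where
  "kg_module G \<Omega> \<rho> \<longleftrightarrow>
     pm.subspace \<Omega> \<and>
     (\<forall>g\<in>carrier G. Vector_Spaces.linear pscale pscale (\<rho> g) \<and> \<rho> g ` \<Omega> \<subseteq> \<Omega>) \<and>
     (\<forall>v\<in>\<Omega>. \<rho> \<one>\<^bsub>G\<^esub> v = v) \<and>
     (\<forall>g\<in>carrier G. \<forall>h\<in>carrier G. \<forall>v\<in>\<Omega>. \<rho> (g \<otimes>\<^bsub>G\<^esub> h) v = \<rho> g (\<rho> h v))"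

definition kg_act ::
  "('g \<Rightarrow> ('b \<Rightarrow>\<^sub>0 'k::field) \<Rightarrow> ('b \<Rightarrow>\<^sub>0 'k)) \<Rightarrow> ('g \<Rightarrow>\<^sub>0 'k) \<Rightarrow> ('b \<Rightarrow>\<^sub>0 'k) \<Rightarrow> ('b \<Rightarrow>\<^sub>0 'k)" where
  "kg_act \<rho> x v = basis_extend (\<lambda>g. \<rho> g v) x"

record (overloaded) ('g, 'b, 'k) glider =
  Omega :: "('b \<Rightarrow>\<^sub>0 'k) set"
  act :: "'g \<Rightarrow> ('b \<Rightarrow>\<^sub>0 'k) \<Rightarrow> ('b \<Rightarrow>\<^sub>0 'k)"
  lev1 :: "('b \<Rightarrow>\<^sub>0 'k) set" \<comment> \<open>the subspace of index \<open>-1\<close>\<close>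
  lev0 :: "('b \<Rightarrow>\<^sub>0 'k) set"

definition findim :: "('b \<Rightarrow>\<^sub>0 'k::field) set \<Rightarrow> bool" where
  "findim V \<longleftrightarrow> (\<exists>B. finite B \<and> V = pm.span B)"

definition is_glider :: "('g, 'x) monoid_scheme \<Rightarrow> ('g, 'b, 'k::field) glider \<Rightarrow> bool" where
  "is_glider G M \<longleftrightarrow>
     kg_module G (Omega M) (act M) \<and>
     pm.subspace (lev1 M) \<and> pm.subspace (lev0 M) \<and> findim (lev1 M) \<and> findim (lev0 M) \<and>
     lev1 M \<subseteq> lev0 M \<and> lev0 M \<subseteq> Omega M \<and>
     (\<forall>x\<in>carrier (monoid_algebra TYPE('k) G). \<forall>m\<in>lev1 M. kg_act (act M) x m \<in> lev0 M)"

definition length_zero :: "('g, 'b, 'k::field) glider \<Rightarrow> bool" where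
  "length_zero M \<longleftrightarrow> lev1 M = {0}"

definition length_one :: "('g, 'b, 'k::field) glider \<Rightarrow> bool" where
  "length_one M \<longleftrightarrow> lev1 M \<noteq> {0}"

definition glider_mor ::
  "('g, 'x) monoid_scheme \<Rightarrow> ('g, 'b, 'k::field) glider \<Rightarrow> ('g, 'c, 'k) glider \<Rightarrow>
   (('b \<Rightarrow>\<^sub>0 'k) \<Rightarrow> ('c \<Rightarrow>\<^sub>0 'k)) \<Rightarrow> bool" where
  "glider_mor G M N f \<longleftrightarrow>
     f \<in> lev0 M \<rightarrow> lev0 N \<and>
     (\<forall>u\<in>lev0 M. \<forall>v\<in>lev0 M. f (u + v) = f u + f v) \<and>
     (\<forall>c. \<forall>v\<in>lev0 M. f (pscale c v) = pscale c (f v)) \<and>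
     f ` lev1 M \<subseteq> lev1 N \<and>
     (\<forall>x\<in>carrier (monoid_algebra TYPE('k) G). \<forall>m\<in>lev1 M.
        f (kg_act (act M) x m) = kg_act (act N) x (f m))"

definition glider_iso ::
  "('g, 'x) monoid_scheme \<Rightarrow> ('g, 'b, 'k::field) glider \<Rightarrow> ('g, 'c, 'k) glider \<Rightarrow> bool" where
  "glider_iso G M N \<longleftrightarrow>
     (\<exists>f h. glider_mor G M N f \<and> glider_mor G N M h \<and>
        (\<forall>v\<in>lev0 M. h (f v) = v) \<and> (\<forall>w\<in>lev0 N. f (h w) = w))"

definition subglider ::
  "('g, 'x) monoid_scheme \<Rightarrow> ('g, 'b, 'k::field) glider \<Rightarrow>
   ('b \<Rightarrow>\<^sub>0 'k) set \<Rightarrow> ('b \<Rightarrow>\<^sub>0 'k) set \<Rightarrow> bool" where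
  "subglider G M N1 N0 \<longleftrightarrow>
     pm.subspace N1 \<and> pm.subspace N0 \<and> N1 \<subseteq> lev1 M \<and> N0 \<subseteq> lev0 M \<and> N1 \<subseteq> N0 \<and>
     (\<forall>x\<in>carrier (monoid_algebra TYPE('k) G). \<forall>m\<in>N1. kg_act (act M) x m \<in> N0)"

definition irreducible_glider :: "('g, 'x) monoid_scheme \<Rightarrow> ('g, 'b, 'k::field) glider \<Rightarrow> bool" where
  "irreducible_glider G M \<longleftrightarrow>
     is_glider G M \<and> length_one M \<and>
     (\<forall>N1 N0. subglider G M N1 N0 \<and> (N1, N0) \<noteq> (lev1 M, lev0 M) \<longrightarrow> N1 = {0})"

definition glider_dsum ::
  "('g, 'a, 'k::field) glider \<Rightarrow> ('g, 'b, 'k) glider \<Rightarrow> ('g, 'a + 'b, 'k) glider" where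
  "glider_dsum M N =
     \<lparr>Omega = dsum_space (Omega M) (Omega N),
      act = (\<lambda>g. basis_extend (case_sum
               (\<lambda>a. pm_inl (act M g (Poly_Mapping.single a 1)))
               (\<lambda>b. pm_inr (act N g (Poly_Mapping.single b 1))))),
      lev1 = dsum_space (lev1 M) (lev1 N),
      lev0 = dsum_space (lev0 M) (lev0 N)\<rparr>"

definition glider_tensor ::
  "('g, 'a, 'k::field) glider \<Rightarrow> ('g, 'b, 'k) glider \<Rightarrow> ('g, 'a \<times> 'b, 'k) glider" where
  "glider_tensor M N =
     \<lparr>Omega = tensor_space (Omega M) (Omega N),
      act = (\<lambda>g. basis_extend (\<lambda>(a, b).
               pure_tensor (act M g (Poly_Mapping.single a 1)) (act N g (Poly_Mapping.single b 1)))),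
      lev1 = tensor_space (lev1 M) (lev1 N),
      lev0 = tensor_space (lev0 M) (lev0 N)\<rparr>"

text \<open>The one-dimensional glider with trivial action, the unit for the tensor product.\<close>

definition glider_unit :: "('g, unit, 'k::field) glider" where
  "glider_unit = \<lparr>Omega = UNIV, act = (\<lambda>_ v. v), lev1 = UNIV, lev0 = UNIV\<rparr>"


section \<open>The Grothendieck ring\<close>

text \<open>
  Since \<open>lev0\<close> and the submodule it generates are finite-dimensional when \<open>G\<close> is finite, every
  glider (over any basis type) is isomorphic to one with basis type \<^typ>\<open>nat\<close>. Its isomorphism
  class is represented by the set of the latter, so no class is lost by this choice of universe.
\<close>

definition iso_class ::
  "('g, 'x) monoid_scheme \<Rightarrow> ('g, 'b, 'k::field) glider \<Rightarrow> ('g, nat, 'k) glider set" where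
  "iso_class G M = {N. is_glider G N \<and> glider_iso G N M}"

definition iso_class_monoid ::
  "'k::field itself \<Rightarrow> ('g, 'x) monoid_scheme \<Rightarrow> ('g, nat, 'k) glider set monoid" where
  "iso_class_monoid K G =
     \<lparr>carrier = {iso_class G M | M :: ('g, nat, 'k) glider. is_glider G M},
      monoid.mult = (\<lambda>c d. \<Union>M\<in>c. \<Union>N\<in>d. iso_class G (glider_tensor M N)),
      one = iso_class G glider_unit\<rparr>"

text \<open>
  \<open>split_groth_ring\<close>: the free abelian group on isomorphism classes, with product induced by
  the tensor product, modulo the additive subgroup generated by \<open>[M \<oplus> N] - [M] - [N]\<close>.
\<close>

definition free_groth_ring ::
  "'k::field itself \<Rightarrow> ('g, 'x) monoid_scheme \<Rightarrow> (('g, nat, 'k) glider set \<Rightarrow>\<^sub>0 int) ring" where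
  "free_groth_ring K G = monoid_algebra TYPE(int) (iso_class_monoid K G)"

definition split_relations ::
  "'k::field itself \<Rightarrow> ('g, 'x) monoid_scheme \<Rightarrow> (('g, nat, 'k) glider set \<Rightarrow>\<^sub>0 int) set" where
  "split_relations K G =
     generate (add_monoid (free_groth_ring K G))
       {Poly_Mapping.single (iso_class G (glider_dsum M N)) 1
          - Poly_Mapping.single (iso_class G M) 1 - Poly_Mapping.single (iso_class G N) 1
        | (M :: ('g, nat, 'k) glider) (N :: ('g, nat, 'k) glider). is_glider G M \<and> is_glider G N}"

definition split_groth_ring ::
  "'k::field itself \<Rightarrow> ('g, 'x) monoid_scheme \<Rightarrow> (('g, nat, 'k) glider set \<Rightarrow>\<^sub>0 int) set ring" where
  "split_groth_ring K G = free_groth_ring K G Quot split_relations K G"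

definition split_class ::
  "('g, 'x) monoid_scheme \<Rightarrow> ('g, nat, 'k::field) glider set \<Rightarrow> (('g, nat, 'k) glider set \<Rightarrow>\<^sub>0 int) set" where
  "split_class G c =
     split_relations TYPE('k) G +>\<^bsub>free_groth_ring TYPE('k) G\<^esub> Poly_Mapping.single c 1"

definition length_zero_ideal ::
  "'k::field itself \<Rightarrow> ('g, 'x) monoid_scheme \<Rightarrow> (('g, nat, 'k) glider set \<Rightarrow>\<^sub>0 int) set set" where
  "length_zero_ideal K G =
     generate (add_monoid (split_groth_ring K G))
       {split_class G (iso_class G M) | M :: ('g, nat, 'k) glider. is_glider G M \<and> length_zero M}"

definition reduced_groth_ring ::
  "'k::field itself \<Rightarrow> ('g, 'x) monoid_scheme \<Rightarrow> (('g, nat, 'k) glider set \<Rightarrow>\<^sub>0 int) set set ring" where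
  "reduced_groth_ring K G = split_groth_ring K G Quot length_zero_ideal K G"

definition reduced_class ::
  "('g, 'x) monoid_scheme \<Rightarrow> ('g, nat, 'k::field) glider set \<Rightarrow>
   (('g, nat, 'k) glider set \<Rightarrow>\<^sub>0 int) set set" where
  "reduced_class G c =
     length_zero_ideal TYPE('k) G +>\<^bsub>split_groth_ring TYPE('k) G\<^esub> split_class G c"

definition irr1_classes ::
  "'k::field itself \<Rightarrow> ('g, 'x) monoid_scheme \<Rightarrow> ('g, nat, 'k) glider set set" where
  "irr1_classes K G = {iso_class G M | M :: ('g, nat, 'k) glider. irreducible_glider G M}"

definition R1bar ::
  "'k::field itself \<Rightarrow> ('g, 'x) monoid_scheme \<Rightarrow> (('g, nat, 'k) glider set \<Rightarrow>\<^sub>0 int) set set ring" where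
  "R1bar K G =
     (reduced_groth_ring K G)
       \<lparr>carrier := generate_ring (reduced_groth_ring K G) (reduced_class G ` irr1_classes K G)\<rparr>"

definition irr1_monoid ::
  "'k::field itself \<Rightarrow> ('g, 'x) monoid_scheme \<Rightarrow> (('g, nat, 'k) glider set \<Rightarrow>\<^sub>0 int) set set monoid" where
  "irr1_monoid K G =
     \<lparr>carrier = reduced_class G ` irr1_classes K G,
      monoid.mult = monoid.mult (R1bar K G),
      one = monoid.one (R1bar K G)\<rparr>"


section \<open>Induction and restriction\<close>

definition lev0_module :: "('g, 'x) monoid_scheme \<Rightarrow> ('g, 'b, 'k::field) glider \<Rightarrow> bool" where
  "lev0_module G M \<longleftrightarrow>
     (\<forall>x\<in>carrier (monoid_algebra TYPE('k) G). \<forall>m\<in>lev0 M. kg_act (act M) x m \<in> lev0 M)"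

text \<open>
  The tensor product \<open>K[G] \<otimes>\<^bsub>K[H]\<^esub> M\<^sub>0\<close> is the quotient of \<open>K[G] \<otimes>\<^bsub>K\<^esub> M\<^sub>0\<close> by the subspace spanned
  by all \<open>x y \<otimes> m - x \<otimes> y m\<close> with \<open>y\<close> in \<open>K[H]\<close>. As quotient map serves a linear projection of
  the ambient space with this kernel, so that the quotient is again a subspace of a free space.
\<close>

definition balancing_space ::
  "('g, 'x) monoid_scheme \<Rightarrow> 'g set \<Rightarrow> ('g, 'b, 'k::field) glider \<Rightarrow> ('g \<times> 'b \<Rightarrow>\<^sub>0 'k) set" where
  "balancing_space G H M =
     pm.span {pure_tensor (x \<otimes>\<^bsub>monoid_algebra TYPE('k) G\<^esub> y) m - pure_tensor x (kg_act (act M) y m)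
              | x y m. x \<in> carrier (monoid_algebra TYPE('k) G) \<and>
                       y \<in> carrier (monoid_algebra TYPE('k) (G\<lparr>carrier := H\<rparr>)) \<and> m \<in> lev0 M}"

definition quotient_proj :: "('c \<Rightarrow>\<^sub>0 'k::field) set \<Rightarrow> ('c \<Rightarrow>\<^sub>0 'k) \<Rightarrow> ('c \<Rightarrow>\<^sub>0 'k)" where
  "quotient_proj R =
     (SOME p. Vector_Spaces.linear pscale pscale p \<and> (\<forall>v. p (p v) = p v) \<and> {v. p v = 0} = R)"

lemma quotient_proj:
  assumes "pm.subspace R"
  shows "Vector_Spaces.linear pscale pscale (quotient_proj R)"
    and "quotient_proj R (quotient_proj R v) = quotient_proj R v"
    and "quotient_proj R v = 0 \<longleftrightarrow> v \<in> R"
proof -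
  interpret pp: vector_space_pair
    "pscale :: 'a \<Rightarrow> ('b \<Rightarrow>\<^sub>0 'a) \<Rightarrow> _" "pscale :: 'a \<Rightarrow> ('b \<Rightarrow>\<^sub>0 'a) \<Rightarrow> _" ..
  obtain B where B: "B \<subseteq> R" "pm.independent B" "R \<subseteq> pm.span B"
    using pm.basis_exists by metis
  have RB: "R = pm.span B" using B assms pm.span_minimal by blast
  define C where "C = pm.extend_basis B"
  have C: "B \<subseteq> C" "pm.independent C" "pm.span C = UNIV"
    using B(2) unfolding C_def
    by (auto simp: pm.extend_basis_superset pm.independent_extend_basis pm.span_extend_basis)
  define p where "p = pp.construct C (\<lambda>x. if x \<in> B then 0 else x)"
  have lin: "Vector_Spaces.linear pscale pscale p"
    unfolding p_def using C(2) by (rule pp.linear_construct)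
  interpret p: Vector_Spaces.linear pscale pscale p by (rule lin)
  have pC: "p x = (if x \<in> B then 0 else x)" if "x \<in> C" for x
    unfolding p_def using pp.construct_basis[OF C(2) that] .
  have pR: "p v = 0" if "v \<in> R" for v
  proof (rule p.eq_0_on_span[of B])
    show "v \<in> pm.span B" using that RB by simp
    show "p x = 0" if "x \<in> B" for x using that C(1) pC[of x] by auto
  qed
  have diff: "v - p v \<in> R" for v
  proof -
    have "v \<in> pm.span C" using C(3) by simp
    then show ?thesis
    proof (induction rule: pm.span_induct_alt)
      case base
      then show ?case using assms by (simp add: p.zero pm.subspace_0)
    next
      case (step c x y)
      have "x - p x \<in> R"
        using pC[OF step(1)] B(1) assms by (auto simp: pm.subspace_0)
      moreover have "pscale c x + y - p (pscale c x + y) = pscale c (x - p x) + (y - p y)"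
        by (simp add: p.add p.scale pm.scale_right_diff_distrib)
      ultimately show ?case
        using step(2) assms by (metis pm.subspace_add pm.subspace_scale)
    qed
  qed
  have idem: "p (p v) = p v" for v
    using pR[OF diff[of v]] by (simp add: p.diff)
  have ker: "{v. p v = 0} = R"
  proof (intro equalityI subsetI)
    show "v \<in> R" if "v \<in> {v. p v = 0}" for v using diff[of v] that by simp
  qed (simp add: pR)
  have "Vector_Spaces.linear pscale pscale (quotient_proj R) \<and>
    (\<forall>v. quotient_proj R (quotient_proj R v) = quotient_proj R v) \<and> {v. quotient_proj R v = 0} = R"
    unfolding quotient_proj_def by (rule someI[of _ p]) (use lin idem ker in blast)
  then show "Vector_Spaces.linear pscale pscale (quotient_proj R)"
    and "quotient_proj R (quotient_proj R v) = quotient_proj R v"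
    and "quotient_proj R v = 0 \<longleftrightarrow> v \<in> R"
    by auto
qed

definition left_mult :: "('g, 'x) monoid_scheme \<Rightarrow> 'g \<Rightarrow> ('g \<times> 'b \<Rightarrow>\<^sub>0 'k::field) \<Rightarrow> ('g \<times> 'b \<Rightarrow>\<^sub>0 'k)" where
  "left_mult G g = basis_extend (\<lambda>(a, b). Poly_Mapping.single (g \<otimes>\<^bsub>G\<^esub> a, b) 1)"

definition glider_ind ::
  "('g, 'x) monoid_scheme \<Rightarrow> 'g set \<Rightarrow> ('g, 'b, 'k::field) glider \<Rightarrow> ('g, 'g \<times> 'b, 'k) glider" where
  "glider_ind G H M =
     (let \<pi> = quotient_proj (balancing_space G H M);
          I = \<pi> ` tensor_space (carrier (monoid_algebra TYPE('k) G)) (lev0 M)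
      in \<lparr>Omega = I,
          act = (\<lambda>g v. \<pi> (left_mult G g v)),
          lev1 = {\<pi> (pure_tensor \<one>\<^bsub>monoid_algebra TYPE('k) G\<^esub> m) | m. m \<in> lev1 M},
          lev0 = I\<rparr>)"

text \<open>
  The maps on the rings are the additive maps with the prescribed values on classes. Restriction
  does not change the data of a glider, only the group over which its class is formed.
\<close>

definition is_Ind_map ::
  "'k::field itself \<Rightarrow> ('g, 'x) monoid_scheme \<Rightarrow> 'g set \<Rightarrow>
   ((('g, nat, 'k) glider set \<Rightarrow>\<^sub>0 int) set set \<Rightarrow> (('g, nat, 'k) glider set \<Rightarrow>\<^sub>0 int) set set) \<Rightarrow> bool" where
  "is_Ind_map K G H F \<longleftrightarrow>
     F \<in> extensional (carrier (R1bar K (G\<lparr>carrier := H\<rparr>))) \<and>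
     F \<in> hom (add_monoid (R1bar K (G\<lparr>carrier := H\<rparr>))) (add_monoid (R1bar K G)) \<and>
     (\<forall>M :: ('g, nat, 'k) glider.
        is_glider (G\<lparr>carrier := H\<rparr>) M \<and> lev0_module (G\<lparr>carrier := H\<rparr>) M \<and>
        reduced_class (G\<lparr>carrier := H\<rparr>) (iso_class (G\<lparr>carrier := H\<rparr>) M)
          \<in> carrier (R1bar K (G\<lparr>carrier := H\<rparr>)) \<longrightarrow>
        F (reduced_class (G\<lparr>carrier := H\<rparr>) (iso_class (G\<lparr>carrier := H\<rparr>) M))
          = reduced_class G (iso_class G (glider_ind G H M)))"

definition is_Res_map ::
  "'k::field itself \<Rightarrow> ('g, 'x) monoid_scheme \<Rightarrow> 'g set \<Rightarrow>
   ((('g, nat, 'k) glider set \<Rightarrow>\<^sub>0 int) set set \<Rightarrow> (('g, nat, 'k) glider set \<Rightarrow>\<^sub>0 int) set set) \<Rightarrow> bool" where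
  "is_Res_map K G H F \<longleftrightarrow>
     F \<in> extensional (carrier (R1bar K G)) \<and>
     F \<in> hom (add_monoid (R1bar K G)) (add_monoid (R1bar K (G\<lparr>carrier := H\<rparr>))) \<and>
     (\<forall>M :: ('g, nat, 'k) glider.
        is_glider G M \<and> lev0_module G M \<and>
        reduced_class G (iso_class G M) \<in> carrier (R1bar K G) \<longrightarrow>
        F (reduced_class G (iso_class G M))
          = reduced_class (G\<lparr>carrier := H\<rparr>) (iso_class (G\<lparr>carrier := H\<rparr>) M))"

definition Ind_map where "Ind_map K G H = (THE F. is_Ind_map K G H F)"

definition Res_map where "Res_map K G H = (THE F. is_Res_map K G H F)"

text \<open>Ring morphisms that need not preserve the unit (unlike \<^const>\<open>ring_hom\<close>).\<close>

definition nonunital_ring_hom :: "('a, 'x) ring_scheme \<Rightarrow> ('b, 'y) ring_scheme \<Rightarrow> ('a \<Rightarrow> 'b) set" where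
  "nonunital_ring_hom R S = hom R S \<inter> hom (add_monoid R) (add_monoid S)"

end

theory Submission
  imports Defs "HOL-Algebra.Elementary_Groups"
begin

text \<open>
  Write a glider as \<open>M\<^sub>1 \<subseteq> M\<^sub>0\<close>, where \<open>M\<^sub>1\<close> is the subspace of index \<open>-1\<close>. A vector space complement
  of \<open>K[G]M\<^sub>1\<close> in \<open>M\<^sub>0\<close> splits off as a glider of length zero, so in the reduced ring a glider has the
  same class as its core \<open>M\<^sub>1 \<subseteq> K[G]M\<^sub>1\<close> (\<open>rcl_core\<close>). The core is determined by the relations
  \<open>\<Sum>g m\<^sub>g = 0\<close> that hold between vectors \<open>m\<^sub>g\<close> of \<open>M\<^sub>1\<close>, and gliders with corresponding relations have
  equal classes (\<open>rcl_same_relations\<close>).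

  A glider is irreducible when \<open>M\<^sub>1\<close> is a line \<open>Kv\<close> and it equals its core (\<open>irreducible_iff\<close>); its
  relations are the annihilator of \<open>v\<close>, a left ideal of \<open>K[G]\<close>. Conversely every glider whose lower
  level is a line has the class of an irreducible one (\<open>rcl_line\<close>). Since the tensor product of two
  lines is a line, the irreducible classes form a monoid, and their additive span is the ring that
  they generate (\<open>carrier_R1bar\<close>).

  The irreducible classes are linearly independent (\<open>irreducible_independent\<close>). For a set \<open>A\<close> of
  elements of the group algebra, the dimension of the space of vectors of \<open>M\<^sub>1\<close> killed by \<open>A\<close> is
  additive on direct sums and zero on gliders of length zero, hence a function on the reduced ring. On
  an irreducible glider with annihilator \<open>I\<close> it is \<open>1\<close> if \<open>A \<subseteq> I\<close> and \<open>0\<close> otherwise. Taking for \<open>A\<close> an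
  annihilator that is maximal among those occurring in a linear combination isolates one coefficient.

  Restriction keeps the data of a glider and therefore descends to a ring morphism. For induction, write
  \<open>\<iota> m = 1 \<otimes> m\<close>. A sum \<open>\<Sum>g (\<iota> m\<^sub>g)\<close> vanishes exactly if for every \<open>t\<close> in \<open>G\<close> the sum \<open>\<Sum>h m\<^bsub>th\<^esub>\<close> over
  \<open>h\<close> in \<open>H\<close> vanishes (\<open>induced_relations\<close>), so the relations of the induced glider depend only on
  those over \<open>H\<close>. The same description holds for the tensor product and for the direct sum of two
  induced gliders (\<open>induced_tensor\<close>, \<open>induced_dsum\<close>), which makes induction additive and
  multiplicative. The annihilator of \<open>v\<close> over \<open>H\<close> consists of the elements supported on \<open>H\<close> of the
  annihilator of \<open>\<iota> v\<close> (\<open>induced_ann\<close>). Induction is therefore injective on the irreducible classes,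
  and, as these form bases, on the whole ring.
\<close>

section \<open>Linear maps between free spaces\<close>

interpretation pmp: vector_space_pair
  "pscale :: 'k::field \<Rightarrow> ('a \<Rightarrow>\<^sub>0 'k) \<Rightarrow> ('a \<Rightarrow>\<^sub>0 'k)" "pscale :: 'k \<Rightarrow> ('b \<Rightarrow>\<^sub>0 'k) \<Rightarrow> ('b \<Rightarrow>\<^sub>0 'k)" ..

abbreviation lin :: "(('a \<Rightarrow>\<^sub>0 'k::field) \<Rightarrow> ('b \<Rightarrow>\<^sub>0 'k)) \<Rightarrow> bool" where
  "lin \<equiv> Vector_Spaces.linear pscale pscale"

abbreviation keys where "keys \<equiv> Poly_Mapping.keys"
abbreviation lookup where "lookup \<equiv> Poly_Mapping.lookup"
abbreviation single where "single \<equiv> Poly_Mapping.single"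

abbreviation bv :: "'a \<Rightarrow> ('a \<Rightarrow>\<^sub>0 'k::comm_ring_1)" where
  "bv a \<equiv> single a 1"

lemma linI:
  assumes "\<And>x y. f (x + y) = f x + f y" "\<And>c x. f (pscale c x) = pscale c (f x)"
  shows "lin f"
  using assms by unfold_locales (auto simp: pm.scale_right_distrib pm.scale_left_distrib)

lemmas lin_add = pmp.linear_add and lin_scale = pmp.linear_scale and lin_zero = pmp.linear_0
  and lin_diff = pmp.linear_diff and lin_sum = pmp.linear_sum

lemma lin_id: "lin (\<lambda>v. v)"
  by (rule linI) auto

lemma lin_comp: "lin f \<Longrightarrow> lin g \<Longrightarrow> lin (\<lambda>v. f (g v))"
  by (rule linI) (simp_all add: lin_add lin_scale)

lemma lin_plus: "lin f \<Longrightarrow> lin g \<Longrightarrow> lin (\<lambda>v. f v + g v)"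
  by (rule linI) (simp_all add: lin_add lin_scale pm.scale_right_distrib algebra_simps)

lemma lin_minus: "lin f \<Longrightarrow> lin g \<Longrightarrow> lin (\<lambda>v. f v - g v)"
  by (rule linI) (simp_all add: lin_add lin_scale pm.scale_right_diff_distrib algebra_simps)

lemma pscale_add_right: "pscale c (x + y) = pscale c x + pscale c y"
  by (auto intro!: poly_mapping_eqI simp: lookup_pscale lookup_add algebra_simps)

lemma pscale_add_left: "pscale (c + d) x = pscale c x + pscale d x"
  by (auto intro!: poly_mapping_eqI simp: lookup_pscale lookup_add algebra_simps)

lemma pscale_pscale: "pscale c (pscale d x) = pscale (c * d) x"
  by (auto intro!: poly_mapping_eqI simp: lookup_pscale algebra_simps)

lemma pscale_one [simp]: "pscale 1 x = x"
  by (auto intro!: poly_mapping_eqI simp: lookup_pscale)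

lemma pscale_zero_left [simp]: "pscale 0 x = 0"
  by (auto intro!: poly_mapping_eqI simp: lookup_pscale)

lemma pscale_zero_right [simp]: "pscale c 0 = 0"
  by (auto intro!: poly_mapping_eqI simp: lookup_pscale)

lemma pscale_sum: "pscale c (\<Sum>i\<in>A. f i) = (\<Sum>i\<in>A. pscale c (f i))"
  by (induction A rule: infinite_finite_induct) (auto simp: pscale_add_right)

lemma pscale_single: "pscale c (single a d) = single a (c * d)"
  by (auto intro!: poly_mapping_eqI simp: lookup_pscale lookup_single when_def)

lemma basis_extend_superset:
  assumes "finite A" "keys v \<subseteq> A"
  shows "basis_extend \<phi> v = (\<Sum>b\<in>A. pscale (lookup v b) (\<phi> b))"
  unfolding basis_extend_def
  by (rule sum.mono_neutral_left) (use assms in \<open>auto simp: in_keys_iff\<close>)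

lemma basis_extend_add: "basis_extend \<phi> (v + w) = basis_extend \<phi> v + basis_extend \<phi> w"
proof -
  let ?A = "keys v \<union> keys w"
  have "basis_extend \<phi> u = (\<Sum>b\<in>?A. pscale (lookup u b) (\<phi> b))"
    if "u \<in> {v, w, v + w}" for u
    using that keys_add[of v w] by (intro basis_extend_superset) auto
  then show ?thesis
    by (simp add: lookup_add pscale_add_left sum.distrib)
qed

lemma basis_extend_pscale: "basis_extend \<phi> (pscale c v) = pscale c (basis_extend \<phi> v)"
proof -
  have "basis_extend \<phi> (pscale c v)
    = (\<Sum>b\<in>keys v. pscale (lookup (pscale c v) b) (\<phi> b))"
    by (rule basis_extend_superset) (auto simp: in_keys_iff lookup_pscale)
  then show ?thesis
    by (simp add: lookup_pscale basis_extend_def pscale_sum pscale_pscale)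
qed

lemma basis_extend_zero [simp]: "basis_extend \<phi> 0 = 0"
  by (simp add: basis_extend_def)

lemma basis_extend_single [simp]: "basis_extend \<phi> (single a c) = pscale c (\<phi> a)"
  by (subst basis_extend_superset[of "{a}"]) auto

lemma lin_basis_extend: "lin (basis_extend \<phi>)"
  by (rule linI) (simp_all add: basis_extend_add basis_extend_pscale)

lemma sum_basis: "(\<Sum>b\<in>keys v. pscale (lookup v b) (bv b)) = v"
proof (rule poly_mapping_eqI)
  fix a
  have "lookup (\<Sum>b\<in>keys v. pscale (lookup v b) (bv b)) a
      = (\<Sum>b\<in>keys v. if b = a then lookup v b else 0)"
    by (simp add: lookup_sum lookup_pscale lookup_single when_def if_distrib cong: if_cong)
  also have "\<dots> = lookup v a"
    by (simp add: in_keys_iff)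
  finally show "lookup (\<Sum>b\<in>keys v. pscale (lookup v b) (bv b)) a
      = lookup v a" .
qed

lemma keys_add_subset: "keys f \<subseteq> A \<Longrightarrow> keys g \<subseteq> A \<Longrightarrow> keys (f + g) \<subseteq> A"
  using keys_add[of f g] by blast

lemma supported_induct [consumes 1, case_names zero add]:
  assumes "keys f \<subseteq> A" and zero: "P 0"
    and add: "\<And>a c f. a \<in> A \<Longrightarrow> keys f \<subseteq> A \<Longrightarrow> P f \<Longrightarrow> P (single a c + f)"
  shows "P (f :: 'a \<Rightarrow>\<^sub>0 'r::comm_ring_1)"
proof -
  have "P (\<Sum>b\<in>B. single b (lookup f b)) \<and>
      keys (\<Sum>b\<in>B. single b (lookup f b)) \<subseteq> A"
    if "finite B" "B \<subseteq> A" for B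
    using that
  proof (induction B rule: finite_induct)
    case (insert b B)
    let ?s = "\<Sum>b\<in>B. single b (lookup f b)"
    have "keys (single b (lookup f b) + ?s) \<subseteq> A"
      by (rule keys_add_subset) (use insert in auto)
    with insert show ?case by (auto intro: add)
  qed (simp add: zero)
  from this[of "keys f"] show ?thesis
    using assms(1) sum_basis[of f] by (simp add: pscale_single)
qed

lemma lin_eq_basis_extend:
  assumes "lin f"
  shows "f v = basis_extend (\<lambda>b. f (bv b)) v"
proof -
  have "f v = f (\<Sum>b\<in>keys v. pscale (lookup v b) (bv b))"
    by (simp add: sum_basis)
  also have "\<dots> = basis_extend (\<lambda>b. f (bv b)) v"
    by (simp add: lin_sum[OF assms] lin_scale[OF assms] basis_extend_def)
  finally show ?thesis .
qed

lemma lin_eqI: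
  assumes "lin f" "lin g" "\<And>b. f (bv b) = g (bv b)"
  shows "f v = g v"
  using lin_eq_basis_extend[OF assms(1), of v] lin_eq_basis_extend[OF assms(2), of v] assms(3) by simp

lemma lin_span_subset:
  assumes "lin f" "pm.subspace S" "\<And>b. b \<in> B \<Longrightarrow> f b \<in> S" "v \<in> pm.span B"
  shows "f v \<in> S"
  using assms(4)
proof (induction rule: pm.span_induct_alt)
  case base
  then show ?case using assms by (simp add: lin_zero pm.subspace_0)
next
  case (step c x y)
  then show ?case using assms
    by (simp add: lin_add lin_scale pm.subspace_add pm.subspace_scale)
qed

lemma lin_eq_on_span:
  assumes "lin f" "lin g" "\<And>b. b \<in> B \<Longrightarrow> f b = g b" "v \<in> pm.span B"
  shows "f v = g v"
  using pmp.linear_eq_on_span[OF assms(1,2) _ assms(4)] assms(3) by blast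

lemma subspace_lin_image: "lin f \<Longrightarrow> pm.subspace V \<Longrightarrow> pm.subspace (f ` V)"
  by (rule pmp.linear_subspace_image)

text \<open>
  A basis of the subspace extends to one of the ambient space. Morphisms of gliders are linear on
  level 0 only, whereas tensor products are formed from maps on ambient basis vectors.
\<close>

lemma extend_to_lin:
  fixes f :: "('a \<Rightarrow>\<^sub>0 'k::field) \<Rightarrow> ('b \<Rightarrow>\<^sub>0 'k)"
  assumes V: "pm.subspace V" and add: "\<And>u v. u \<in> V \<Longrightarrow> v \<in> V \<Longrightarrow> f (u + v) = f u + f v"
    and scale: "\<And>c v. v \<in> V \<Longrightarrow> f (pscale c v) = pscale c (f v)"
  obtains F where "lin F" "\<And>v. v \<in> V \<Longrightarrow> F v = f v"
proof -
  obtain B where B: "B \<subseteq> V" "pm.independent B" "V \<subseteq> pm.span B"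
    using pm.basis_exists by metis
  define F where "F = pmp.construct B f"
  have F: "lin F" "\<And>b. b \<in> B \<Longrightarrow> F b = f b"
    unfolding F_def using B(2) by (auto simp: pmp.linear_construct pmp.construct_basis)
  have f0: "f 0 = 0" using scale[of 0 0] V by (simp add: pm.subspace_0)
  have "v \<in> V \<and> F v = f v" if "v \<in> pm.span B" for v
    using that
  proof (induction rule: pm.span_induct_alt)
    case base
    then show ?case using F V f0 by (simp add: lin_zero pm.subspace_0)
  next
    case (step c x y)
    then have "x \<in> V" using B by blast
    with step show ?case
      using F add[of "pscale c x" y] scale[of x c] V
      by (simp add: lin_add lin_scale pm.subspace_add pm.subspace_scale)
  qed
  then show ?thesis using B that[OF F(1)] by blast
qed

lemma findim_image: "lin f \<Longrightarrow> findim V \<Longrightarrow> findim (f ` V)"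
  unfolding findim_def by (metis finite_imageI pmp.linear_span_image)

lemma findim_span: "finite B \<Longrightarrow> findim (pm.span B)"
  unfolding findim_def by blast

lemma findim_subspace:
  assumes "findim W" "pm.subspace V" "V \<subseteq> W"
  shows "findim V"
proof -
  obtain B where B: "B \<subseteq> V" "pm.independent B" "V \<subseteq> pm.span B"
    using pm.basis_exists by metis
  obtain C where "finite C" "W = pm.span C" using assms(1) unfolding findim_def by blast
  then have "finite B" using pm.independent_span_bound[of C B] B assms(3) by blast
  moreover have "V = pm.span B" using B assms(2) pm.span_minimal by blast
  ultimately show ?thesis unfolding findim_def by blast
qed

subsection \<open>Tensor products\<close>

lemma lookup_pure_tensor:
  "lookup (pure_tensor v w) (a, b) = lookup v a * lookup w b"
proof -
  have inner: "lookup (basis_extend (\<lambda>b. single (a', b) 1) w) (a, b)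
    = (if a' = a then lookup w b else 0)" for a'
    by (simp add: basis_extend_def lookup_sum lookup_pscale lookup_single when_def in_keys_iff
        if_distrib cong: if_cong)
  have "lookup (pure_tensor v w) (a, b)
    = (\<Sum>a'\<in>keys v. lookup v a' * (if a' = a then lookup w b else 0))"
    unfolding pure_tensor_def
    by (subst basis_extend_def) (simp add: lookup_sum lookup_pscale inner)
  also have "\<dots> = lookup v a * lookup w b"
    by (simp add: if_distrib in_keys_iff cong: if_cong)
  finally show ?thesis .
qed

lemma lin_pure_tensor_right: "lin (pure_tensor v)"
  by (rule linI) (auto intro!: poly_mapping_eqI simp: lookup_pure_tensor lookup_add lookup_pscale algebra_simps)

lemma lin_pure_tensor_left: "lin (\<lambda>v. pure_tensor v w)"
  by (rule linI) (auto intro!: poly_mapping_eqI simp: lookup_pure_tensor lookup_add lookup_pscale algebra_simps)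

lemma pure_tensor_bv: "pure_tensor (bv a) (bv b) = bv (a, b)"
  by (auto intro!: poly_mapping_eqI simp: lookup_pure_tensor lookup_single when_def)

lemma pure_tensor_eq_0_iff: "pure_tensor v w = 0 \<longleftrightarrow> v = 0 \<or> w = 0"
proof -
  have "v = 0 \<or> w = 0" if "pure_tensor v w = 0"
  proof (rule ccontr)
    assume "\<not> ?thesis"
    then obtain a b where "lookup v a \<noteq> 0" "lookup w b \<noteq> 0"
      by (metis poly_mapping_eqI lookup_zero)
    then show False using that lookup_pure_tensor[of v w a b] by simp
  qed
  then show ?thesis using lin_zero[OF lin_pure_tensor_left, of w] lin_zero[OF lin_pure_tensor_right, of v]
    by auto
qed

text \<open>
  The tensor product of two linear maps, the second operation being the map out of a direct sum
  that is given on both summands (\<open>dsum_case\<close> below). Both are defined by the values on basis vectors, in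
  the form in which the actions on tensor products and direct sums of gliders are given.
\<close>

definition tensor_map ::
  "(('a \<Rightarrow>\<^sub>0 'k::field) \<Rightarrow> ('c \<Rightarrow>\<^sub>0 'k)) \<Rightarrow> (('b \<Rightarrow>\<^sub>0 'k) \<Rightarrow> ('d \<Rightarrow>\<^sub>0 'k)) \<Rightarrow> ('a \<times> 'b \<Rightarrow>\<^sub>0 'k) \<Rightarrow> ('c \<times> 'd \<Rightarrow>\<^sub>0 'k)"
  where "tensor_map f g = basis_extend (\<lambda>(a, b). pure_tensor (f (bv a)) (g (bv b)))"

lemma lin_tensor_map: "lin (tensor_map f g)"
  unfolding tensor_map_def by (rule lin_basis_extend)

lemma bilinear_eqI:
  assumes "\<And>w. lin (\<lambda>v. f v w)" "\<And>v. lin (f v)" "\<And>w. lin (\<lambda>v. g v w)" "\<And>v. lin (g v)"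
    and "\<And>a b. f (bv a) (bv b) = g (bv a) (bv b)"
  shows "f v w = g v w"
proof (rule lin_eqI[of "\<lambda>v. f v w" "\<lambda>v. g v w", OF assms(1) assms(3)])
  show "f (bv a) w = g (bv a) w" for a
    by (rule lin_eqI[OF assms(2) assms(4)]) (rule assms(5))
qed

lemma tensor_map_pure:
  assumes "lin f" "lin g"
  shows "tensor_map f g (pure_tensor v w) = pure_tensor (f v) (g w)"
proof (rule bilinear_eqI[where f = "\<lambda>v w. tensor_map f g (pure_tensor v w)"])
  show "tensor_map f g (pure_tensor (bv a) (bv b)) = pure_tensor (f (bv a)) (g (bv b))" for a b
    by (simp add: pure_tensor_bv tensor_map_def)
qed (intro lin_comp[OF lin_tensor_map] lin_pure_tensor_left lin_pure_tensor_right
     lin_comp[OF lin_pure_tensor_left assms(1)] lin_comp[OF lin_pure_tensor_right assms(2)])+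

lemma subspace_tensor_space: "pm.subspace (tensor_space V W)"
  unfolding tensor_space_def by (rule pm.subspace_span)

lemma pure_in_tensor_space: "v \<in> V \<Longrightarrow> w \<in> W \<Longrightarrow> pure_tensor v w \<in> tensor_space V W"
  unfolding tensor_space_def by (rule pm.span_base) blast

lemma lin_tensor_subset:
  assumes "lin f" "pm.subspace S" "\<And>v w. v \<in> V \<Longrightarrow> w \<in> W \<Longrightarrow> f (pure_tensor v w) \<in> S"
    and "z \<in> tensor_space V W"
  shows "f z \<in> S"
  using assms(4) unfolding tensor_space_def
  by (rule lin_span_subset[OF assms(1,2), rotated]) (use assms(3) in blast)

lemma lin_eq_on_tensor:
  assumes "lin f" "lin g" "\<And>v w. v \<in> V \<Longrightarrow> w \<in> W \<Longrightarrow> f (pure_tensor v w) = g (pure_tensor v w)"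
    and "z \<in> tensor_space V W"
  shows "f z = g z"
  using assms(4) unfolding tensor_space_def
  by (rule lin_eq_on_span[OF assms(1,2), rotated]) (use assms(3) in blast)

lemma tensor_space_span:
  "tensor_space (pm.span B) (pm.span C) = pm.span {pure_tensor b c | b c. b \<in> B \<and> c \<in> C}" (is "_ = ?S")
proof
  have 1: "pure_tensor b w \<in> ?S" if "b \<in> B" "w \<in> pm.span C" for b w
    by (rule lin_span_subset[OF lin_pure_tensor_right pm.subspace_span _ that(2)])
      (use that(1) in \<open>blast intro: pm.span_base\<close>)
  have 2: "pure_tensor v w \<in> ?S" if "v \<in> pm.span B" "w \<in> pm.span C" for v w
    by (rule lin_span_subset[OF lin_pure_tensor_left pm.subspace_span _ that(1)])
      (use that(2) 1 in blast)
  show "tensor_space (pm.span B) (pm.span C) \<subseteq> ?S"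
    unfolding tensor_space_def by (rule pm.span_minimal) (auto intro: 2)
  show "?S \<subseteq> tensor_space (pm.span B) (pm.span C)"
    by (rule pm.span_minimal) (auto intro: pm.span_base pure_in_tensor_space subspace_tensor_space)
qed

lemma findim_tensor:
  assumes "findim V" "findim W" shows "findim (tensor_space V W)"
proof -
  obtain B C where BC: "finite B" "V = pm.span B" "finite C" "W = pm.span C"
    using assms unfolding findim_def by blast
  have "{pure_tensor b c | b c. b \<in> B \<and> c \<in> C} = (\<lambda>(b, c). pure_tensor b c) ` (B \<times> C)" by auto
  with BC show ?thesis by (simp add: tensor_space_span findim_span)
qed

lemma tensor_space_mono: "V \<subseteq> V' \<Longrightarrow> W \<subseteq> W' \<Longrightarrow> tensor_space V W \<subseteq> tensor_space V' W'"
  unfolding tensor_space_def by (rule pm.span_mono) blast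

lemma tensor_space_zero:
  assumes "V = {0} \<or> W = {0}" "0 \<in> V" "0 \<in> W"
  shows "tensor_space V W = {0}"
proof -
  have "{pure_tensor v w | v w. v \<in> V \<and> w \<in> W} = {0}"
    using assms by (force simp: pure_tensor_eq_0_iff)
  then show ?thesis by (simp add: tensor_space_def)
qed

subsection \<open>Direct sums\<close>

lemma lookup_pm_inl: "lookup (pm_inl v) x = (case x of Inl a \<Rightarrow> lookup v a | Inr _ \<Rightarrow> 0)"
  by (auto simp: pm_inl_def basis_extend_def lookup_sum lookup_pscale lookup_single when_def in_keys_iff
        if_distrib split: sum.split cong: if_cong)

lemma lookup_pm_inr: "lookup (pm_inr v) x = (case x of Inr a \<Rightarrow> lookup v a | Inl _ \<Rightarrow> 0)"
  by (auto simp: pm_inr_def basis_extend_def lookup_sum lookup_pscale lookup_single when_def in_keys_iff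
        if_distrib split: sum.split cong: if_cong)

lemma lin_pm_inl: "lin pm_inl" and lin_pm_inr: "lin pm_inr"
  unfolding pm_inl_def pm_inr_def by (rule lin_basis_extend)+

lemma pm_sum_eq_iff: "pm_inl v + pm_inr w = pm_inl v' + pm_inr w' \<longleftrightarrow> v = v' \<and> w = w'"
proof -
  have "v = v' \<and> w = w'" if "pm_inl v + pm_inr w = pm_inl v' + pm_inr w'"
  proof -
    have "lookup (pm_inl v + pm_inr w) x = lookup (pm_inl v' + pm_inr w') x" for x
      using that by simp
    from this[of "Inl _"] this[of "Inr _"] show ?thesis
      by (auto intro!: poly_mapping_eqI simp: lookup_add lookup_pm_inl lookup_pm_inr)
  qed
  then show ?thesis by auto
qed

definition dsum_case ::
  "(('a \<Rightarrow>\<^sub>0 'k::field) \<Rightarrow> ('c \<Rightarrow>\<^sub>0 'k)) \<Rightarrow> (('b \<Rightarrow>\<^sub>0 'k) \<Rightarrow> ('c \<Rightarrow>\<^sub>0 'k)) \<Rightarrow> ('a + 'b \<Rightarrow>\<^sub>0 'k) \<Rightarrow> ('c \<Rightarrow>\<^sub>0 'k)"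
  where "dsum_case f g = basis_extend (case_sum (\<lambda>a. f (bv a)) (\<lambda>b. g (bv b)))"

lemma lin_dsum_case: "lin (dsum_case f g)"
  unfolding dsum_case_def by (rule lin_basis_extend)

lemma dsum_case_inl: assumes "lin f" shows "dsum_case f g (pm_inl v) = f v"
  by (rule lin_eqI[OF lin_comp[OF lin_dsum_case lin_pm_inl] assms])
    (simp add: pm_inl_def dsum_case_def)

lemma dsum_case_inr: assumes "lin g" shows "dsum_case f g (pm_inr v) = g v"
  by (rule lin_eqI[OF lin_comp[OF lin_dsum_case lin_pm_inr] assms])
    (simp add: pm_inr_def dsum_case_def)

lemma dsum_case_sum:
  "lin f \<Longrightarrow> lin g \<Longrightarrow> dsum_case f g (pm_inl v + pm_inr w) = f v + g w"
  by (simp add: lin_add[OF lin_dsum_case] dsum_case_inl dsum_case_inr)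

lemma dsum_space_eq_image: "dsum_space V W = (\<lambda>(v, w). pm_inl v + pm_inr w) ` (V \<times> W)"
  unfolding dsum_space_def by auto

lemma subspace_dsum_space:
  assumes "pm.subspace V" "pm.subspace W"
  shows "pm.subspace (dsum_space V W)"
proof -
  have "dsum_space V W = {x + y |x y. x \<in> pm_inl ` V \<and> y \<in> pm_inr ` W}"
    unfolding dsum_space_def by blast
  then show ?thesis
    using pm.subspace_sums[OF subspace_lin_image[OF lin_pm_inl assms(1)] subspace_lin_image[OF lin_pm_inr assms(2)]]
    by simp
qed

lemma dsum_space_span: "dsum_space (pm.span B) (pm.span C) = pm.span (pm_inl ` B \<union> pm_inr ` C)"
  unfolding pm.span_Un pmp.linear_span_image[OF lin_pm_inl] pmp.linear_span_image[OF lin_pm_inr]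
    dsum_space_def by blast

lemma findim_dsum:
  assumes "findim V" "findim W" shows "findim (dsum_space V W)"
proof -
  obtain B C where BC: "finite B" "V = pm.span B" "finite C" "W = pm.span C"
    using assms unfolding findim_def by blast
  then show ?thesis by (simp add: dsum_space_span findim_span)
qed

subsection \<open>Relabelling the basis\<close>

text \<open>
  The canonical isomorphisms between iterated tensor products and direct sums of free spaces only
  rename basis vectors.
\<close>

definition relabel :: "('a \<Rightarrow> 'b) \<Rightarrow> ('a \<Rightarrow>\<^sub>0 'r::comm_ring_1) \<Rightarrow> ('b \<Rightarrow>\<^sub>0 'r)" where
  "relabel e = basis_extend (\<lambda>a. bv (e a))"

lemma lin_relabel: "lin (relabel e)"
  unfolding relabel_def by (rule lin_basis_extend)

lemma relabel_single [simp]: "relabel e (single a c) = single (e a) c"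
  by (simp add: relabel_def pscale_single)

lemma relabel_add: "relabel e (v + w) = relabel e v + relabel e w"
  by (simp add: relabel_def basis_extend_add)

lemma relabel_inverse:
  assumes "\<And>a. a \<in> keys v \<Longrightarrow> e' (e a) = a"
  shows "relabel e' (relabel e v) = v"
  using subset_refl
proof (induction v rule: supported_induct[where A = "keys v"])
  case zero
  show ?case by (simp add: relabel_def)
qed (simp add: relabel_add assms)

lemma keys_relabel:
  assumes "keys v \<subseteq> A"
  shows "keys (relabel e v) \<subseteq> e ` A"
  using assms
proof (induction v rule: supported_induct)
  case zero
  show ?case by (simp add: relabel_def)
next
  case (add a c f)
  then show ?case by (simp add: relabel_add keys_add_subset)
qed

lemma lookup_relabel:
  assumes "inj e"
  shows "lookup (relabel e v) (e a) = lookup v a"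
  using assms
  by (simp add: relabel_def basis_extend_def lookup_sum lookup_pscale lookup_single when_def inj_eq
      in_keys_iff if_distrib cong: if_cong)

section \<open>Gliders\<close>

lemma monoid_algebra_simps [simp]:
  "carrier (monoid_algebra R M) = {f. keys f \<subseteq> carrier M}"
  "monoid.one (monoid_algebra R M) = single \<one>\<^bsub>M\<^esub> 1"
  "zero (monoid_algebra R M) = 0"
  "add (monoid_algebra R M) = (+)"
  by (simp_all add: monoid_algebra_def)

lemma kg_act_bv [simp]: "kg_act \<rho> (bv g) v = \<rho> g v"
  by (simp add: kg_act_def)

text \<open>
  The group elements span the group algebra.
\<close>

lemma kg_act_closed_iff:
  fixes S :: "('b \<Rightarrow>\<^sub>0 'k::field) set"
  assumes "pm.subspace S"
  shows "(\<forall>x\<in>carrier (monoid_algebra TYPE('k) G). kg_act \<rho> x m \<in> S) \<longleftrightarrow> (\<forall>g\<in>carrier G. \<rho> g m \<in> S)"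
    (is "?L \<longleftrightarrow> ?R")
proof
  assume L: ?L
  show ?R
  proof
    fix g assume "g \<in> carrier G"
    then show "\<rho> g m \<in> S" using L[rule_format, of "bv g"] by simp
  qed
next
  assume ?R
  then show ?L
    unfolding kg_act_def basis_extend_def
    by (auto intro!: pm.subspace_sum[OF assms] pm.subspace_scale[OF assms])
qed

lemma is_glider_iff:
  "is_glider G M \<longleftrightarrow>
     kg_module G (Omega M) (act M) \<and>
     pm.subspace (lev1 M) \<and> pm.subspace (lev0 M) \<and> findim (lev1 M) \<and> findim (lev0 M) \<and>
     lev1 M \<subseteq> lev0 M \<and> lev0 M \<subseteq> Omega M \<and>
     (\<forall>g\<in>carrier G. \<forall>m\<in>lev1 M. act M g m \<in> lev0 M)"
  unfolding is_glider_def using kg_act_closed_iff[of "lev0 M" G "act M"] by blast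

lemma is_gliderI:
  assumes "pm.subspace (Omega M)" "\<And>g. g \<in> carrier G \<Longrightarrow> lin (act M g)"
    "\<And>g v. g \<in> carrier G \<Longrightarrow> v \<in> Omega M \<Longrightarrow> act M g v \<in> Omega M"
    "\<And>v. v \<in> Omega M \<Longrightarrow> act M \<one>\<^bsub>G\<^esub> v = v"
    "\<And>g h v. g \<in> carrier G \<Longrightarrow> h \<in> carrier G \<Longrightarrow> v \<in> Omega M \<Longrightarrow>
       act M (g \<otimes>\<^bsub>G\<^esub> h) v = act M g (act M h v)"
    "pm.subspace (lev1 M)" "pm.subspace (lev0 M)" "findim (lev0 M)"
    "\<And>v. v \<in> lev1 M \<Longrightarrow> v \<in> lev0 M" "\<And>v. v \<in> lev0 M \<Longrightarrow> v \<in> Omega M"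
    "\<And>g m. g \<in> carrier G \<Longrightarrow> m \<in> lev1 M \<Longrightarrow> act M g m \<in> lev0 M"
  shows "is_glider G M"
  unfolding is_glider_iff kg_module_def
  using assms findim_subspace[of "lev0 M" "lev1 M"] by (auto simp: subset_iff)

lemma gliderD:
  assumes "is_glider G M"
  shows "pm.subspace (Omega M)" "pm.subspace (lev1 M)" "pm.subspace (lev0 M)"
    "findim (lev1 M)" "findim (lev0 M)"
    "\<And>g. g \<in> carrier G \<Longrightarrow> lin (act M g)"
    "\<And>g v. g \<in> carrier G \<Longrightarrow> v \<in> Omega M \<Longrightarrow> act M g v \<in> Omega M"
    "\<And>v. v \<in> Omega M \<Longrightarrow> act M \<one>\<^bsub>G\<^esub> v = v"
    "\<And>g h v. g \<in> carrier G \<Longrightarrow> h \<in> carrier G \<Longrightarrow> v \<in> Omega M \<Longrightarrow>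
       act M (g \<otimes>\<^bsub>G\<^esub> h) v = act M g (act M h v)"
    "\<And>v. v \<in> lev1 M \<Longrightarrow> v \<in> lev0 M" "\<And>v. v \<in> lev0 M \<Longrightarrow> v \<in> Omega M"
    "\<And>v. v \<in> lev1 M \<Longrightarrow> v \<in> Omega M"
    "\<And>g m. g \<in> carrier G \<Longrightarrow> m \<in> lev1 M \<Longrightarrow> act M g m \<in> lev0 M"
  using assms unfolding is_glider_iff kg_module_def subset_iff image_subset_iff by blast+

subsection \<open>Isomorphisms\<close>

lemma lin_kg_act:
  assumes "lin f" "\<And>g. g \<in> carrier G \<Longrightarrow> f (\<rho> g m) = \<sigma> g (f m)" "keys x \<subseteq> carrier G"
  shows "f (kg_act \<rho> x m) = kg_act \<sigma> x (f m)"
  unfolding kg_act_def basis_extend_def lin_sum[OF assms(1)] lin_scale[OF assms(1)]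
  using assms by (intro sum.cong) auto

lemma glider_isoI:
  fixes M :: "('g, 'a, 'k::field) glider" and N :: "('g, 'b, 'k) glider"
  assumes M: "is_glider G M" and N: "is_glider G N" and f: "lin f" and h: "lin h"
    and f1: "\<And>v. v \<in> lev1 M \<Longrightarrow> f v \<in> lev1 N" and f0: "\<And>v. v \<in> lev0 M \<Longrightarrow> f v \<in> lev0 N"
    and h1: "\<And>v. v \<in> lev1 N \<Longrightarrow> h v \<in> lev1 M" and h0: "\<And>v. v \<in> lev0 N \<Longrightarrow> h v \<in> lev0 M"
    and hf: "\<And>v. v \<in> lev0 M \<Longrightarrow> h (f v) = v" and fh: "\<And>v. v \<in> lev0 N \<Longrightarrow> f (h v) = v"
    and eq: "\<And>g m. g \<in> carrier G \<Longrightarrow> m \<in> lev1 M \<Longrightarrow> f (act M g m) = act N g (f m)"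
  shows "glider_iso G M N"
proof -
  have eqh: "h (act N g m) = act M g (h m)" if "g \<in> carrier G" "m \<in> lev1 N" for g m
  proof -
    have "h (act N g m) = h (f (act M g (h m)))"
      using that eq[of g "h m"] h1 fh[of m] gliderD(10)[OF N] by simp
    also have "\<dots> = act M g (h m)"
      using that h1 by (intro hf gliderD(13)[OF M])
    finally show ?thesis .
  qed
  show ?thesis
    unfolding glider_iso_def glider_mor_def using assms
    by (intro exI[of _ f] exI[of _ h])
      (auto simp: lin_add lin_scale intro!: lin_kg_act[OF f] lin_kg_act[OF h] eqh)
qed

text \<open>
  Maps that are linear on the whole ambient spaces can be tensored and added basis vector by basis
  vector, which a map given on level 0 only cannot.
\<close>

definition linear_iso_pair ::
  "('g, 'x) monoid_scheme \<Rightarrow> ('g, 'a, 'k::field) glider \<Rightarrow> ('g, 'b, 'k) glider \<Rightarrow>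
   (('a \<Rightarrow>\<^sub>0 'k) \<Rightarrow> ('b \<Rightarrow>\<^sub>0 'k)) \<Rightarrow> (('b \<Rightarrow>\<^sub>0 'k) \<Rightarrow> ('a \<Rightarrow>\<^sub>0 'k)) \<Rightarrow> bool" where
  "linear_iso_pair G M N f h \<longleftrightarrow> lin f \<and> lin h \<and>
     (\<forall>v\<in>lev1 M. f v \<in> lev1 N) \<and> (\<forall>v\<in>lev0 M. f v \<in> lev0 N) \<and>
     (\<forall>v\<in>lev1 N. h v \<in> lev1 M) \<and> (\<forall>v\<in>lev0 N. h v \<in> lev0 M) \<and>
     (\<forall>v\<in>lev0 M. h (f v) = v) \<and> (\<forall>v\<in>lev0 N. f (h v) = v) \<and>
     (\<forall>g\<in>carrier G. \<forall>m\<in>lev1 M. f (act M g m) = act N g (f m)) \<and>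
     (\<forall>g\<in>carrier G. \<forall>m\<in>lev1 N. h (act N g m) = act M g (h m))"

lemma linear_iso_pairD:
  assumes "linear_iso_pair G M N f h"
  shows "lin f" "lin h"
    "\<And>v. v \<in> lev1 M \<Longrightarrow> f v \<in> lev1 N" "\<And>v. v \<in> lev0 M \<Longrightarrow> f v \<in> lev0 N"
    "\<And>v. v \<in> lev1 N \<Longrightarrow> h v \<in> lev1 M" "\<And>v. v \<in> lev0 N \<Longrightarrow> h v \<in> lev0 M"
    "\<And>v. v \<in> lev0 M \<Longrightarrow> h (f v) = v" "\<And>v. v \<in> lev0 N \<Longrightarrow> f (h v) = v"
    "\<And>g m. g \<in> carrier G \<Longrightarrow> m \<in> lev1 M \<Longrightarrow> f (act M g m) = act N g (f m)"
    "\<And>g m. g \<in> carrier G \<Longrightarrow> m \<in> lev1 N \<Longrightarrow> h (act N g m) = act M g (h m)"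
  using assms unfolding linear_iso_pair_def by blast+

lemma glider_morD:
  fixes M :: "('g, 'a, 'k::field) glider" and N :: "('g, 'b, 'k) glider"
  assumes "glider_mor G M N f"
  shows "v \<in> lev0 M \<Longrightarrow> f v \<in> lev0 N" "v \<in> lev1 M \<Longrightarrow> f v \<in> lev1 N"
    "u \<in> lev0 M \<Longrightarrow> v \<in> lev0 M \<Longrightarrow> f (u + v) = f u + f v"
    "v \<in> lev0 M \<Longrightarrow> f (pscale c v) = pscale c (f v)"
    "x \<in> carrier (monoid_algebra TYPE('k) G) \<Longrightarrow> m \<in> lev1 M \<Longrightarrow>
       f (kg_act (act M) x m) = kg_act (act N) x (f m)"
proof -
  note mor = assms[unfolded glider_mor_def]
  note 1 = mor[THEN conjunct1] and 2 = mor[THEN conjunct2]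
  note 3 = 2[THEN conjunct2] note 4 = 3[THEN conjunct2] note 5 = 4[THEN conjunct2]
  show "v \<in> lev0 M \<Longrightarrow> f v \<in> lev0 N" using 1 by (rule funcset_mem)
  show "v \<in> lev1 M \<Longrightarrow> f v \<in> lev1 N" using 4[THEN conjunct1] by (rule subsetD[OF _ imageI])
  show "u \<in> lev0 M \<Longrightarrow> v \<in> lev0 M \<Longrightarrow> f (u + v) = f u + f v"
    by (rule 2[THEN conjunct1, rule_format])
  show "v \<in> lev0 M \<Longrightarrow> f (pscale c v) = pscale c (f v)"
    by (rule 3[THEN conjunct1, rule_format])
  show "x \<in> carrier (monoid_algebra TYPE('k) G) \<Longrightarrow> m \<in> lev1 M \<Longrightarrow>
       f (kg_act (act M) x m) = kg_act (act N) x (f m)"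
    by (rule 5[rule_format])
qed

text \<open>
  The two morphisms of an isomorphism are replaced by linear extensions to the ambient spaces.
\<close>

lemma glider_isoE:
  fixes M :: "('g, 'a, 'k::field) glider" and N :: "('g, 'b, 'k) glider"
  assumes iso: "glider_iso G M N" and M: "is_glider G M" and N: "is_glider G N"
  obtains f h where "linear_iso_pair G M N f h"
proof -
  obtain f h where mor: "glider_mor G M N f" "glider_mor G N M h"
    and inv: "\<forall>v\<in>lev0 M. h (f v) = v" "\<forall>v\<in>lev0 N. f (h v) = v"
    using iso unfolding glider_iso_def by blast
  note mf = glider_morD[OF mor(1)] and mh = glider_morD[OF mor(2)]
  obtain F where F: "lin F" "\<And>v. v \<in> lev0 M \<Longrightarrow> F v = f v"
    by (rule extend_to_lin[OF gliderD(3)[OF M] mf(3) mf(4)]) blast+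
  obtain E where E: "lin E" "\<And>v. v \<in> lev0 N \<Longrightarrow> E v = h v"
    by (rule extend_to_lin[OF gliderD(3)[OF N] mh(3) mh(4)]) blast+
  have carr: "bv g \<in> carrier (monoid_algebra TYPE('k) G)" if "g \<in> carrier G" for g
    using that by simp
  have feq: "f (act M g m) = act N g (f m)" if "g \<in> carrier G" "m \<in> lev1 M" for g m
  proof -
    have "f (kg_act (act M) (bv g) m) = kg_act (act N) (bv g) (f m)"
      by (rule mf(5)[OF carr[OF that(1)] that(2)])
    then show ?thesis by simp
  qed
  have heq: "h (act N g m) = act M g (h m)" if "g \<in> carrier G" "m \<in> lev1 N" for g m
  proof -
    have "h (kg_act (act N) (bv g) m) = kg_act (act M) (bv g) (h m)"
      by (rule mh(5)[OF carr[OF that(1)] that(2)])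
    then show ?thesis by simp
  qed
  show ?thesis
    by (rule that[of F E], unfold linear_iso_pair_def)
      (simp add: F E mf(1,2) mh(1,2) inv feq heq gliderD(10,13)[OF M] gliderD(10,13)[OF N])
qed

lemma glider_iso_refl: "is_glider G M \<Longrightarrow> glider_iso G M M"
  by (rule glider_isoI[OF _ _ lin_id lin_id]) simp_all

lemma glider_iso_sym: "glider_iso G M N \<Longrightarrow> glider_iso G N M"
  unfolding glider_iso_def by blast

lemma glider_iso_trans:
  assumes "glider_iso G M N" "glider_iso G N P" "is_glider G M" "is_glider G N" "is_glider G P"
  shows "glider_iso G M P"
proof -
  obtain f h where "linear_iso_pair G M N f h"
    using glider_isoE[OF assms(1,3,4)] by blast
  note f = linear_iso_pairD[OF this]
  obtain f' h' where "linear_iso_pair G N P f' h'"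
    using glider_isoE[OF assms(2,4,5)] by blast
  note f' = linear_iso_pairD[OF this]
  show ?thesis
    by (rule glider_isoI[OF assms(3,5) lin_comp[OF f'(1) f(1)] lin_comp[OF f(2) f'(2)]])
      (simp_all add: f f')
qed

lemma glider_iso_relabel:
  assumes M: "is_glider G M" and N: "is_glider G N"
    and inv: "\<And>x. e' (e x) = x" "\<And>y. e (e' y) = y"
    and "\<And>v. v \<in> lev1 M \<Longrightarrow> relabel e v \<in> lev1 N" "\<And>v. v \<in> lev0 M \<Longrightarrow> relabel e v \<in> lev0 N"
    "\<And>v. v \<in> lev1 N \<Longrightarrow> relabel e' v \<in> lev1 M" "\<And>v. v \<in> lev0 N \<Longrightarrow> relabel e' v \<in> lev0 M"
    "\<And>g m. g \<in> carrier G \<Longrightarrow> m \<in> lev1 M \<Longrightarrow> relabel e (act M g m) = act N g (relabel e m)"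
  shows "glider_iso G M N"
  by (rule glider_isoI[OF M N lin_relabel lin_relabel])
    (use assms in \<open>auto intro: relabel_inverse\<close>)

text \<open>
  The action is conjugated by \<open>L\<close> and \<open>R\<close>. As these are inverse to each other on the module, but perhaps
  not on the ambient space, basis vectors that the module does not involve can be dropped.
\<close>

lemma is_glider_transport:
  fixes M :: "('g, 'a, 'k::field) glider"
  assumes M: "is_glider G M" and L: "lin L" and R: "lin R" and RL: "\<And>v. v \<in> Omega M \<Longrightarrow> R (L v) = v"
  defines "N \<equiv> \<lparr>Omega = L ` Omega M, act = (\<lambda>g v. L (act M g (R v))), lev1 = L ` lev1 M, lev0 = L ` lev0 M\<rparr>"
  shows "is_glider G N" "glider_iso G N M"
proof -
  note D = gliderD[OF M]
  show N: "is_glider G N"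
    unfolding N_def using D RL
    by (intro is_gliderI) (auto intro!: subspace_lin_image[OF L] findim_image[OF L] lin_comp[OF L] lin_comp[OF _ R])
  show "glider_iso G N M"
    by (rule glider_isoI[OF N M R L]) (use D RL in \<open>auto simp: N_def\<close>)
qed

subsection \<open>Direct sums and tensor products of gliders\<close>

lemma glider_tensor_simps [simp]:
  "Omega (glider_tensor M N) = tensor_space (Omega M) (Omega N)"
  "lev1 (glider_tensor M N) = tensor_space (lev1 M) (lev1 N)"
  "lev0 (glider_tensor M N) = tensor_space (lev0 M) (lev0 N)"
  "act (glider_tensor M N) g = tensor_map (act M g) (act N g)"
  by (simp_all add: glider_tensor_def tensor_map_def)

lemma glider_dsum_simps [simp]:
  "Omega (glider_dsum M N) = dsum_space (Omega M) (Omega N)"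
  "lev1 (glider_dsum M N) = dsum_space (lev1 M) (lev1 N)"
  "lev0 (glider_dsum M N) = dsum_space (lev0 M) (lev0 N)"
  "act (glider_dsum M N) g = dsum_case (\<lambda>v. pm_inl (act M g v)) (\<lambda>v. pm_inr (act N g v))"
  by (simp_all add: glider_dsum_def dsum_case_def)

lemma (in monoid) is_glider_tensor:
  assumes M: "is_glider G M" and N: "is_glider G N"
  shows "is_glider G (glider_tensor M N)"
proof -
  note D = gliderD[OF M] gliderD[OF N]
  have pure: "tensor_map (act M g) (act N g) (pure_tensor u w) = pure_tensor (act M g u) (act N g w)"
    if "g \<in> carrier G" for g u w
    using D that by (simp add: tensor_map_pure)
  show ?thesis
  proof (rule is_gliderI, unfold glider_tensor_simps)
    show "lin (tensor_map (act M g) (act N g))" for g by (rule lin_tensor_map)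
    show "tensor_map (act M g) (act N g) v \<in> tensor_space (Omega M) (Omega N)"
      if "g \<in> carrier G" "v \<in> tensor_space (Omega M) (Omega N)" for g v
      by (rule lin_tensor_subset[OF lin_tensor_map subspace_tensor_space _ that(2)])
        (simp add: D that(1) pure pure_in_tensor_space)
    show "tensor_map (act M g) (act N g) v \<in> tensor_space (lev0 M) (lev0 N)"
      if "g \<in> carrier G" "v \<in> tensor_space (lev1 M) (lev1 N)" for g v
      by (rule lin_tensor_subset[OF lin_tensor_map subspace_tensor_space _ that(2)])
        (simp add: D that(1) pure pure_in_tensor_space)
    show "tensor_map (act M \<one>) (act N \<one>) v = v" if "v \<in> tensor_space (Omega M) (Omega N)" for v
      by (rule lin_eq_on_tensor[OF lin_tensor_map lin_id _ that]) (simp add: pure D)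
    show "tensor_map (act M (g \<otimes> h)) (act N (g \<otimes> h)) v =
        tensor_map (act M g) (act N g) (tensor_map (act M h) (act N h) v)"
      if "g \<in> carrier G" "h \<in> carrier G" "v \<in> tensor_space (Omega M) (Omega N)" for g h v
      by (rule lin_eq_on_tensor[OF lin_tensor_map lin_comp[OF lin_tensor_map lin_tensor_map] _ that(3)])
        (simp add: pure D that(1,2))
    have "tensor_space (lev1 M) (lev1 N) \<subseteq> tensor_space (lev0 M) (lev0 N)"
         "tensor_space (lev0 M) (lev0 N) \<subseteq> tensor_space (Omega M) (Omega N)"
      by (intro tensor_space_mono subsetI; simp add: D)+
    then show "v \<in> tensor_space (lev1 M) (lev1 N) \<Longrightarrow> v \<in> tensor_space (lev0 M) (lev0 N)"
      "v \<in> tensor_space (lev0 M) (lev0 N) \<Longrightarrow> v \<in> tensor_space (Omega M) (Omega N)" for v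
      by blast+
  qed (intro subspace_tensor_space findim_tensor D)+
qed

lemma dsum_spaceE:
  assumes "x \<in> dsum_space V W"
  obtains v w where "x = pm_inl v + pm_inr w" "v \<in> V" "w \<in> W"
  using assms unfolding dsum_space_def by blast

lemma dsum_spaceI: "v \<in> V \<Longrightarrow> w \<in> W \<Longrightarrow> pm_inl v + pm_inr w \<in> dsum_space V W"
  unfolding dsum_space_def by blast

lemma (in monoid) is_glider_dsum:
  assumes M: "is_glider G M" and N: "is_glider G N"
  shows "is_glider G (glider_dsum M N)"
proof -
  note D = gliderD[OF M] gliderD[OF N]
  have pure: "dsum_case (\<lambda>v. pm_inl (act M g v)) (\<lambda>v. pm_inr (act N g v)) (pm_inl u + pm_inr w)
      = pm_inl (act M g u) + pm_inr (act N g w)"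
    if "g \<in> carrier G" for g u w
    using D that by (simp add: dsum_case_sum lin_comp lin_pm_inl lin_pm_inr)
  show ?thesis
  proof (rule is_gliderI, unfold glider_dsum_simps)
    show "lin (dsum_case (\<lambda>v. pm_inl (act M g v)) (\<lambda>v. pm_inr (act N g v)))" for g
      by (rule lin_dsum_case)
  qed (auto simp: pure D intro!: subspace_dsum_space findim_dsum dsum_spaceI elim!: dsum_spaceE)
qed

lemma tensor_map_into:
  assumes "lin f" "lin g" "\<And>v. v \<in> V \<Longrightarrow> f v \<in> V'" "\<And>v. v \<in> W \<Longrightarrow> g v \<in> W'" "z \<in> tensor_space V W"
  shows "tensor_map f g z \<in> tensor_space V' W'"
  by (rule lin_tensor_subset[OF lin_tensor_map subspace_tensor_space _ assms(5)])
    (simp add: assms tensor_map_pure pure_in_tensor_space)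

lemma (in monoid) glider_iso_tensor:
  assumes "glider_iso G M M'" "glider_iso G N N'"
    and M: "is_glider G M" "is_glider G M'" and N: "is_glider G N" "is_glider G N'"
  shows "glider_iso G (glider_tensor M N) (glider_tensor M' N')"
proof -
  obtain f h where "linear_iso_pair G M M' f h"
    using glider_isoE[OF assms(1) M] by blast
  note f = linear_iso_pairD[OF this]
  obtain f' h' where "linear_iso_pair G N N' f' h'"
    using glider_isoE[OF assms(2) N] by blast
  note f' = linear_iso_pairD[OF this]
  note D = gliderD[OF M(1)] gliderD[OF M(2)] gliderD[OF N(1)] gliderD[OF N(2)]
  show ?thesis
  proof (rule glider_isoI[OF is_glider_tensor[OF M(1) N(1)] is_glider_tensor[OF M(2) N(2)]
        lin_tensor_map[of f f'] lin_tensor_map[of h h']], unfold glider_tensor_simps)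
    show "tensor_map h h' (tensor_map f f' v) = v" if "v \<in> tensor_space (lev0 M) (lev0 N)" for v
      by (rule lin_eq_on_tensor[OF lin_comp[OF lin_tensor_map lin_tensor_map] lin_id _ that])
        (simp add: f f' tensor_map_pure)
    show "tensor_map f f' (tensor_map h h' v) = v" if "v \<in> tensor_space (lev0 M') (lev0 N')" for v
      by (rule lin_eq_on_tensor[OF lin_comp[OF lin_tensor_map lin_tensor_map] lin_id _ that])
        (simp add: f f' tensor_map_pure)
    show "tensor_map f f' (tensor_map (act M g) (act N g) m)
        = tensor_map (act M' g) (act N' g) (tensor_map f f' m)"
      if "g \<in> carrier G" "m \<in> tensor_space (lev1 M) (lev1 N)" for g m
      by (rule lin_eq_on_tensor[OF lin_comp[OF lin_tensor_map lin_tensor_map]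
            lin_comp[OF lin_tensor_map lin_tensor_map] _ that(2)])
        (simp add: f f' D that(1) tensor_map_pure)
  qed (erule tensor_map_into[rotated -1]; simp add: f f')+
qed

lemma (in monoid) glider_iso_dsum:
  assumes "glider_iso G M M'" "glider_iso G N N'"
    and M: "is_glider G M" "is_glider G M'" and N: "is_glider G N" "is_glider G N'"
  shows "glider_iso G (glider_dsum M N) (glider_dsum M' N')"
proof -
  obtain f h where "linear_iso_pair G M M' f h"
    using glider_isoE[OF assms(1) M] by blast
  note f = linear_iso_pairD[OF this]
  obtain f' h' where "linear_iso_pair G N N' f' h'"
    using glider_isoE[OF assms(2) N] by blast
  note f' = linear_iso_pairD[OF this]
  note D = gliderD[OF M(1)] gliderD[OF M(2)] gliderD[OF N(1)] gliderD[OF N(2)]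
  note ev = dsum_case_sum lin_comp[OF lin_pm_inl] lin_comp[OF lin_pm_inr]
  show ?thesis
    by (rule glider_isoI[OF is_glider_dsum[OF M(1) N(1)] is_glider_dsum[OF M(2) N(2)]
          lin_dsum_case[of "\<lambda>v. pm_inl (f v)" "\<lambda>v. pm_inr (f' v)"]
          lin_dsum_case[of "\<lambda>v. pm_inl (h v)" "\<lambda>v. pm_inr (h' v)"]], unfold glider_dsum_simps)
      (auto elim!: dsum_spaceE intro!: dsum_spaceI simp: ev f f' D)
qed

subsection \<open>Associativity, commutativity, unit and distributivity up to isomorphism\<close>

text \<open>
  Comparing coefficients of pure tensors.
\<close>

lemma relabel_assoc:
  fixes u :: "'a \<Rightarrow>\<^sub>0 'k::field" and v :: "'b \<Rightarrow>\<^sub>0 'k" and w :: "'c \<Rightarrow>\<^sub>0 'k"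
  shows "relabel (\<lambda>((a, b), c). (a, (b, c))) (pure_tensor (pure_tensor u v) w) = pure_tensor u (pure_tensor v w)"
  "relabel (\<lambda>(a, (b, c)). ((a, b), c)) (pure_tensor u (pure_tensor v w)) = pure_tensor (pure_tensor u v) w"
proof -
  have 1: "relabel (\<lambda>((a, b), c). (a, (b, c))) (pure_tensor (pure_tensor u v) w) = pure_tensor u (pure_tensor v w)"
  proof (rule poly_mapping_eqI)
    fix x :: "'a \<times> 'b \<times> 'c"
    obtain a b c where x: "x = (\<lambda>((a, b), c). (a, (b, c))) ((a, b), c)" by (cases x) auto
    show "lookup (relabel (\<lambda>((a, b), c). (a, (b, c))) (pure_tensor (pure_tensor u v) w)) x
       = lookup (pure_tensor u (pure_tensor v w)) x"
      unfolding x by (subst lookup_relabel) (auto simp: inj_def lookup_pure_tensor)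
  qed
  then show "relabel (\<lambda>((a, b), c). (a, (b, c))) (pure_tensor (pure_tensor u v) w) = pure_tensor u (pure_tensor v w)" .
  show "relabel (\<lambda>(a, (b, c)). ((a, b), c)) (pure_tensor u (pure_tensor v w)) = pure_tensor (pure_tensor u v) w"
    unfolding 1[symmetric] by (rule relabel_inverse) auto
qed

lemma tensor_space_assoc:
  "v \<in> tensor_space (tensor_space U V) W \<Longrightarrow>
     relabel (\<lambda>((a, b), c). (a, (b, c))) v \<in> tensor_space U (tensor_space V W)"
  "z \<in> tensor_space U (tensor_space V W) \<Longrightarrow>
     relabel (\<lambda>(a, (b, c)). ((a, b), c)) z \<in> tensor_space (tensor_space U V) W"
proof -
  have 1: "relabel (\<lambda>((a, b), c). (a, (b, c))) (pure_tensor z w) \<in> tensor_space U (tensor_space V W)"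
    if "z \<in> tensor_space U V" "w \<in> W" for z w
    by (rule lin_tensor_subset[OF lin_comp[OF lin_relabel lin_pure_tensor_left] subspace_tensor_space _ that(1)])
      (use that(2) in \<open>simp add: relabel_assoc pure_in_tensor_space\<close>)
  show "relabel (\<lambda>((a, b), c). (a, (b, c))) v \<in> tensor_space U (tensor_space V W)"
    if "v \<in> tensor_space (tensor_space U V) W"
    by (rule lin_tensor_subset[OF lin_relabel subspace_tensor_space 1 that])
  have 2: "relabel (\<lambda>(a, (b, c)). ((a, b), c)) (pure_tensor u z) \<in> tensor_space (tensor_space U V) W"
    if "z \<in> tensor_space V W" "u \<in> U" for z u
    by (rule lin_tensor_subset[OF lin_comp[OF lin_relabel lin_pure_tensor_right] subspace_tensor_space _ that(1)])
      (use that(2) in \<open>simp add: relabel_assoc pure_in_tensor_space\<close>)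
  show "relabel (\<lambda>(a, (b, c)). ((a, b), c)) z \<in> tensor_space (tensor_space U V) W"
    if "z \<in> tensor_space U (tensor_space V W)"
    by (rule lin_tensor_subset[OF lin_relabel subspace_tensor_space 2 that])
qed

lemma (in monoid) glider_tensor_assoc:
  assumes M: "is_glider G M" and N: "is_glider G N" and P: "is_glider G P"
  shows "glider_iso G (glider_tensor (glider_tensor M N) P) (glider_tensor M (glider_tensor N P))"
proof (rule glider_iso_relabel[where e = "\<lambda>((a, b), c). (a, (b, c))" and e' = "\<lambda>(a, (b, c)). ((a, b), c)"])
  note D = gliderD[OF M] gliderD[OF N] gliderD[OF P]
  fix g m assume g: "g \<in> carrier G"
  show "relabel (\<lambda>((a, b), c). (a, (b, c))) (act (glider_tensor (glider_tensor M N) P) g m)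
    = act (glider_tensor M (glider_tensor N P)) g (relabel (\<lambda>((a, b), c). (a, (b, c))) m)"
    unfolding glider_tensor_simps
    by (rule lin_eqI[OF lin_comp[OF lin_relabel lin_tensor_map] lin_comp[OF lin_tensor_map lin_relabel]])
      (auto simp: pure_tensor_bv[symmetric] relabel_assoc tensor_map_pure lin_tensor_map D g)
qed (auto simp: tensor_space_assoc assms is_glider_tensor)

lemma relabel_swap:
  fixes v :: "'a \<Rightarrow>\<^sub>0 'k::field" and w :: "'b \<Rightarrow>\<^sub>0 'k"
  shows "relabel prod.swap (pure_tensor v w) = pure_tensor w v"
proof (rule poly_mapping_eqI)
  fix x :: "'b \<times> 'a"
  obtain a b where x: "x = prod.swap (a, b)" by (cases x) auto
  show "lookup (relabel prod.swap (pure_tensor v w)) x = lookup (pure_tensor w v) x"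
    unfolding x by (subst lookup_relabel) (auto simp: lookup_pure_tensor)
qed

lemma tensor_space_swap: "z \<in> tensor_space V W \<Longrightarrow> relabel prod.swap z \<in> tensor_space W V"
  by (rule lin_tensor_subset[OF lin_relabel subspace_tensor_space])
    (simp_all add: relabel_swap pure_in_tensor_space)

lemma (in monoid) glider_tensor_comm:
  assumes M: "is_glider G M" and N: "is_glider G N"
  shows "glider_iso G (glider_tensor M N) (glider_tensor N M)"
proof (rule glider_iso_relabel[where e = prod.swap and e' = prod.swap])
  note D = gliderD[OF M] gliderD[OF N]
  fix g m assume g: "g \<in> carrier G"
  show "relabel prod.swap (act (glider_tensor M N) g m) = act (glider_tensor N M) g (relabel prod.swap m)"
    unfolding glider_tensor_simps
    by (rule lin_eqI[OF lin_comp[OF lin_relabel lin_tensor_map] lin_comp[OF lin_tensor_map lin_relabel]])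
      (auto simp: pure_tensor_bv[symmetric] relabel_swap tensor_map_pure D g)
qed (simp_all add: assms is_glider_tensor tensor_space_swap)

lemma is_glider_unit: "is_glider G (glider_unit :: ('g, unit, 'k::field) glider)"
proof -
  have "v \<in> pm.span {bv ()}" for v :: "unit \<Rightarrow>\<^sub>0 'k"
  proof -
    have "v = pscale (lookup v ()) (bv ())"
      by (auto intro!: poly_mapping_eqI simp: lookup_pscale)
    then show ?thesis by (metis pm.span_base pm.span_scale singletonI)
  qed
  then have "findim (UNIV :: (unit \<Rightarrow>\<^sub>0 'k) set)"
    unfolding findim_def by (intro exI[of _ "{bv ()}"]) auto
  then show ?thesis
    by (intro is_gliderI) (auto simp: glider_unit_def lin_id)
qed

lemma relabel_fst_unit: "relabel fst (pure_tensor v (w :: unit \<Rightarrow>\<^sub>0 'k::field)) = pscale (lookup w ()) v"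
  and relabel_pair_unit: "relabel (\<lambda>a. (a, ())) v = pure_tensor v (bv ())"
proof -
  show "relabel fst (pure_tensor v w) = pscale (lookup w ()) v"
  proof (rule poly_mapping_eqI)
    fix a
    have "inj (fst :: 'a \<times> unit \<Rightarrow> 'a)" by (auto simp: inj_def)
    from lookup_relabel[OF this, of "pure_tensor v w" "(a, ())"]
    show "lookup (relabel fst (pure_tensor v w)) a
      = lookup (pscale (lookup w ()) v) a"
      by (simp add: lookup_pure_tensor lookup_pscale)
  qed
  show "relabel (\<lambda>a. (a, ())) v = pure_tensor v (bv ())"
    by (rule lin_eqI[OF lin_relabel lin_pure_tensor_left]) (simp add: pure_tensor_bv)
qed

lemma (in monoid) glider_tensor_unit:
  assumes M: "is_glider G (M :: ('a, 'c, 'k::field) glider)"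
  shows "glider_iso G (glider_tensor M glider_unit) M"
proof (rule glider_iso_relabel[where e = fst and e' = "\<lambda>a. (a, ())"])
  note D = gliderD[OF M]
  have unit: "lev1 glider_unit = UNIV" "lev0 glider_unit = UNIV" "act glider_unit = (\<lambda>_ v. v)"
    by (simp_all add: glider_unit_def)
  have into: "relabel fst v \<in> V" if "v \<in> tensor_space V UNIV" "pm.subspace V"
    for v :: "'c \<times> unit \<Rightarrow>\<^sub>0 'k" and V
    by (rule lin_tensor_subset[OF lin_relabel that(2) _ that(1)])
      (simp add: relabel_fst_unit pm.subspace_scale that(2))
  show "v \<in> lev1 (glider_tensor M glider_unit) \<Longrightarrow> relabel fst v \<in> lev1 M"
    "v \<in> lev0 (glider_tensor M glider_unit) \<Longrightarrow> relabel fst v \<in> lev0 M" for v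
    by (simp_all add: unit into D)
  show "v \<in> lev1 M \<Longrightarrow> relabel (\<lambda>a. (a, ())) v \<in> lev1 (glider_tensor M glider_unit)"
    "v \<in> lev0 M \<Longrightarrow> relabel (\<lambda>a. (a, ())) v \<in> lev0 (glider_tensor M glider_unit)" for v
    by (simp_all add: relabel_pair_unit unit pure_in_tensor_space)
  fix g m assume g: "g \<in> carrier G"
  show "relabel fst (act (glider_tensor M glider_unit) g m) = act M g (relabel fst m)"
    unfolding glider_tensor_simps unit
    by (rule lin_eqI[OF lin_comp[OF lin_relabel lin_tensor_map] lin_comp[OF D(6)[OF g] lin_relabel]])
      (auto simp: pure_tensor_bv[symmetric] relabel_fst_unit tensor_map_pure D g lin_id lin_scale)
qed (auto simp: assms is_glider_tensor is_glider_unit)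

definition distrib_map :: "('a + 'b) \<times> 'c \<Rightarrow> ('a \<times> 'c) + ('b \<times> 'c)" where
  "distrib_map = (\<lambda>(x, c). case_sum (\<lambda>a. Inl (a, c)) (\<lambda>b. Inr (b, c)) x)"

definition undistrib_map :: "('a \<times> 'c) + ('b \<times> 'c) \<Rightarrow> ('a + 'b) \<times> 'c" where
  "undistrib_map = case_sum (\<lambda>(a, c). (Inl a, c)) (\<lambda>(b, c). (Inr b, c))"

lemma distrib_map_inverse [simp]:
  "undistrib_map (distrib_map x) = x" "distrib_map (undistrib_map y) = y"
  by (cases x; cases "fst x"; auto simp: distrib_map_def undistrib_map_def)
    (cases y; auto simp: distrib_map_def undistrib_map_def)

lemma relabel_distrib:
  "relabel distrib_map (pure_tensor (pm_inl v + pm_inr w) p) = pm_inl (pure_tensor v p) + pm_inr (pure_tensor w p)"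
proof (rule poly_mapping_eqI)
  fix x
  have inj: "inj distrib_map" by (rule inj_on_inverseI[where g = undistrib_map]) simp
  show "lookup (relabel distrib_map (pure_tensor (pm_inl v + pm_inr w) p)) x
    = lookup (pm_inl (pure_tensor v p) + pm_inr (pure_tensor w p)) x"
    using lookup_relabel[OF inj, of "pure_tensor (pm_inl v + pm_inr w) p" "undistrib_map x", unfolded distrib_map_inverse]
    by (cases x) (auto simp: undistrib_map_def lookup_pure_tensor lookup_add lookup_pm_inl lookup_pm_inr)
qed

lemma relabel_undistrib:
  "relabel undistrib_map (pm_inl (pure_tensor v p) + pm_inr (pure_tensor w p)) = pure_tensor (pm_inl v + pm_inr w) p"
  unfolding relabel_distrib[symmetric] by (rule relabel_inverse) simp

lemma distrib_space:
  "z \<in> tensor_space (dsum_space V W) U \<Longrightarrow>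
     relabel distrib_map z \<in> dsum_space (tensor_space V U) (tensor_space W U)"
  by (rule lin_tensor_subset[OF lin_relabel subspace_dsum_space[OF subspace_tensor_space subspace_tensor_space]])
    (auto elim!: dsum_spaceE simp: relabel_distrib intro!: dsum_spaceI pure_in_tensor_space)

lemma undistrib_space:
  fixes V :: "('a \<Rightarrow>\<^sub>0 'k::field) set" and W :: "('b \<Rightarrow>\<^sub>0 'k) set"
  assumes "z \<in> dsum_space (tensor_space V U) (tensor_space W U)" "0 \<in> V" "0 \<in> W"
  shows "relabel undistrib_map z \<in> tensor_space (dsum_space V W) U"
proof -
  have l: "relabel undistrib_map (pm_inl z) \<in> tensor_space (dsum_space V W) U"
    if "z \<in> tensor_space V U" for z
  proof (rule lin_tensor_subset[OF lin_comp[OF lin_relabel lin_pm_inl] subspace_tensor_space _ that])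
    show "relabel undistrib_map (pm_inl (pure_tensor v u)) \<in> tensor_space (dsum_space V W) U"
      if "v \<in> V" "u \<in> U" for v u
      using relabel_undistrib[of v u "0 :: 'b \<Rightarrow>\<^sub>0 'k"] dsum_spaceI[OF that(1) assms(3)] that(2)
      by (simp add: lin_zero[OF lin_pure_tensor_left] lin_zero[OF lin_pm_inr] pure_in_tensor_space)
  qed
  have r: "relabel undistrib_map (pm_inr z) \<in> tensor_space (dsum_space V W) U"
    if "z \<in> tensor_space W U" for z
  proof (rule lin_tensor_subset[OF lin_comp[OF lin_relabel lin_pm_inr] subspace_tensor_space _ that])
    show "relabel undistrib_map (pm_inr (pure_tensor v u)) \<in> tensor_space (dsum_space V W) U"
      if "v \<in> W" "u \<in> U" for v u
      using relabel_undistrib[of "0 :: 'a \<Rightarrow>\<^sub>0 'k" u v] dsum_spaceI[OF assms(2) that(1)] that(2)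
      by (simp add: lin_zero[OF lin_pure_tensor_left] lin_zero[OF lin_pm_inl] pure_in_tensor_space)
  qed
  show ?thesis
    by (rule dsum_spaceE[OF assms(1)])
      (auto simp: lin_add[OF lin_relabel] intro!: pm.subspace_add[OF subspace_tensor_space] l r)
qed

lemma (in monoid) glider_tensor_distrib:
  assumes M: "is_glider G M" and N: "is_glider G N" and P: "is_glider G P"
  shows "glider_iso G (glider_tensor (glider_dsum M N) P) (glider_dsum (glider_tensor M P) (glider_tensor N P))"
proof (rule glider_iso_relabel[where e = distrib_map and e' = undistrib_map])
  note D = gliderD[OF M] gliderD[OF N] gliderD[OF P]
  show "z \<in> lev1 (glider_tensor (glider_dsum M N) P) \<Longrightarrow>
      relabel distrib_map z \<in> lev1 (glider_dsum (glider_tensor M P) (glider_tensor N P))"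
    "z \<in> lev0 (glider_tensor (glider_dsum M N) P) \<Longrightarrow>
      relabel distrib_map z \<in> lev0 (glider_dsum (glider_tensor M P) (glider_tensor N P))" for z
    by (simp_all add: distrib_space)
  show "z \<in> lev1 (glider_dsum (glider_tensor M P) (glider_tensor N P)) \<Longrightarrow>
      relabel undistrib_map z \<in> lev1 (glider_tensor (glider_dsum M N) P)"
    "z \<in> lev0 (glider_dsum (glider_tensor M P) (glider_tensor N P)) \<Longrightarrow>
      relabel undistrib_map z \<in> lev0 (glider_tensor (glider_dsum M N) P)" for z
    by (simp_all add: undistrib_space pm.subspace_0 D)
  fix g z assume g: "g \<in> carrier G" and z: "z \<in> lev1 (glider_tensor (glider_dsum M N) P)"
  show "relabel distrib_map (act (glider_tensor (glider_dsum M N) P) g z)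
     = act (glider_dsum (glider_tensor M P) (glider_tensor N P)) g (relabel distrib_map z)"
    unfolding glider_tensor_simps glider_dsum_simps
    by (rule lin_eq_on_tensor[OF lin_comp[OF lin_relabel lin_tensor_map] lin_comp[OF lin_dsum_case lin_relabel]
          _ z[unfolded glider_tensor_simps glider_dsum_simps]])
      (auto elim!: dsum_spaceE simp: relabel_distrib tensor_map_pure D g lin_dsum_case dsum_case_sum
        lin_comp[OF lin_pm_inl] lin_comp[OF lin_pm_inr] lin_tensor_map)
qed (auto simp: assms is_glider_tensor is_glider_dsum)

subsection \<open>Gliders over a finite group\<close>

locale finite_group = group G for G :: "('g, 'x) monoid_scheme" (structure) +
  assumes fin: "finite (carrier G)"
begin

text \<open>
  Since \<open>G\<close> is finite, level 0 generates a finite-dimensional submodule. It involves only finitely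
  many basis vectors of the ambient space, and these can be numbered.
\<close>

lemma nat_representative:
  fixes M :: "('g, 'b, 'k::field) glider"
  assumes M: "is_glider G M"
  obtains N :: "('g, nat, 'k) glider" where "is_glider G N" "glider_iso G N M"
proof -
  note D = gliderD[OF M]
  obtain B where B: "finite B" "lev0 M = pm.span B" using D(5) unfolding findim_def by blast
  define T where "T = (\<lambda>(g, b). act M g b) ` (carrier G \<times> B)"
  have T: "finite T" unfolding T_def using B(1) fin by blast
  define W where "W = pm.span T"
  have sW: "pm.subspace W" unfolding W_def by (rule pm.subspace_span)
  have BO: "b \<in> Omega M" if "b \<in> B" for b using that D(11) B(2) pm.span_base by blast
  have T_W: "act M g b \<in> W" if "g \<in> carrier G" "b \<in> B" for g b
    unfolding W_def T_def by (rule pm.span_base) (use that in auto)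
  have BW: "b \<in> W" if "b \<in> B" for b using T_W[OF one_closed that] D(8) BO that by simp
  have lev0W: "lev0 M \<subseteq> W" unfolding B(2) by (rule pm.span_minimal[OF _ sW]) (use BW in blast)
  have WO: "W \<subseteq> Omega M"
    unfolding W_def by (rule pm.span_minimal[OF _ D(1)]) (auto simp: T_def D BO)
  have Wact: "act M g v \<in> W" if "g \<in> carrier G" "v \<in> W" for g v
  proof (rule lin_span_subset[OF D(6)[OF that(1)] sW _ that(2)[unfolded W_def]])
    fix b assume "b \<in> T"
    then obtain h c where "b = act M h c" "h \<in> carrier G" "c \<in> B" unfolding T_def by auto
    then show "act M g b \<in> W" using T_W[of "g \<otimes> h" c] D(9)[of g h c] BO that(1) by simp
  qed
  define M' where "M' = M\<lparr>Omega := W\<rparr>"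
  have M': "is_glider G M'"
    by (rule is_gliderI) (use D sW lev0W WO Wact in \<open>auto simp: M'_def subset_iff\<close>)
  have M'M: "glider_iso G M' M"
    by (rule glider_isoI[OF M' M lin_id lin_id]) (auto simp: M'_def)
  define S where "S = (\<Union>v\<in>T. keys v)"
  have "finite S" using T unfolding S_def by simp
  then obtain e :: "'b \<Rightarrow> nat" where e: "inj_on e S"
    using finite_imp_inj_to_nat_seg by metis
  have sub: "pm.subspace {v :: 'b \<Rightarrow>\<^sub>0 'k. keys v \<subseteq> S}"
    unfolding pm.subspace_def by (auto simp: subset_iff in_keys_iff lookup_add lookup_pscale)
      (metis add_0)
  have keys: "W \<subseteq> {v. keys v \<subseteq> S}"
    unfolding W_def by (rule pm.span_minimal[OF _ sub]) (auto simp: S_def)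
  have inv: "relabel (inv_into S e) (relabel e v) = v" if "v \<in> Omega M'" for v
    using that keys by (intro relabel_inverse inv_into_f_f[OF e]) (auto simp: M'_def)
  let ?N = "\<lparr>Omega = relabel e ` Omega M', act = (\<lambda>g v. relabel e (act M' g (relabel (inv_into S e) v))),
    lev1 = relabel e ` lev1 M', lev0 = relabel e ` lev0 M'\<rparr> :: ('g, nat, 'k) glider"
  have N: "is_glider G ?N" "glider_iso G ?N M'"
    using is_glider_transport[OF M' lin_relabel lin_relabel, of "inv_into S e" e] inv by blast+
  show ?thesis using that[OF N(1) glider_iso_trans[OF N(2) M'M N(1) M' M]] .
qed

text \<open>
  A class is a set of gliders over \<^typ>\<open>nat\<close>; it determines the glider because it is not empty.
\<close>

lemma iso_class_eq_iff:
  fixes M :: "('g, 'b, 'k::field) glider" and N :: "('g, 'c, 'k) glider"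
  assumes M: "is_glider G M" and N: "is_glider G N"
  shows "iso_class G M = iso_class G N \<longleftrightarrow> glider_iso G M N"
proof
  assume eq: "iso_class G M = iso_class G N"
  obtain P :: "('g, nat, 'k) glider" where P: "is_glider G P" "glider_iso G P M"
    using nat_representative[OF M] .
  then have "glider_iso G P N" using eq unfolding iso_class_def by blast
  then show "glider_iso G M N" using P assms by (metis glider_iso_sym glider_iso_trans)
next
  assume "glider_iso G M N"
  then show "iso_class G M = iso_class G N"
    unfolding iso_class_def using assms by (blast intro: glider_iso_sym glider_iso_trans)
qed

end

section \<open>Monoid algebras\<close>

abbreviation ma_mult :: "('m, 'x) monoid_scheme \<Rightarrow> ('m \<Rightarrow>\<^sub>0 'r::comm_ring_1) \<Rightarrow> ('m \<Rightarrow>\<^sub>0 'r) \<Rightarrow> ('m \<Rightarrow>\<^sub>0 'r)" where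
  "ma_mult M \<equiv> monoid.mult (monoid_algebra TYPE('r) M)"

lemma ma_mult_def:
  "ma_mult M f g = basis_extend (\<lambda>a. basis_extend (\<lambda>b. bv (a \<otimes>\<^bsub>M\<^esub> b)) g) f"
  by (simp add: monoid_algebra_def)

lemma ma_mult_add_left: "ma_mult M (f + f') g = ma_mult M f g + ma_mult M f' g"
  by (simp add: ma_mult_def basis_extend_add)

lemma ma_mult_add_right: "ma_mult M f (g + g') = ma_mult M f g + ma_mult M f g'"
  unfolding ma_mult_def
  by (simp add: basis_extend_def[of _ f] basis_extend_add pscale_add_right sum.distrib)

lemma ma_mult_zero [simp]: "ma_mult M 0 g = 0" "ma_mult M f 0 = 0"
  unfolding ma_mult_def by (simp_all add: basis_extend_def[of _ f])

lemma ma_mult_diff_left: "ma_mult M (f - f') g = ma_mult M f g - ma_mult M f' g"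
  using ma_mult_add_left[of M "f - f'" f' g] by (simp add: algebra_simps)

lemma ma_mult_single [simp]:
  "ma_mult M (single a r) (single b s) = single (a \<otimes>\<^bsub>M\<^esub> b) (r * s)"
  by (simp add: ma_mult_def pscale_single)

lemma keys_diff_subset:
  fixes f g :: "'a \<Rightarrow>\<^sub>0 'r::ab_group_add"
  assumes "keys f \<subseteq> A" "keys g \<subseteq> A"
  shows "keys (f - g) \<subseteq> A"
  using assms by (auto simp: subset_iff in_keys_iff lookup_minus) metis

lemma (in comm_monoid) monoid_algebra_cring: "cring (monoid_algebra TYPE('r::comm_ring_1) G)"
proof -
  let ?A = "carrier G"
  have closed: "keys (ma_mult G f g) \<subseteq> ?A"
    if f: "keys f \<subseteq> ?A" and g: "keys g \<subseteq> ?A" for f g :: "'a \<Rightarrow>\<^sub>0 'r"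
    using f
  proof (induction rule: supported_induct)
    case (add a c f)
    have "keys (ma_mult G (single a c) g) \<subseteq> ?A"
      using g by (induction rule: supported_induct)
        (use add(1) in \<open>simp_all add: ma_mult_add_right keys_add_subset\<close>)
    with add show ?case by (simp add: ma_mult_add_left keys_add_subset)
  qed simp
  have comm: "ma_mult G f g = ma_mult G g f"
    if f: "keys f \<subseteq> ?A" and g: "keys g \<subseteq> ?A" for f g :: "'a \<Rightarrow>\<^sub>0 'r"
    using f
  proof (induction rule: supported_induct)
    case (add a c f)
    have "ma_mult G (single a c) g = ma_mult G g (single a c)"
      using g by (induction rule: supported_induct)
        (use add(1) in \<open>simp_all add: ma_mult_add_right ma_mult_add_left m_comm mult.commute\<close>)
    with add show ?case by (simp add: ma_mult_add_left ma_mult_add_right)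
  qed simp
  have assoc: "ma_mult G (ma_mult G f g) h = ma_mult G f (ma_mult G g h)"
    if f: "keys f \<subseteq> ?A" and g: "keys g \<subseteq> ?A" and h: "keys h \<subseteq> ?A"
    for f g h :: "'a \<Rightarrow>\<^sub>0 'r"
    using f
  proof (induction rule: supported_induct)
    case (add a c f)
    have "ma_mult G (ma_mult G (single a c) g) h = ma_mult G (single a c) (ma_mult G g h)"
      using g
    proof (induction rule: supported_induct)
      case (add b d g)
      have "ma_mult G (ma_mult G (single a c) (single b d)) h
          = ma_mult G (single a c) (ma_mult G (single b d) h)"
        using h by (induction rule: supported_induct)
          (use add(1) \<open>a \<in> ?A\<close> in \<open>simp_all add: ma_mult_add_right m_assoc mult.assoc\<close>)
      with add show ?case by (simp add: ma_mult_add_left ma_mult_add_right)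
    qed simp
    with add show ?case by (simp add: ma_mult_add_left)
  qed simp
  have one: "ma_mult G (bv \<one>) f = f" if f: "keys f \<subseteq> ?A" for f :: "'a \<Rightarrow>\<^sub>0 'r"
    using f by (induction rule: supported_induct) (simp_all add: ma_mult_add_right)
  show ?thesis
  proof (rule cringI)
    show "abelian_group (monoid_algebra TYPE('r) G)"
    proof (rule abelian_groupI)
      show "\<exists>y\<in>carrier (monoid_algebra TYPE('r) G).
          y \<oplus>\<^bsub>monoid_algebra TYPE('r) G\<^esub> x = \<zero>\<^bsub>monoid_algebra TYPE('r) G\<^esub>"
        if "x \<in> carrier (monoid_algebra TYPE('r) G)" for x
        using that by (intro bexI[of _ "- x"]) simp_all
    qed (auto simp: add.assoc add.commute dest: keys_add_subset)
    show "Group.comm_monoid (monoid_algebra TYPE('r) G)"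
      by (rule comm_monoidI) (simp_all add: closed assoc one, rule comm)
  qed (simp add: ma_mult_add_left)
qed

lemma monoid_algebra_a_inv:
  assumes "cring (monoid_algebra TYPE('r::comm_ring_1) M)" "keys f \<subseteq> carrier M"
  shows "\<ominus>\<^bsub>monoid_algebra TYPE('r) M\<^esub> f = - f"
proof -
  interpret cring "monoid_algebra TYPE('r) M" by fact
  show ?thesis
    by (rule minus_equality) (use assms(2) in simp_all)
qed

text \<open>
  Integer coefficients are sums of copies of \<open>1\<close> or of \<open>-1\<close>.
\<close>

lemma monoid_algebra_generated:
  assumes "cring (monoid_algebra TYPE(int) M)"
    and "keys f \<subseteq> A" "A \<subseteq> carrier M"
  shows "f \<in> generate (add_monoid (monoid_algebra TYPE(int) M)) ((\<lambda>c. bv c) ` A)" (is "_ \<in> ?S")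
proof -
  interpret cring "monoid_algebra TYPE(int) M" by fact
  have sub: "subgroup ?S (add_monoid (monoid_algebra TYPE(int) M))"
    by (rule add.generate_is_subgroup) (use assms(3) in auto)
  have sum_closed: "f + g \<in> ?S" if "f \<in> ?S" "g \<in> ?S" for f g
    using subgroup.m_closed[OF sub that] by simp
  have nat: "single a (int n) \<in> ?S" if "a \<in> A" for a n
  proof (induction n)
    case 0
    show ?case using subgroup.one_closed[OF sub] by simp
  next
    case (Suc n)
    have "bv a \<in> ?S" by (rule generate.incl) (use that in simp)
    from sum_closed[OF this Suc] show ?case by (simp add: single_add)
  qed
  have single: "single a c \<in> ?S" if a: "a \<in> A" for a c
  proof (cases c rule: int_cases2)
    case (nonneg n)
    then show ?thesis using nat[OF a] by simp
  next
    case (nonpos n)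
    have "\<ominus>\<^bsub>monoid_algebra TYPE(int) M\<^esub> single a (int n) \<in> ?S"
      using subgroup.m_inv_closed[OF sub nat[OF a]] by (simp add: a_inv_def)
    then show ?thesis
      using nonpos a assms(3) monoid_algebra_a_inv[OF assms(1), of "single a (int n)"]
      by (simp add: single_uminus subset_iff split: if_splits)
  qed
  show ?thesis
    using assms(2)
  proof (induction rule: supported_induct)
    case zero
    show ?case using subgroup.one_closed[OF sub] by simp
  next
    case (add a c f)
    then show ?case using sum_closed[OF single[OF add(1)] add(3)] by blast
  qed
qed

section \<open>Ideals and ring morphisms given on additive generators\<close>

text \<open>
  By distributivity products of generators suffice, one factor after the other. The case that \<open>S\<close>
  spans the ring yields ideals, the case \<open>S = T\<close> yields subrings.
\<close>

lemma (in cring) generate_mult: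
  assumes S: "S \<subseteq> carrier R" and T: "T \<subseteq> carrier R"
    and mult: "\<And>t s. t \<in> T \<Longrightarrow> s \<in> S \<Longrightarrow> t \<otimes> s \<in> generate (add_monoid R) T"
    and a: "a \<in> generate (add_monoid R) T" and x: "x \<in> generate (add_monoid R) S"
  shows "a \<otimes> x \<in> generate (add_monoid R) T"
proof -
  let ?I = "generate (add_monoid R) T"
  have sub: "subgroup ?I (add_monoid R)" by (rule add.generate_is_subgroup) (use T in simp)
  have Ic: "?I \<subseteq> carrier R" using subgroup.subset[OF sub] by simp
  have Sc: "generate (add_monoid R) S \<subseteq> carrier R" using add.generate_incl S by simp
  have Iz: "\<zero> \<in> ?I" using subgroup.one_closed[OF sub] by simp
  have Ia: "a \<oplus> b \<in> ?I" if "a \<in> ?I" "b \<in> ?I" for a b using subgroup.m_closed[OF sub that] by simp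
  have Ii: "\<ominus> a \<in> ?I" if "a \<in> ?I" for a using subgroup.m_inv_closed[OF sub that] by (simp add: a_inv_def)
  have 1: "t \<otimes> x \<in> ?I" if t: "t \<in> T" for t
    using x
  proof (induction rule: generate.induct)
    case (inv s)
    then have "t \<otimes> \<ominus> s = \<ominus> (t \<otimes> s)" using t T S by (intro r_minus) auto
    then show ?case using Ii[OF mult[OF t inv]] by (simp add: a_inv_def)
  next
    case (eng x y)
    have "x \<in> carrier R" "y \<in> carrier R" "t \<in> carrier R" using eng Sc t T by auto
    then show ?case using Ia[OF eng(3,4)] by (simp add: r_distr)
  qed (use t T Iz mult in \<open>auto simp: subset_iff\<close>)
  have xc: "x \<in> carrier R" using x Sc by blast
  show ?thesis
    using a
  proof (induction rule: generate.induct)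
    case (incl t)
    then show ?case by (rule 1)
  next
    case (inv t)
    then have "\<ominus> t \<otimes> x = \<ominus> (t \<otimes> x)" using xc T by (intro l_minus) auto
    then show ?case using Ii[OF 1[OF inv]] by (simp add: a_inv_def)
  next
    case (eng a b)
    have "a \<in> carrier R" "b \<in> carrier R" using eng Ic by auto
    then show ?case using Ia[OF eng(3,4)] xc by (simp add: l_distr)
  qed (use xc Iz in auto)
qed

lemma (in cring) ideal_generate:
  assumes S: "carrier R = generate (add_monoid R) S" and T: "T \<subseteq> carrier R"
    and mult: "\<And>t s. t \<in> T \<Longrightarrow> s \<in> S \<Longrightarrow> t \<otimes> s \<in> generate (add_monoid R) T"
  shows "ideal (generate (add_monoid R) T) R"
proof (rule idealI)
  have Sc: "S \<subseteq> carrier R" using generate.incl[of _ S "add_monoid R"] S by blast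
  show sub: "subgroup (generate (add_monoid R) T) (add_monoid R)"
    by (rule add.generate_is_subgroup) (use T in simp)
  fix a x assume a: "a \<in> generate (add_monoid R) T" and x: "x \<in> carrier R"
  show "a \<otimes> x \<in> generate (add_monoid R) T"
    by (rule generate_mult[OF Sc T mult a subsetD[OF equalityD1[OF S] x]])
  then show "x \<otimes> a \<in> generate (add_monoid R) T"
    using subgroup.subset[OF sub] a x by (simp add: m_comm subset_iff)
qed (rule ring_axioms)

lemma ring_hom_group_hom:
  assumes "ring R" "ring S" "h \<in> ring_hom R S"
  shows "group_hom (add_monoid R) (add_monoid S) h"
proof -
  interpret ring_hom_ring R S h using assms by (intro ring_hom_ringI2)
  show ?thesis by (rule a_group_hom)
qed

text \<open>
  An element of the kernel agrees modulo \<open>I\<close> with a combination of elements of \<open>L\<close>, and so differs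
  from it by a combination of elements of \<open>T\<close>.
\<close>

lemma (in cring) iterated_quotient_kernel:
  assumes I: "I = generate (add_monoid R) T" "ideal I R"
    and J: "J = generate (add_monoid (R Quot I)) ((+>) I ` L)" "ideal J (R Quot I)"
    and N: "subgroup N (add_monoid R)" "T \<subseteq> N" "L \<subseteq> N"
    and x: "x \<in> carrier R" "J +>\<^bsub>R Quot I\<^esub> (I +> x) = J"
  shows "x \<in> N"
proof -
  interpret I: ideal I R by (rule I(2))
  interpret J: ideal J "R Quot I" by (rule J(2))
  interpret p: group_hom "add_monoid R" "add_monoid (R Quot I)" "(+>) I"
    by (rule ring_hom_group_hom[OF ring_axioms I.quotient_is_ring I.rcos_ring_hom])
  have IN: "I \<subseteq> N" unfolding I(1) by (rule add.generate_subgroup_incl[OF N(2,1)])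
  have "I +> x \<in> carrier (R Quot I)" using p.hom_closed[of x] x(1) by simp
  from J.rcos_const_imp_mem[OF this x(2)]
  have "I +> x \<in> J" .
  also have "J \<subseteq> (+>) I ` N" unfolding J(1)
    by (rule J.add.generate_subgroup_incl[OF _ p.subgroup_img_is_subgroup[OF N(1)]]) (use N(3) in blast)
  finally obtain n where n: "n \<in> N" "I +> x = I +> n" by blast
  have nc: "n \<in> carrier R" using n(1) subgroup.subset[OF N(1)] by auto
  have "x \<ominus> n \<in> N" using quotient_eq_iff_same_a_r_cos[OF I(2) x(1) nc] n(2) IN by blast
  then have "(x \<ominus> n) \<oplus> n \<in> N" using subgroup.m_closed[OF N(1) _ n(1)] by simp
  moreover have "(x \<ominus> n) \<oplus> n = x" using x(1) nc by (simp add: a_minus_def a_assoc l_neg)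
  ultimately show ?thesis by simp
qed

text \<open>
  Both sides are biadditive in \<open>x\<close> and \<open>y\<close>.
\<close>

lemma mult_hom_from_generators:
  assumes R: "cring R" and S: "cring S" and h: "h \<in> hom (add_monoid R) (add_monoid S)"
    and gen: "carrier R = generate (add_monoid R) B"
    and mult: "\<And>a b. a \<in> B \<Longrightarrow> b \<in> B \<Longrightarrow> h (a \<otimes>\<^bsub>R\<^esub> b) = h a \<otimes>\<^bsub>S\<^esub> h b"
    and xy: "x \<in> carrier R" "y \<in> carrier R"
  shows "h (x \<otimes>\<^bsub>R\<^esub> y) = h x \<otimes>\<^bsub>S\<^esub> h y"
proof -
  interpret R: cring R by fact
  interpret S: cring S by fact
  interpret h: group_hom "add_monoid R" "add_monoid S" h
    using h R.a_group S.a_group by (simp add: group_hom_def group_hom_axioms_def)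
  have hc: "h a \<in> carrier S" if "a \<in> carrier R" for a using h.hom_closed that by simp
  have ha: "h (a \<oplus>\<^bsub>R\<^esub> b) = h a \<oplus>\<^bsub>S\<^esub> h b" if "a \<in> carrier R" "b \<in> carrier R" for a b
    using h.hom_mult that by simp
  have h0: "h \<zero>\<^bsub>R\<^esub> = \<zero>\<^bsub>S\<^esub>" using h.hom_one by simp
  have hi: "h (\<ominus>\<^bsub>R\<^esub> a) = \<ominus>\<^bsub>S\<^esub> h a" if "a \<in> carrier R" for a
    using h.hom_inv that by (simp add: a_inv_def)
  have Bc: "B \<subseteq> carrier R" using generate.incl[of _ B "add_monoid R"] gen by blast
  have 1: "h (a \<otimes>\<^bsub>R\<^esub> y) = h a \<otimes>\<^bsub>S\<^esub> h y" if a: "a \<in> B" and "y \<in> generate (add_monoid R) B" for a y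
    using that(2)
  proof (induction rule: generate.induct)
    case (inv b)
    have "a \<in> carrier R" "b \<in> carrier R" using a inv Bc by auto
    then show ?case using mult[OF a inv] by (simp add: a_inv_def[symmetric] R.r_minus S.r_minus hi hc)
  next
    case (eng y z)
    have "a \<in> carrier R" "y \<in> carrier R" "z \<in> carrier R" using a Bc eng gen by auto
    then show ?case using eng by (simp add: R.r_distr S.r_distr ha hc)
  qed (use a Bc mult in \<open>auto simp: h0 hc subset_iff\<close>)
  have "x \<in> generate (add_monoid R) B" using xy(1) gen by simp
  then show ?thesis
  proof (induction rule: generate.induct)
    case one
    then show ?case using xy(2) by (simp add: h0 hc)
  next
    case (incl b)
    then show ?case using 1 xy(2) gen by simp
  next
    case (inv b)
    have "b \<in> carrier R" using inv Bc by auto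
    then show ?case using 1[OF inv] xy(2) gen by (simp add: a_inv_def[symmetric] R.l_minus S.l_minus hi hc)
  next
    case (eng a b)
    have "a \<in> carrier R" "b \<in> carrier R" using eng gen by auto
    then show ?case using eng xy(2) by (simp add: R.l_distr S.l_distr ha hc)
  qed
qed

section \<open>The Grothendieck ring of gliders\<close>

definition split_gens :: "('g, 'x) monoid_scheme \<Rightarrow> (('g, nat, 'k::field) glider set \<Rightarrow>\<^sub>0 int) set" where
  "split_gens G = {bv (iso_class G (glider_dsum M N)) - bv (iso_class G M) - bv (iso_class G N)
        | (M :: ('g, nat, 'k) glider) (N :: ('g, nat, 'k) glider). is_glider G M \<and> is_glider G N}"

definition length_zero_gens :: "('g, 'x) monoid_scheme \<Rightarrow> (('g, nat, 'k::field) glider set \<Rightarrow>\<^sub>0 int) set" where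
  "length_zero_gens G = {bv (iso_class G M) | M :: ('g, nat, 'k) glider. is_glider G M \<and> length_zero M}"

text \<open>
  The composite of the two quotient maps.
\<close>

definition groth_proj ::
  "('g, 'x) monoid_scheme \<Rightarrow> (('g, nat, 'k::field) glider set \<Rightarrow>\<^sub>0 int) \<Rightarrow>
   (('g, nat, 'k) glider set \<Rightarrow>\<^sub>0 int) set set" where
  "groth_proj G x = length_zero_ideal TYPE('k) G +>\<^bsub>split_groth_ring TYPE('k) G\<^esub>
     (split_relations TYPE('k) G +>\<^bsub>free_groth_ring TYPE('k) G\<^esub> x)"

lemma reduced_class_eq: "reduced_class G c = groth_proj G (bv c)"
  by (simp add: reduced_class_def split_class_def groth_proj_def)

abbreviation rcl :: "('g, 'x) monoid_scheme \<Rightarrow> ('g, 'b, 'k::field) glider \<Rightarrow>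
   (('g, nat, 'k) glider set \<Rightarrow>\<^sub>0 int) set set" where
  "rcl G M \<equiv> reduced_class G (iso_class G M)"

lemma length_zero_iso:
  assumes "glider_iso G M N" "is_glider G M" "is_glider G N" "length_zero M"
  shows "length_zero N"
proof -
  obtain f h where "linear_iso_pair G M N f h" using glider_isoE[OF assms(1-3)] by blast
  note f = linear_iso_pairD[OF this]
  have "v = 0" if "v \<in> lev1 N" for v
    using f(5)[OF that] f(8)[of v] gliderD(10)[OF assms(3) that] assms(4) lin_zero[OF f(1)]
    by (simp add: length_zero_def)
  then show ?thesis
    using pm.subspace_0[OF gliderD(2)[OF assms(3)]] by (auto simp: length_zero_def)
qed

context finite_group
begin

lemma iso_class_mult:
  fixes M :: "('g, 'b, 'k::field) glider" and N :: "('g, 'c, 'k) glider"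
  assumes M: "is_glider G M" and N: "is_glider G N"
  shows "iso_class G M \<otimes>\<^bsub>iso_class_monoid TYPE('k) G\<^esub> iso_class G N = iso_class G (glider_tensor M N)"
proof -
  obtain M0 :: "('g, nat, 'k) glider" where M0: "is_glider G M0" "glider_iso G M0 M"
    using nat_representative[OF M] .
  obtain N0 :: "('g, nat, 'k) glider" where N0: "is_glider G N0" "glider_iso G N0 N"
    using nat_representative[OF N] .
  have "iso_class G (glider_tensor M' N') = iso_class G (glider_tensor M N)"
    if "M' \<in> iso_class G M" "N' \<in> iso_class G N" for M' N'
    using that M N unfolding iso_class_def[of G M] iso_class_def[of G N]
    by (simp add: iso_class_eq_iff is_glider_tensor glider_iso_tensor)
  moreover have "M0 \<in> iso_class G M" "N0 \<in> iso_class G N"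
    using M0 N0 by (simp_all add: iso_class_def)
  ultimately show ?thesis
    unfolding iso_class_monoid_def by auto
qed

lemma iso_class_in_carrier:
  fixes M :: "('g, 'b, 'k::field) glider"
  assumes M: "is_glider G M"
  shows "iso_class G M \<in> carrier (iso_class_monoid TYPE('k) G)"
proof -
  obtain M0 :: "('g, nat, 'k) glider" where M0: "is_glider G M0" "glider_iso G M0 M"
    using nat_representative[OF M] .
  then have "iso_class G M = iso_class G M0" using M by (simp add: iso_class_eq_iff glider_iso_sym)
  then show ?thesis using M0 unfolding iso_class_monoid_def by auto
qed

lemma iso_class_carrierE:
  assumes "c \<in> carrier (iso_class_monoid TYPE('k::field) G)"
  obtains M :: "('g, nat, 'k::field) glider" where "is_glider G M" "c = iso_class G M"
  using assms unfolding iso_class_monoid_def by auto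

lemma iso_class_comm_monoid: "comm_monoid (iso_class_monoid TYPE('k::field) G)"
proof -
  have comm: "x \<otimes>\<^bsub>iso_class_monoid TYPE('k) G\<^esub> y = y \<otimes>\<^bsub>iso_class_monoid TYPE('k) G\<^esub> x"
    if xy: "x \<in> carrier (iso_class_monoid TYPE('k) G)" "y \<in> carrier (iso_class_monoid TYPE('k) G)" for x y
  proof -
    obtain M :: "('g, nat, 'k) glider" where M: "is_glider G M" "x = iso_class G M"
      by (rule iso_class_carrierE[OF xy(1)])
    obtain N :: "('g, nat, 'k) glider" where N: "is_glider G N" "y = iso_class G N"
      by (rule iso_class_carrierE[OF xy(2)])
    show ?thesis using M N
      by (simp add: iso_class_mult iso_class_eq_iff is_glider_tensor glider_tensor_comm)
  qed
  have one: "\<one>\<^bsub>iso_class_monoid TYPE('k) G\<^esub> = iso_class G (glider_unit :: ('g, unit, 'k) glider)"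
    by (simp add: iso_class_monoid_def)
  note u = is_glider_unit[of G, where ?'k = 'k]
  show ?thesis
  proof (rule comm_monoidI)
    fix x y z assume xyz: "x \<in> carrier (iso_class_monoid TYPE('k) G)"
      "y \<in> carrier (iso_class_monoid TYPE('k) G)" "z \<in> carrier (iso_class_monoid TYPE('k) G)"
    obtain M :: "('g, nat, 'k) glider" where M: "is_glider G M" "x = iso_class G M"
      by (rule iso_class_carrierE[OF xyz(1)])
    obtain N :: "('g, nat, 'k) glider" where N: "is_glider G N" "y = iso_class G N"
      by (rule iso_class_carrierE[OF xyz(2)])
    obtain P :: "('g, nat, 'k) glider" where P: "is_glider G P" "z = iso_class G P"
      by (rule iso_class_carrierE[OF xyz(3)])
    show "(x \<otimes>\<^bsub>iso_class_monoid TYPE('k) G\<^esub> y) \<otimes>\<^bsub>iso_class_monoid TYPE('k) G\<^esub> z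
       = x \<otimes>\<^bsub>iso_class_monoid TYPE('k) G\<^esub> (y \<otimes>\<^bsub>iso_class_monoid TYPE('k) G\<^esub> z)"
      using M N P by (simp add: iso_class_mult iso_class_eq_iff is_glider_tensor glider_tensor_assoc)
  next
    fix x y assume xy: "x \<in> carrier (iso_class_monoid TYPE('k) G)" "y \<in> carrier (iso_class_monoid TYPE('k) G)"
    obtain M :: "('g, nat, 'k) glider" where M: "is_glider G M" "x = iso_class G M"
      by (rule iso_class_carrierE[OF xy(1)])
    obtain N :: "('g, nat, 'k) glider" where N: "is_glider G N" "y = iso_class G N"
      by (rule iso_class_carrierE[OF xy(2)])
    show "x \<otimes>\<^bsub>iso_class_monoid TYPE('k) G\<^esub> y \<in> carrier (iso_class_monoid TYPE('k) G)"
      using M N by (simp add: iso_class_mult iso_class_in_carrier is_glider_tensor)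
  next
    fix x assume x: "x \<in> carrier (iso_class_monoid TYPE('k) G)"
    obtain M :: "('g, nat, 'k) glider" where M: "is_glider G M" "x = iso_class G M"
      by (rule iso_class_carrierE[OF x])
    have 1: "\<one>\<^bsub>iso_class_monoid TYPE('k) G\<^esub> \<in> carrier (iso_class_monoid TYPE('k) G)"
      unfolding one by (rule iso_class_in_carrier[OF u])
    have "x \<otimes>\<^bsub>iso_class_monoid TYPE('k) G\<^esub> \<one>\<^bsub>iso_class_monoid TYPE('k) G\<^esub> = x"
      using M u unfolding one by (simp add: iso_class_mult iso_class_eq_iff is_glider_tensor glider_tensor_unit)
    then show "\<one>\<^bsub>iso_class_monoid TYPE('k) G\<^esub> \<otimes>\<^bsub>iso_class_monoid TYPE('k) G\<^esub> x = x"
      using comm[OF 1 x] by simp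
  next
    show "\<one>\<^bsub>iso_class_monoid TYPE('k) G\<^esub> \<in> carrier (iso_class_monoid TYPE('k) G)"
      unfolding one by (rule iso_class_in_carrier[OF u])
  qed (rule comm)
qed

lemma free_groth_cring: "cring (free_groth_ring TYPE('k::field) G)"
  unfolding free_groth_ring_def by (rule comm_monoid.monoid_algebra_cring[OF iso_class_comm_monoid])

lemma free_groth_generated:
  "carrier (free_groth_ring TYPE('k::field) G)
    = generate (add_monoid (free_groth_ring TYPE('k) G)) (bv ` carrier (iso_class_monoid TYPE('k) G))"
proof -
  interpret cring "free_groth_ring TYPE('k) G" by (rule free_groth_cring)
  have gens: "bv ` carrier (iso_class_monoid TYPE('k) G) \<subseteq> carrier (free_groth_ring TYPE('k) G)"
    by (auto simp: free_groth_ring_def)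
  show ?thesis
  proof
    show "carrier (free_groth_ring TYPE('k) G)
      \<subseteq> generate (add_monoid (free_groth_ring TYPE('k) G)) (bv ` carrier (iso_class_monoid TYPE('k) G))"
      using monoid_algebra_generated[OF free_groth_cring[unfolded free_groth_ring_def], of _ "carrier (iso_class_monoid TYPE('k) G)"]
      by (auto simp: free_groth_ring_def)
    show "generate (add_monoid (free_groth_ring TYPE('k) G)) (bv ` carrier (iso_class_monoid TYPE('k) G))
      \<subseteq> carrier (free_groth_ring TYPE('k) G)"
      using add.generate_incl[of "bv ` carrier (iso_class_monoid TYPE('k) G)"] gens by simp
  qed
qed

lemma bv_in_free_groth:
  fixes M :: "('g, 'b, 'k::field) glider"
  shows "is_glider G M \<Longrightarrow> bv (iso_class G M) \<in> carrier (free_groth_ring TYPE('k) G)"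
  by (simp add: free_groth_ring_def iso_class_in_carrier)

lemma split_gens_carrier: "split_gens G \<subseteq> carrier (free_groth_ring TYPE('k::field) G)"
proof
  fix x :: "('g, nat, 'k) glider set \<Rightarrow>\<^sub>0 int" assume "x \<in> split_gens G"
  then obtain M N :: "('g, nat, 'k) glider" where MN: "is_glider G M" "is_glider G N"
    and x: "x = bv (iso_class G (glider_dsum M N)) - bv (iso_class G M) - bv (iso_class G N)"
    unfolding split_gens_def by auto
  show "x \<in> carrier (free_groth_ring TYPE('k) G)"
    unfolding x by (simp add: free_groth_ring_def MN is_glider_dsum iso_class_in_carrier keys_diff_subset)
qed

lemma split_relations_eq:
  "split_relations TYPE('k::field) G = generate (add_monoid (free_groth_ring TYPE('k) G)) (split_gens G)"
  unfolding split_relations_def split_gens_def ..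

text \<open>
  Tensoring distributes over direct sums, so a split relation times a class is a split relation.
\<close>

lemma split_relations_ideal: "ideal (split_relations TYPE('k::field) G) (free_groth_ring TYPE('k) G)"
  unfolding split_relations_eq
proof (rule cring.ideal_generate[OF free_groth_cring free_groth_generated split_gens_carrier])
  fix t s :: "('g, nat, 'k) glider set \<Rightarrow>\<^sub>0 int"
  assume t: "t \<in> split_gens G" and s: "s \<in> bv ` carrier (iso_class_monoid TYPE('k) G)"
  obtain M N :: "('g, nat, 'k) glider" where MN: "is_glider G M" "is_glider G N"
    and t: "t = bv (iso_class G (glider_dsum M N)) - bv (iso_class G M) - bv (iso_class G N)"
    using t unfolding split_gens_def by auto
  obtain P :: "('g, nat, 'k) glider" where P: "is_glider G P" and s: "s = bv (iso_class G P)"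
    using s by (auto elim: iso_class_carrierE)
  obtain M' :: "('g, nat, 'k) glider" where M': "is_glider G M'" "glider_iso G M' (glider_tensor M P)"
    using nat_representative[OF is_glider_tensor[OF MN(1) P]] .
  obtain N' :: "('g, nat, 'k) glider" where N': "is_glider G N'" "glider_iso G N' (glider_tensor N P)"
    using nat_representative[OF is_glider_tensor[OF MN(2) P]] .
  have "glider_iso G (glider_dsum M' N') (glider_dsum (glider_tensor M P) (glider_tensor N P))"
    using M' N' MN P by (intro glider_iso_dsum is_glider_tensor)
  then have "glider_iso G (glider_tensor (glider_dsum M N) P) (glider_dsum M' N')"
    using M' N' MN P
    by (intro glider_iso_trans[OF glider_tensor_distrib[OF MN P] glider_iso_sym] is_glider_tensor is_glider_dsum)
  then have eqs: "iso_class G (glider_tensor (glider_dsum M N) P) = iso_class G (glider_dsum M' N')"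
    "iso_class G (glider_tensor M P) = iso_class G M'" "iso_class G (glider_tensor N P) = iso_class G N'"
    using M' N' MN P by (simp_all add: iso_class_eq_iff is_glider_tensor is_glider_dsum glider_iso_sym)
  have "t \<otimes>\<^bsub>free_groth_ring TYPE('k) G\<^esub> s
     = bv (iso_class G (glider_dsum M' N')) - bv (iso_class G M') - bv (iso_class G N')"
    unfolding t s free_groth_ring_def
    by (simp add: ma_mult_diff_left iso_class_mult MN P is_glider_dsum eqs)
  then have "t \<otimes>\<^bsub>free_groth_ring TYPE('k) G\<^esub> s \<in> split_gens G"
    unfolding split_gens_def using M' N' by blast
  then show "t \<otimes>\<^bsub>free_groth_ring TYPE('k) G\<^esub> s
      \<in> generate (add_monoid (free_groth_ring TYPE('k) G)) (split_gens G)"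
    by (rule generate.incl)
qed

lemma split_groth_cring: "cring (split_groth_ring TYPE('k::field) G)"
  unfolding split_groth_ring_def
  by (rule ideal.quotient_is_cring[OF split_relations_ideal free_groth_cring])

lemma split_proj_hom:
  "(+>\<^bsub>free_groth_ring TYPE('k::field) G\<^esub>) (split_relations TYPE('k) G)
     \<in> ring_hom (free_groth_ring TYPE('k) G) (split_groth_ring TYPE('k) G)"
  unfolding split_groth_ring_def by (rule ideal.rcos_ring_hom[OF split_relations_ideal])

lemma length_zero_ideal_eq:
  "length_zero_ideal TYPE('k::field) G = generate (add_monoid (split_groth_ring TYPE('k) G))
     ((+>\<^bsub>free_groth_ring TYPE('k) G\<^esub>) (split_relations TYPE('k) G) ` length_zero_gens G)"
  unfolding length_zero_ideal_def split_class_def length_zero_gens_def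
  by (rule arg_cong[of _ _ "generate (add_monoid (split_groth_ring TYPE('k) G))"]) blast

lemma length_zero_gens_carrier: "length_zero_gens G \<subseteq> carrier (free_groth_ring TYPE('k::field) G)"
  unfolding length_zero_gens_def by (auto intro: bv_in_free_groth)

lemma split_proj_image:
  "(+>\<^bsub>free_groth_ring TYPE('k::field) G\<^esub>) (split_relations TYPE('k) G) ` carrier (free_groth_ring TYPE('k) G)
     = carrier (split_groth_ring TYPE('k) G)"
  by (auto simp: split_groth_ring_def FactRing_def A_RCOSETS_def' a_r_coset_def')

text \<open>
  The lower level of a tensor product is zero as soon as one factor has lower level zero.
\<close>

lemma length_zero_ideal: "ideal (length_zero_ideal TYPE('k::field) G) (split_groth_ring TYPE('k) G)"
proof -
  let ?F = "free_groth_ring TYPE('k) G" and ?Q = "split_groth_ring TYPE('k) G"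
  let ?p = "(+>\<^bsub>?F\<^esub>) (split_relations TYPE('k) G)"
  interpret F: cring ?F by (rule free_groth_cring)
  interpret Q: cring ?Q by (rule split_groth_cring)
  interpret p: group_hom "add_monoid ?F" "add_monoid ?Q" ?p
    by (rule ring_hom_group_hom[OF F.ring_axioms Q.ring_axioms split_proj_hom])
  have S: "bv ` carrier (iso_class_monoid TYPE('k) G) \<subseteq> carrier ?F"
    by (auto simp: free_groth_ring_def)
  show ?thesis
    unfolding length_zero_ideal_eq
  proof (rule Q.ideal_generate)
    show "carrier ?Q = generate (add_monoid ?Q) (?p ` (bv ` carrier (iso_class_monoid TYPE('k) G)))"
    proof -
      have "generate (add_monoid ?Q) (?p ` (bv ` carrier (iso_class_monoid TYPE('k) G)))
        = ?p ` generate (add_monoid ?F) (bv ` carrier (iso_class_monoid TYPE('k) G))"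
        by (rule p.generate_img) (use S in simp)
      also have "\<dots> = carrier ?Q"
        by (simp only: free_groth_generated[symmetric] split_proj_image)
      finally show ?thesis ..
    qed
    show "?p ` length_zero_gens G \<subseteq> carrier ?Q"
      using length_zero_gens_carrier split_proj_image by blast
    fix t s assume t: "t \<in> ?p ` length_zero_gens G"
      and s: "s \<in> ?p ` (bv ` carrier (iso_class_monoid TYPE('k) G))"
    obtain M :: "('g, nat, 'k) glider" where M: "is_glider G M" "length_zero M"
      and t: "t = ?p (bv (iso_class G M))" using t unfolding length_zero_gens_def by auto
    obtain P :: "('g, nat, 'k) glider" where P: "is_glider G P" and s: "s = ?p (bv (iso_class G P))"
      using s by (auto elim: iso_class_carrierE)
    have Z: "length_zero (glider_tensor M P)"
      using M pm.subspace_0[OF gliderD(2)[OF P]] by (simp add: length_zero_def tensor_space_zero)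
    obtain M' :: "('g, nat, 'k) glider" where M': "is_glider G M'" "glider_iso G M' (glider_tensor M P)"
      using nat_representative[OF is_glider_tensor[OF M(1) P]] .
    have Z': "length_zero M'"
      using length_zero_iso[OF glider_iso_sym[OF M'(2)] is_glider_tensor[OF M(1) P] M'(1) Z] .
    have "t \<otimes>\<^bsub>?Q\<^esub> s = ?p (bv (iso_class G M) \<otimes>\<^bsub>?F\<^esub> bv (iso_class G P))"
      unfolding t s using ring_hom_mult[OF split_proj_hom] bv_in_free_groth M P by metis
    also have "bv (iso_class G M) \<otimes>\<^bsub>?F\<^esub> bv (iso_class G P) = bv (iso_class G M')"
    proof -
      have "iso_class G (glider_tensor M P) = iso_class G M'"
        using M' M P by (simp add: iso_class_eq_iff is_glider_tensor glider_iso_sym)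
      then show ?thesis using M P by (simp add: free_groth_ring_def iso_class_mult)
    qed
    finally have "t \<otimes>\<^bsub>?Q\<^esub> s \<in> ?p ` length_zero_gens G"
      unfolding length_zero_gens_def using M' Z' by blast
    then show "t \<otimes>\<^bsub>?Q\<^esub> s \<in> generate (add_monoid ?Q) (?p ` length_zero_gens G)"
      by (rule generate.incl)
  qed
qed

lemma reduced_groth_cring: "cring (reduced_groth_ring TYPE('k::field) G)"
  unfolding reduced_groth_ring_def
  by (rule ideal.quotient_is_cring[OF length_zero_ideal split_groth_cring])

lemma groth_proj_hom:
  "groth_proj G \<in> ring_hom (free_groth_ring TYPE('k::field) G) (reduced_groth_ring TYPE('k) G)"
proof -
  have "(+>\<^bsub>split_groth_ring TYPE('k) G\<^esub>) (length_zero_ideal TYPE('k) G) \<circ>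
      (+>\<^bsub>free_groth_ring TYPE('k) G\<^esub>) (split_relations TYPE('k) G)
     \<in> ring_hom (free_groth_ring TYPE('k) G) (reduced_groth_ring TYPE('k) G)"
    unfolding reduced_groth_ring_def
    by (rule ring_hom_trans[OF split_proj_hom ideal.rcos_ring_hom[OF length_zero_ideal]])
  then show ?thesis by (simp add: groth_proj_def[abs_def] comp_def)
qed

lemma groth_proj_image:
  "groth_proj G ` carrier (free_groth_ring TYPE('k::field) G) = carrier (reduced_groth_ring TYPE('k) G)"
proof -
  have "groth_proj G ` carrier (free_groth_ring TYPE('k) G)
    = (+>\<^bsub>split_groth_ring TYPE('k) G\<^esub>) (length_zero_ideal TYPE('k) G) ` carrier (split_groth_ring TYPE('k) G)"
    unfolding split_proj_image[symmetric] by (simp add: groth_proj_def[abs_def] image_image)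
  also have "\<dots> = carrier (reduced_groth_ring TYPE('k) G)"
    by (auto simp: reduced_groth_ring_def FactRing_def A_RCOSETS_def' a_r_coset_def')
  finally show ?thesis .
qed

lemma groth_proj_group_hom:
  "group_hom (add_monoid (free_groth_ring TYPE('k::field) G)) (add_monoid (reduced_groth_ring TYPE('k) G)) (groth_proj G)"
  by (rule ring_hom_group_hom[OF cring.axioms(1)[OF free_groth_cring] cring.axioms(1)[OF reduced_groth_cring] groth_proj_hom])

text \<open>
  The kernel of the projection is the smallest subgroup that contains the split relations and the
  classes of gliders of length zero.
\<close>

lemma groth_proj_kernel:
  assumes N: "subgroup N (add_monoid (free_groth_ring TYPE('k::field) G))" "split_gens G \<subseteq> N" "length_zero_gens G \<subseteq> N"
    and x: "x \<in> carrier (free_groth_ring TYPE('k) G)" "groth_proj G x = \<zero>\<^bsub>reduced_groth_ring TYPE('k) G\<^esub>"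
  shows "x \<in> N"
proof -
  have zero: "\<zero>\<^bsub>reduced_groth_ring TYPE('k) G\<^esub> = length_zero_ideal TYPE('k) G"
    by (simp add: reduced_groth_ring_def FactRing_def)
  show ?thesis
  proof (rule cring.iterated_quotient_kernel[OF free_groth_cring split_relations_eq split_relations_ideal
        _ _ N x(1)])
    show "length_zero_ideal TYPE('k) G =
      generate (add_monoid (free_groth_ring TYPE('k) G Quot split_relations TYPE('k) G))
       ((+>\<^bsub>free_groth_ring TYPE('k) G\<^esub>) (split_relations TYPE('k) G) ` length_zero_gens G)"
      using length_zero_ideal_eq by (simp only: split_groth_ring_def)
    show "ideal (length_zero_ideal TYPE('k) G) (free_groth_ring TYPE('k) G Quot split_relations TYPE('k) G)"
      using length_zero_ideal by (simp only: split_groth_ring_def)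
    show "length_zero_ideal TYPE('k) G +>\<^bsub>free_groth_ring TYPE('k) G Quot split_relations TYPE('k) G\<^esub>
        (split_relations TYPE('k) G +>\<^bsub>free_groth_ring TYPE('k) G\<^esub> x) = length_zero_ideal TYPE('k) G"
      using x(2) by (simp only: zero groth_proj_def split_groth_ring_def)
  qed
qed

lemma groth_proj_eqD:
  assumes N: "subgroup N (add_monoid (free_groth_ring TYPE('k::field) G))" "split_gens G \<subseteq> N" "length_zero_gens G \<subseteq> N"
    and xy: "x \<in> carrier (free_groth_ring TYPE('k) G)" "y \<in> carrier (free_groth_ring TYPE('k) G)"
      "groth_proj G x = groth_proj G y"
  shows "x - y \<in> N"
proof -
  let ?F = "free_groth_ring TYPE('k) G" and ?R = "reduced_groth_ring TYPE('k) G"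
  interpret R: cring ?R by (rule reduced_groth_cring)
  interpret q: group_hom "add_monoid ?F" "add_monoid ?R" "groth_proj G" by (rule groth_proj_group_hom)
  have d: "x - y \<in> carrier ?F" using xy by (simp add: free_groth_ring_def keys_diff_subset)
  have "groth_proj G x = groth_proj G (x - y) \<oplus>\<^bsub>?R\<^esub> groth_proj G y"
    using q.hom_mult[of "x - y" y] d xy(2) by (simp add: free_groth_ring_def)
  then have "groth_proj G (x - y) = \<zero>\<^bsub>?R\<^esub>"
    using xy d q.hom_closed[of "x - y"] q.hom_closed[of y] R.add.r_cancel_one[of "groth_proj G y" "groth_proj G (x - y)"] by simp
  then show ?thesis by (rule groth_proj_kernel[OF N d])
qed

text \<open>
  By this lemma additive functions of gliders become functions on the reduced ring.
\<close>

lemma groth_proj_factor: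
  assumes B: "group B" and h: "h \<in> hom (add_monoid (free_groth_ring TYPE('k::field) G)) B"
    and gens: "\<And>z. z \<in> split_gens G \<Longrightarrow> h z = \<one>\<^bsub>B\<^esub>" "\<And>z. z \<in> length_zero_gens G \<Longrightarrow> h z = \<one>\<^bsub>B\<^esub>"
    and xy: "x \<in> carrier (free_groth_ring TYPE('k) G)" "y \<in> carrier (free_groth_ring TYPE('k) G)"
      "groth_proj G x = groth_proj G y"
  shows "h x = h y"
proof -
  let ?F = "free_groth_ring TYPE('k) G"
  interpret F: cring ?F by (rule free_groth_cring)
  interpret h: group_hom "add_monoid ?F" B h
    using F.a_group B h by (simp add: group_hom_def group_hom_axioms_def)
  have "x - y \<in> kernel (add_monoid ?F) B h"
    by (rule groth_proj_eqD[OF h.subgroup_kernel _ _ xy])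
      (use gens split_gens_carrier length_zero_gens_carrier in \<open>auto simp: kernel_def\<close>)
  then have d: "x - y \<in> carrier ?F" "h (x - y) = \<one>\<^bsub>B\<^esub>" by (auto simp: kernel_def)
  have "h x = h (x - y) \<otimes>\<^bsub>B\<^esub> h y"
    using h.hom_mult[of "x - y" y] d(1) xy(2) by (simp add: free_groth_ring_def)
  then show ?thesis using d(2) h.hom_closed[of y] xy(2) by simp
qed

subsection \<open>Computing with classes of gliders over any basis type\<close>

text \<open>
  Tensor products, direct sums and induced gliders live over product and sum types. Classes are
  therefore computed for gliders over any basis type, by passing to representatives over \<^typ>\<open>nat\<close>.
\<close>

lemma rcl_closed:
  fixes M :: "('g, 'b, 'k::field) glider"
  assumes "is_glider G M"
  shows "rcl G M \<in> carrier (reduced_groth_ring TYPE('k) G)"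
  unfolding reduced_class_eq groth_proj_image[symmetric] using bv_in_free_groth[OF assms] by blast

lemma rcl_iso:
  fixes M :: "('g, 'b, 'k::field) glider" and N :: "('g, 'c, 'k) glider"
  shows "is_glider G M \<Longrightarrow> is_glider G N \<Longrightarrow> glider_iso G M N \<Longrightarrow> rcl G M = rcl G N"
  using iso_class_eq_iff by metis

lemma rcl_tensor:
  fixes M :: "('g, 'b, 'k::field) glider" and N :: "('g, 'c, 'k) glider"
  assumes "is_glider G M" "is_glider G N"
  shows "rcl G (glider_tensor M N) = rcl G M \<otimes>\<^bsub>reduced_groth_ring TYPE('k) G\<^esub> rcl G N"
proof -
  have "rcl G M \<otimes>\<^bsub>reduced_groth_ring TYPE('k) G\<^esub> rcl G N
     = groth_proj G (bv (iso_class G M) \<otimes>\<^bsub>free_groth_ring TYPE('k) G\<^esub> bv (iso_class G N))"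
    unfolding reduced_class_eq
    using ring_hom_mult[OF groth_proj_hom bv_in_free_groth[OF assms(1)] bv_in_free_groth[OF assms(2)]] by simp
  then show ?thesis
    by (simp add: free_groth_ring_def iso_class_mult assms reduced_class_eq)
qed

lemma rcl_length_zero:
  fixes M :: "('g, 'b, 'k::field) glider"
  assumes M: "is_glider G M" "length_zero M"
  shows "rcl G M = \<zero>\<^bsub>reduced_groth_ring TYPE('k) G\<^esub>"
proof -
  obtain M' :: "('g, nat, 'k) glider" where M': "is_glider G M'" "glider_iso G M' M"
    using nat_representative[OF M(1)] .
  interpret J: ideal "length_zero_ideal TYPE('k) G" "split_groth_ring TYPE('k) G" by (rule length_zero_ideal)
  have "length_zero M'" using length_zero_iso[OF glider_iso_sym[OF M'(2)] M(1) M'(1) M(2)] .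
  then have "split_class G (iso_class G M') \<in> length_zero_ideal TYPE('k) G"
    unfolding length_zero_ideal_def using M'(1) by (blast intro: generate.incl)
  then have "rcl G M' = \<zero>\<^bsub>reduced_groth_ring TYPE('k) G\<^esub>"
    unfolding reduced_class_def by (simp add: J.a_rcos_const reduced_groth_ring_def FactRing_def)
  then show ?thesis using rcl_iso[OF M'(1) M(1) M'(2)] by simp
qed

lemma rcl_dsum:
  fixes M :: "('g, 'b, 'k::field) glider" and N :: "('g, 'c, 'k) glider"
  assumes M: "is_glider G M" and N: "is_glider G N"
  shows "rcl G (glider_dsum M N) = rcl G M \<oplus>\<^bsub>reduced_groth_ring TYPE('k) G\<^esub> rcl G N"
proof -
  let ?F = "free_groth_ring TYPE('k) G" and ?R = "reduced_groth_ring TYPE('k) G"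
  obtain M' :: "('g, nat, 'k) glider" where M': "is_glider G M'" "glider_iso G M' M"
    using nat_representative[OF M] .
  obtain N' :: "('g, nat, 'k) glider" where N': "is_glider G N'" "glider_iso G N' N"
    using nat_representative[OF N] .
  interpret F: cring ?F by (rule free_groth_cring)
  interpret R: cring ?R by (rule reduced_groth_cring)
  interpret Q: cring "split_groth_ring TYPE('k) G" by (rule split_groth_cring)
  interpret q: group_hom "add_monoid ?F" "add_monoid ?R" "groth_proj G" by (rule groth_proj_group_hom)
  interpret I: ideal "split_relations TYPE('k) G" ?F by (rule split_relations_ideal)
  interpret J: ideal "length_zero_ideal TYPE('k) G" "split_groth_ring TYPE('k) G" by (rule length_zero_ideal)
  define x :: "('g, nat, 'k) glider set \<Rightarrow>\<^sub>0 int" where "x = bv (iso_class G (glider_dsum M' N')) - bv (iso_class G M') - bv (iso_class G N')"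
  have xI: "x \<in> split_gens G" unfolding split_gens_def x_def using M' N' by blast
  then have "x \<in> split_relations TYPE('k) G" unfolding split_relations_eq by (rule generate.incl)
  then have "split_relations TYPE('k) G +>\<^bsub>?F\<^esub> x = \<zero>\<^bsub>split_groth_ring TYPE('k) G\<^esub>"
    by (simp add: I.a_rcos_const split_groth_ring_def FactRing_def)
  then have x0: "groth_proj G x = \<zero>\<^bsub>?R\<^esub>"
    by (simp add: groth_proj_def J.a_rcos_const reduced_groth_ring_def FactRing_def)
  have xc: "x \<in> carrier ?F" using xI split_gens_carrier by blast
  note bM = bv_in_free_groth[OF M'(1)] and bN = bv_in_free_groth[OF N'(1)]
  have "bv (iso_class G (glider_dsum M' N')) = x \<oplus>\<^bsub>?F\<^esub> (bv (iso_class G M') \<oplus>\<^bsub>?F\<^esub> bv (iso_class G N'))"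
    by (simp add: x_def free_groth_ring_def)
  then have "rcl G (glider_dsum M' N') = rcl G M' \<oplus>\<^bsub>?R\<^esub> rcl G N'"
    unfolding reduced_class_eq
    using q.hom_mult[of x "bv (iso_class G M') \<oplus>\<^bsub>?F\<^esub> bv (iso_class G N')"]
      q.hom_mult[of "bv (iso_class G M')" "bv (iso_class G N')"] xc bM bN x0
    by (simp add: R.l_zero F.a_closed ring_hom_closed[OF groth_proj_hom])
  then show ?thesis
    using rcl_iso[OF M'(1) M M'(2)] rcl_iso[OF N'(1) N N'(2)]
      rcl_iso[OF is_glider_dsum[OF M'(1) N'(1)] is_glider_dsum[OF M N] glider_iso_dsum[OF M'(2) N'(2) M'(1) M N'(1) N]]
    by simp
qed

end

section \<open>The generated submodule and relations\<close>

text \<open>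
  The submodule generated by the lower level. One vector \<open>m g\<close> for each \<open>g\<close> is enough, the lower level
  being a subspace on which \<open>g\<close> acts linearly.
\<close>

definition generated0 :: "('g, 'x) monoid_scheme \<Rightarrow> ('g, 'b, 'k::field) glider \<Rightarrow> ('b \<Rightarrow>\<^sub>0 'k) set" where
  "generated0 G M = {\<Sum>g\<in>carrier G. act M g (m g) | m. \<forall>g\<in>carrier G. m g \<in> lev1 M}"

definition core :: "('g, 'x) monoid_scheme \<Rightarrow> ('g, 'b, 'k::field) glider \<Rightarrow> ('g, 'b, 'k) glider" where
  "core G M = M\<lparr>lev0 := generated0 G M\<rparr>"

lemma core_simps [simp]:
  "Omega (core G M) = Omega M" "act (core G M) = act M" "lev1 (core G M) = lev1 M"
  "lev0 (core G M) = generated0 G M" "generated0 G (core G M) = generated0 G M"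
  by (simp_all add: core_def generated0_def)

text \<open>
  A relation of \<open>M\<close> is a family \<open>m\<close> of vectors of the lower level whose sum \<open>\<Sum>g (m g)\<close> is zero.
\<close>

definition same_relations ::
  "('g, 'x) monoid_scheme \<Rightarrow> ('g, 'a, 'k::field) glider \<Rightarrow> ('g, 'b, 'k) glider \<Rightarrow>
   (('a \<Rightarrow>\<^sub>0 'k) \<Rightarrow> ('b \<Rightarrow>\<^sub>0 'k)) \<Rightarrow> bool" where
  "same_relations G M N f \<longleftrightarrow> lin f \<and> f ` lev1 M = lev1 N \<and> inj_on f (lev1 M) \<and>
     (\<forall>m. (\<forall>g\<in>carrier G. m g \<in> lev1 M) \<longrightarrow>
        (\<Sum>g\<in>carrier G. act M g (m g)) = 0 \<longleftrightarrow> (\<Sum>g\<in>carrier G. act N g (f (m g))) = 0)"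

text \<open>
  A function on \<open>G\<close> stands for the element of the group algebra with these coefficients; its values
  off the carrier are arbitrary.
\<close>

definition ann :: "('g, 'x) monoid_scheme \<Rightarrow> ('g, 'b, 'k::field) glider \<Rightarrow> ('b \<Rightarrow>\<^sub>0 'k) \<Rightarrow> ('g \<Rightarrow> 'k) set" where
  "ann G M v = {x. (\<Sum>g\<in>carrier G. pscale (x g) (act M g v)) = 0}"

definition annihilated ::
  "('g, 'x) monoid_scheme \<Rightarrow> ('g \<Rightarrow> 'k) set \<Rightarrow> ('g, 'b, 'k::field) glider \<Rightarrow> ('b \<Rightarrow>\<^sub>0 'k) set" where
  "annihilated G A M = {v \<in> lev1 M. A \<subseteq> ann G M v}"

lemma dim_lin_image:
  assumes f: "lin f" and V: "pm.subspace V" and inj: "inj_on f V"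
  shows "pm.dim (f ` V) = pm.dim V"
proof -
  obtain B where B: "B \<subseteq> V" "pm.independent B" "V \<subseteq> pm.span B" "card B = pm.dim V"
    using pm.basis_exists by metis
  have span: "pm.span B = V" using B V by (metis pm.span_minimal subset_antisym)
  have "pm.independent (f ` B)"
    using pmp.linear_independent_injective_image[OF f B(2)] inj span by simp
  moreover have "pm.span (f ` B) = f ` V" by (simp add: pmp.linear_span_image[OF f] span)
  ultimately have "pm.dim (f ` V) = card (f ` B)"
    using pm.dim_span_eq_card_independent by metis
  also have "\<dots> = card B" using inj B(1) by (meson card_image inj_on_subset)
  finally show ?thesis using B(4) by simp
qed

lemma findim_basis:
  assumes "findim V" "pm.subspace V"
  obtains B where "finite B" "pm.independent B" "V = pm.span B" "card B = pm.dim V"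
proof -
  obtain B where B: "B \<subseteq> V" "pm.independent B" "V \<subseteq> pm.span B" "card B = pm.dim V"
    using pm.basis_exists by metis
  obtain C where "finite C" "V = pm.span C" using assms(1) unfolding findim_def by blast
  then have "finite B" using pm.independent_span_bound[of C B] B by blast
  then show ?thesis using that B assms(2) by (metis pm.span_minimal subset_antisym)
qed

lemma dim_dsum_space:
  assumes V: "findim V" "pm.subspace V" and W: "findim W" "pm.subspace W"
  shows "pm.dim (dsum_space V W) = pm.dim V + pm.dim W"
proof -
  obtain B where B: "finite B" "pm.independent B" "V = pm.span B" "card B = pm.dim V"
    using findim_basis[OF V] .
  obtain C where C: "finite C" "pm.independent C" "W = pm.span C" "card C = pm.dim W"
    using findim_basis[OF W] .
  have injl: "inj pm_inl" and injr: "inj pm_inr"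
    using pm_sum_eq_iff[of _ 0 _ 0] pm_sum_eq_iff[of 0 _ 0 _]
    by (auto simp: inj_def lin_zero[OF lin_pm_inl] lin_zero[OF lin_pm_inr])
  have nz: "b \<noteq> 0" if "b \<in> B" for b using that B(2) pm.dependent_zero by blast
  have disj: "pm_inl ` B \<inter> pm_inr ` C = {}"
  proof -
    have "b = 0" if "pm_inl b = pm_inr c" for b c
      using that pm_sum_eq_iff[of b 0 0 c] by (simp add: lin_zero[OF lin_pm_inl] lin_zero[OF lin_pm_inr])
    then show ?thesis using nz by blast
  qed
  have "pm.independent (pm_inl ` B \<union> pm_inr ` C)"
  proof -
    have "u x = 0" if eq: "(\<Sum>x\<in>pm_inl ` B \<union> pm_inr ` C. pscale (u x) x) = 0"
      and x: "x \<in> pm_inl ` B \<union> pm_inr ` C" for u x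
    proof -
      have "(\<Sum>x\<in>pm_inl ` B \<union> pm_inr ` C. pscale (u x) x)
        = (\<Sum>b\<in>B. pscale (u (pm_inl b)) (pm_inl b)) + (\<Sum>c\<in>C. pscale (u (pm_inr c)) (pm_inr c))"
        using B(1) C(1) disj
        by (simp add: sum.union_disjoint sum.reindex[OF inj_on_subset[OF injl]] sum.reindex[OF inj_on_subset[OF injr]])
      also have "\<dots> = pm_inl (\<Sum>b\<in>B. pscale (u (pm_inl b)) b) + pm_inr (\<Sum>c\<in>C. pscale (u (pm_inr c)) c)"
        by (simp add: lin_sum[OF lin_pm_inl] lin_scale[OF lin_pm_inl] lin_sum[OF lin_pm_inr] lin_scale[OF lin_pm_inr])
      finally have "(\<Sum>b\<in>B. pscale (u (pm_inl b)) b) = 0" "(\<Sum>c\<in>C. pscale (u (pm_inr c)) c) = 0"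
        using eq pm_sum_eq_iff[of "\<Sum>b\<in>B. pscale (u (pm_inl b)) b" "\<Sum>c\<in>C. pscale (u (pm_inr c)) c" 0 0]
        by (simp_all add: lin_zero[OF lin_pm_inl] lin_zero[OF lin_pm_inr])
      then show "u x = 0"
        using pm.independentD[OF B(2) B(1) subset_refl] pm.independentD[OF C(2) C(1) subset_refl] x by auto
    qed
    then show ?thesis
      using pm.dependent_finite[of "pm_inl ` B \<union> pm_inr ` C"] B(1) C(1) by blast
  qed
  then have "pm.dim (dsum_space V W) = card (pm_inl ` B \<union> pm_inr ` C)"
    unfolding B(3) C(3) dsum_space_span by (rule pm.dim_span_eq_card_independent)
  also have "\<dots> = card B + card C"
    using B(1) C(1) disj
    by (simp add: card_Un_disjoint card_image[OF inj_on_subset[OF injl subset_UNIV]]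
        card_image[OF inj_on_subset[OF injr subset_UNIV]])
  finally show ?thesis using B(4) C(4) by simp
qed

context finite_group
begin

lemma generated0_subspace:
  assumes M: "is_glider G M"
  shows "pm.subspace (generated0 G M)"
proof (rule pm.subspaceI)
  note D = gliderD[OF M]
  show "0 \<in> generated0 G M"
    unfolding generated0_def mem_Collect_eq
    by (rule exI[of _ "\<lambda>_. 0"]) (auto simp: pm.subspace_0[OF D(2)] lin_zero D(6) intro!: sum.neutral[symmetric])
  show "x + y \<in> generated0 G M" if xy: "x \<in> generated0 G M" "y \<in> generated0 G M" for x y
  proof -
    obtain m n where "x = (\<Sum>g\<in>carrier G. act M g (m g))" "\<forall>g\<in>carrier G. m g \<in> lev1 M"
      "y = (\<Sum>g\<in>carrier G. act M g (n g))" "\<forall>g\<in>carrier G. n g \<in> lev1 M"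
      using xy unfolding generated0_def by blast
    then show ?thesis
      unfolding generated0_def mem_Collect_eq
      by (intro exI[of _ "\<lambda>g. m g + n g"]) (simp add: lin_add[OF D(6)] sum.distrib pm.subspace_add[OF D(2)])
  qed
  show "pscale c x \<in> generated0 G M" if x: "x \<in> generated0 G M" for c x
  proof -
    obtain m where "x = (\<Sum>g\<in>carrier G. act M g (m g))" "\<forall>g\<in>carrier G. m g \<in> lev1 M"
      using x unfolding generated0_def by blast
    then show ?thesis
      unfolding generated0_def mem_Collect_eq
      by (intro exI[of _ "\<lambda>g. pscale c (m g)"]) (simp add: lin_scale[OF D(6)] pscale_sum pm.subspace_scale[OF D(2)])
  qed
qed

lemma act_point_mass:
  assumes M: "is_glider G M" and h: "h \<in> carrier G"
  shows "(\<Sum>g\<in>carrier G. act M g (if g = h then m else 0)) = act M h m"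
proof -
  have "(\<Sum>g\<in>carrier G. act M g (if g = h then m else 0)) = (\<Sum>g\<in>carrier G. if g = h then act M h m else 0)"
    by (rule sum.cong) (auto simp: lin_zero[OF gliderD(6)[OF M]])
  then show ?thesis using h fin by simp
qed

lemma act_in_generated0:
  assumes M: "is_glider G M" and h: "h \<in> carrier G" and m: "m \<in> lev1 M"
  shows "act M h m \<in> generated0 G M"
  unfolding generated0_def mem_Collect_eq
  by (rule exI[of _ "\<lambda>g. if g = h then m else 0"])
    (use m pm.subspace_0[OF gliderD(2)[OF M]] in \<open>auto simp: act_point_mass[OF M h]\<close>)

lemma lev1_in_generated0:
  assumes M: "is_glider G M" and m: "m \<in> lev1 M"
  shows "m \<in> generated0 G M"
  using act_in_generated0[OF M one_closed m] gliderD(8,12)[OF M] m by simp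

lemma generated0_in_lev0: "is_glider G M \<Longrightarrow> generated0 G M \<subseteq> lev0 M"
  unfolding generated0_def by (auto intro!: pm.subspace_sum gliderD(3) gliderD(13))

lemma is_glider_core:
  assumes M: "is_glider G M"
  shows "is_glider G (core G M)"
proof (rule is_gliderI)
  note D = gliderD[OF M]
  show "findim (lev0 (core G M))"
    using findim_subspace[OF D(5) generated0_subspace[OF M] generated0_in_lev0[OF M]] by simp
  show "v \<in> lev0 (core G M) \<Longrightarrow> v \<in> Omega (core G M)" for v
    using generated0_in_lev0[OF M] D(11) by auto
qed (simp_all add: gliderD[OF M] generated0_subspace[OF M] act_in_generated0[OF M] lev1_in_generated0[OF M])

text \<open>
  A complement of the generated submodule in level 0, with trivial action, splits off as a glider of
  length zero.
\<close>

lemma rcl_core: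
  fixes M :: "('g, 'b, 'k::field) glider"
  assumes M: "is_glider G M"
  shows "rcl G (core G M) = rcl G M"
proof -
  let ?C = "generated0 G M"
  note D = gliderD[OF M]
  note C = is_glider_core[OF M]
  \<comment> \<open>The image of an idempotent map with kernel the generated submodule is a complement of it.\<close>
  define p where "p = quotient_proj ?C"
  have p: "lin p" "\<And>v. p (p v) = p v" "\<And>v. p v = 0 \<longleftrightarrow> v \<in> ?C"
    unfolding p_def using quotient_proj[OF generated0_subspace[OF M]] by auto
  have pC: "v - p v \<in> ?C" for v
    using p by (metis lin_diff right_minus_eq)
  have CO: "?C \<subseteq> lev0 M" by (rule generated0_in_lev0[OF M])
  have p0: "p v \<in> lev0 M" if "v \<in> lev0 M" for v
    using pm.subspace_diff[OF D(3) that, of "v - p v"] pC CO by auto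
  define Z :: "('g, 'b, 'k) glider" where
    "Z = \<lparr>Omega = p ` lev0 M, act = (\<lambda>_ v. v), lev1 = {0}, lev0 = p ` lev0 M\<rparr>"
  have Z: "is_glider G Z"
    using lin_zero[OF p(1)] pm.subspace_0[OF D(3)]
    by (intro is_gliderI) (auto simp: Z_def lin_id subspace_lin_image p(1) D findim_image intro: image_eqI[of 0 p 0])
  have "glider_iso G M (glider_dsum (core G M) Z)"
  proof (rule glider_isoI[OF M is_glider_dsum[OF C Z], where f = "\<lambda>v. pm_inl (v - p v) + pm_inr (p v)"
        and h = "dsum_case (\<lambda>v. v) (\<lambda>v. v)"])
    show "lin (\<lambda>v. pm_inl (v - p v) + pm_inr (p v))"
      by (rule lin_plus[OF lin_comp[OF lin_pm_inl lin_minus[OF lin_id p(1)]] lin_comp[OF lin_pm_inr p(1)]])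
    show "lin (dsum_case (\<lambda>v. v) (\<lambda>v. v))" by (rule lin_dsum_case)
    have pz: "p v = 0" if "v \<in> ?C" for v using p(3) that by simp
    have pz1: "p v = 0" if "v \<in> lev1 M" for v using pz[OF lev1_in_generated0[OF M that]] .
    show "pm_inl (v - p v) + pm_inr (p v) \<in> lev1 (glider_dsum (core G M) Z)" if "v \<in> lev1 M" for v
      using that pz1[OF that] by (auto simp: Z_def intro!: dsum_spaceI)
    show "pm_inl (v - p v) + pm_inr (p v) \<in> lev0 (glider_dsum (core G M) Z)" if "v \<in> lev0 M" for v
      using that pC by (auto simp: Z_def intro!: dsum_spaceI)
    show "dsum_case (\<lambda>v. v) (\<lambda>v. v) w \<in> lev1 M" if "w \<in> lev1 (glider_dsum (core G M) Z)" for w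
      using that by (auto simp: Z_def dsum_case_sum lin_id elim!: dsum_spaceE)
    show "dsum_case (\<lambda>v. v) (\<lambda>v. v) w \<in> lev0 M" if "w \<in> lev0 (glider_dsum (core G M) Z)" for w
      using that CO p0 by (auto simp: Z_def dsum_case_sum lin_id elim!: dsum_spaceE intro!: pm.subspace_add[OF D(3)])
    show "dsum_case (\<lambda>v. v) (\<lambda>v. v) (pm_inl (v - p v) + pm_inr (p v)) = v" for v
      by (simp add: dsum_case_sum lin_id)
    show "pm_inl (dsum_case (\<lambda>v. v) (\<lambda>v. v) w - p (dsum_case (\<lambda>v. v) (\<lambda>v. v) w))
        + pm_inr (p (dsum_case (\<lambda>v. v) (\<lambda>v. v) w)) = w" if "w \<in> lev0 (glider_dsum (core G M) Z)" for w
      using that by (auto simp: Z_def dsum_case_sum lin_id lin_add[OF p(1)] pz p(2) elim!: dsum_spaceE)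
    show "pm_inl (act M g m - p (act M g m)) + pm_inr (p (act M g m))
        = act (glider_dsum (core G M) Z) g (pm_inl (m - p m) + pm_inr (p m))"
      if "g \<in> carrier G" "m \<in> lev1 M" for g m
      using pz[OF act_in_generated0[OF M that]] pz1[OF that(2)]
      by (simp add: Z_def dsum_case_sum lin_comp[OF lin_pm_inl D(6)[OF that(1)]] lin_pm_inr)
  qed
  then have "rcl G M = rcl G (glider_dsum (core G M) Z)"
    by (rule rcl_iso[OF M is_glider_dsum[OF C Z]])
  also have "\<dots> = rcl G (core G M) \<oplus>\<^bsub>reduced_groth_ring TYPE('k) G\<^esub> rcl G Z"
    by (rule rcl_dsum[OF C Z])
  also have "rcl G Z = \<zero>\<^bsub>reduced_groth_ring TYPE('k) G\<^esub>"
    by (rule rcl_length_zero[OF Z]) (simp add: length_zero_def Z_def)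
  finally show ?thesis
    using abelian_monoid.r_zero[OF _ rcl_closed[OF C]] cring.axioms(1)[OF reduced_groth_cring, where ?'k1 = 'k]
    by (metis abelian_group.axioms(1) ring.is_abelian_group)
qed

lemma same_relationsD:
  assumes "same_relations G M N f"
  shows "lin f" "f ` lev1 M = lev1 N" "inj_on f (lev1 M)" "\<And>v. v \<in> lev1 M \<Longrightarrow> f v \<in> lev1 N"
    "\<And>m. (\<And>g. g \<in> carrier G \<Longrightarrow> m g \<in> lev1 M) \<Longrightarrow>
        (\<Sum>g\<in>carrier G. act M g (m g)) = 0 \<longleftrightarrow> (\<Sum>g\<in>carrier G. act N g (f (m g))) = 0"
  using assms unfolding same_relations_def by blast+

lemma same_relations_sym:
  assumes f: "same_relations G M N f" and M: "is_glider G M"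
  obtains h where "same_relations G N M h" "\<And>v. v \<in> lev1 M \<Longrightarrow> h (f v) = v" "\<And>w. w \<in> lev1 N \<Longrightarrow> f (h w) = w"
proof -
  note D = same_relationsD[OF f]
  obtain h where h: "lin h" "\<And>v. v \<in> lev1 M \<Longrightarrow> h (f v) = v"
    using pmp.linear_exists_left_inverse_on[OF D(1) gliderD(2)[OF M] D(3)] by metis
  have hw: "h w \<in> lev1 M \<and> f (h w) = w" if "w \<in> lev1 N" for w
    using that h(2) D(2) by force
  have "h ` lev1 N = lev1 M" using hw h(2) D(4) by force
  moreover have "inj_on h (lev1 N)" using hw by (metis inj_onI)
  moreover have "(\<Sum>g\<in>carrier G. act N g (m g)) = 0 \<longleftrightarrow> (\<Sum>g\<in>carrier G. act M g (h (m g))) = 0"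
    if m: "\<forall>g\<in>carrier G. m g \<in> lev1 N" for m
  proof -
    have "(\<Sum>g\<in>carrier G. act N g (f (h (m g)))) = (\<Sum>g\<in>carrier G. act N g (m g))"
      using m hw by (intro sum.cong) auto
    then show ?thesis using D(5)[of "\<lambda>g. h (m g)"] m hw by simp
  qed
  ultimately have "same_relations G N M h" unfolding same_relations_def using h(1) by blast
  then show ?thesis using that h(2) hw by blast
qed

text \<open>
  The value at a sum \<open>\<Sum>g (m g)\<close> does not depend on \<open>m\<close>, because the difference of two families with
  the same sum is a relation.
\<close>

lemma same_relations_extend:
  assumes f: "same_relations G M N f" and M: "is_glider G M" and N: "is_glider G N"
  obtains F where "lin F"
    "\<And>m. (\<And>g. g \<in> carrier G \<Longrightarrow> m g \<in> lev1 M) \<Longrightarrow>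
       F (\<Sum>g\<in>carrier G. act M g (m g)) = (\<Sum>g\<in>carrier G. act N g (f (m g)))"
proof -
  note D = gliderD[OF M] and E = gliderD[OF N] and R = same_relationsD[OF f]
  define rep where "rep v = (SOME m. (\<forall>g\<in>carrier G. m g \<in> lev1 M) \<and> v = (\<Sum>g\<in>carrier G. act M g (m g)))" for v
  have rep: "\<forall>g\<in>carrier G. rep v g \<in> lev1 M" "v = (\<Sum>g\<in>carrier G. act M g (rep v g))"
    if "v \<in> generated0 G M" for v
  proof -
    have "\<exists>m. (\<forall>g\<in>carrier G. m g \<in> lev1 M) \<and> v = (\<Sum>g\<in>carrier G. act M g (m g))"
      using that unfolding generated0_def by blast
    from someI_ex[OF this] show "\<forall>g\<in>carrier G. rep v g \<in> lev1 M" "v = (\<Sum>g\<in>carrier G. act M g (rep v g))"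
      unfolding rep_def by blast+
  qed
  define F0 where "F0 v = (\<Sum>g\<in>carrier G. act N g (f (rep v g)))" for v
  have F0: "F0 (\<Sum>g\<in>carrier G. act M g (m g)) = (\<Sum>g\<in>carrier G. act N g (f (m g)))"
    if m: "\<And>g. g \<in> carrier G \<Longrightarrow> m g \<in> lev1 M" for m
  proof -
    let ?v = "\<Sum>g\<in>carrier G. act M g (m g)"
    have v: "?v \<in> generated0 G M" unfolding generated0_def using m by blast
    have "(\<Sum>g\<in>carrier G. act M g (rep ?v g - m g)) = (\<Sum>g\<in>carrier G. act M g (rep ?v g)) - ?v"
      by (simp add: lin_diff[OF D(6)] sum_subtractf)
    also have "\<dots> = 0" using rep(2)[OF v] by simp
    finally have "(\<Sum>g\<in>carrier G. act N g (f (rep ?v g - m g))) = 0"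
      using R(5)[of "\<lambda>g. rep ?v g - m g"] rep(1)[OF v] m pm.subspace_diff[OF D(2)] by simp
    then show ?thesis
      by (simp add: lin_diff[OF R(1)] lin_diff[OF E(6)] sum_subtractf F0_def)
  qed
  have add: "F0 (u + v) = F0 u + F0 v" if u: "u \<in> generated0 G M" and v: "v \<in> generated0 G M" for u v
  proof -
    have "u + v = (\<Sum>g\<in>carrier G. act M g (rep u g + rep v g))"
      using rep(2)[OF u] rep(2)[OF v] by (simp add: lin_add[OF D(6)] sum.distrib)
    then have "F0 (u + v) = (\<Sum>g\<in>carrier G. act N g (f (rep u g + rep v g)))"
      using F0[of "\<lambda>g. rep u g + rep v g"] rep(1)[OF u] rep(1)[OF v] pm.subspace_add[OF D(2)] by simp
    then show ?thesis by (simp add: lin_add[OF R(1)] lin_add[OF E(6)] sum.distrib F0_def)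
  qed
  have scale: "F0 (pscale c v) = pscale c (F0 v)" if v: "v \<in> generated0 G M" for c v
  proof -
    have "pscale c v = (\<Sum>g\<in>carrier G. act M g (pscale c (rep v g)))"
      by (subst rep(2)[OF v]) (simp add: lin_scale[OF D(6)] pscale_sum)
    then have "F0 (pscale c v) = (\<Sum>g\<in>carrier G. act N g (f (pscale c (rep v g))))"
      using F0[of "\<lambda>g. pscale c (rep v g)"] rep(1)[OF v] pm.subspace_scale[OF D(2)] by simp
    then show ?thesis by (simp add: lin_scale[OF R(1)] lin_scale[OF E(6)] pscale_sum F0_def)
  qed
  obtain F where F: "lin F" "\<And>v. v \<in> generated0 G M \<Longrightarrow> F v = F0 v"
    using extend_to_lin[OF generated0_subspace[OF M] add scale] by blast
  show ?thesis
  proof (rule that[OF F(1)])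
    fix m assume m: "\<And>g. g \<in> carrier G \<Longrightarrow> m g \<in> lev1 M"
    then have "(\<Sum>g\<in>carrier G. act M g (m g)) \<in> generated0 G M" unfolding generated0_def by blast
    then show "F (\<Sum>g\<in>carrier G. act M g (m g)) = (\<Sum>g\<in>carrier G. act N g (f (m g)))"
      using F(2) F0[OF m] by simp
  qed
qed

text \<open>
  The extensions of \<open>f\<close> and of its inverse are inverse to each other.
\<close>

lemma core_iso:
  assumes f: "same_relations G M N f" and M: "is_glider G M" and N: "is_glider G N"
  shows "glider_iso G (core G M) (core G N)"
proof -
  note D = gliderD[OF M] and E = gliderD[OF N] and R = same_relationsD[OF f]
  obtain h where h: "same_relations G N M h" "\<And>v. v \<in> lev1 M \<Longrightarrow> h (f v) = v" "\<And>w. w \<in> lev1 N \<Longrightarrow> f (h w) = w"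
    using same_relations_sym[OF f M] by blast
  note S = same_relationsD[OF h(1)]
  obtain F where F: "lin F" "\<And>m. (\<And>g. g \<in> carrier G \<Longrightarrow> m g \<in> lev1 M) \<Longrightarrow>
       F (\<Sum>g\<in>carrier G. act M g (m g)) = (\<Sum>g\<in>carrier G. act N g (f (m g)))"
    using same_relations_extend[OF f M N] by blast
  obtain H where H: "lin H" "\<And>m. (\<And>g. g \<in> carrier G \<Longrightarrow> m g \<in> lev1 N) \<Longrightarrow>
       H (\<Sum>g\<in>carrier G. act N g (m g)) = (\<Sum>g\<in>carrier G. act M g (h (m g)))"
    using same_relations_extend[OF h(1) N M] by blast
  have Fact: "F (act M a m) = act N a (f m)" if "a \<in> carrier G" "m \<in> lev1 M" for a m
    using F(2)[of "\<lambda>g. if g = a then m else 0"] that pm.subspace_0[OF D(2)]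
    by (simp add: act_point_mass[OF M] act_point_mass[OF N] if_distrib[of f] lin_zero[OF R(1)] cong: if_cong)
  have Hact: "H (act N a m) = act M a (h m)" if "a \<in> carrier G" "m \<in> lev1 N" for a m
    using H(2)[of "\<lambda>g. if g = a then m else 0"] that pm.subspace_0[OF E(2)]
    by (simp add: act_point_mass[OF M] act_point_mass[OF N] if_distrib[of h] lin_zero[OF S(1)] cong: if_cong)
  have F1: "F m = f m" if "m \<in> lev1 M" for m
    using Fact[OF one_closed that] that D(8,12) E(8,12) R(4) by simp
  have H1: "H m = h m" if "m \<in> lev1 N" for m
    using Hact[OF one_closed that] that D(8,12) E(8,12) S(4) by simp
  show ?thesis
  proof (rule glider_isoI[OF is_glider_core[OF M] is_glider_core[OF N] F(1) H(1)], unfold core_simps)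
    show "F v \<in> lev1 N" if "v \<in> lev1 M" for v using that F1 R(4) by simp
    show "H v \<in> lev1 M" if "v \<in> lev1 N" for v using that H1 S(4) by simp
    show "F v \<in> generated0 G N" if v: "v \<in> generated0 G M" for v
    proof -
      obtain m where m: "v = (\<Sum>g\<in>carrier G. act M g (m g))" "\<forall>g\<in>carrier G. m g \<in> lev1 M"
        using v unfolding generated0_def by blast
      then show ?thesis using F(2)[of m] R(4) unfolding generated0_def by auto
    qed
    show "H v \<in> generated0 G M" if v: "v \<in> generated0 G N" for v
    proof -
      obtain m where m: "v = (\<Sum>g\<in>carrier G. act N g (m g))" "\<forall>g\<in>carrier G. m g \<in> lev1 N"
        using v unfolding generated0_def by blast
      then show ?thesis using H(2)[of m] S(4) unfolding generated0_def by auto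
    qed
    show "H (F v) = v" if v: "v \<in> generated0 G M" for v
    proof -
      obtain m where m: "v = (\<Sum>g\<in>carrier G. act M g (m g))" "\<forall>g\<in>carrier G. m g \<in> lev1 M"
        using v unfolding generated0_def by blast
      then show ?thesis using F(2)[of m] H(2)[of "\<lambda>g. f (m g)"] R(4) h(2) by simp
    qed
    show "F (H v) = v" if v: "v \<in> generated0 G N" for v
    proof -
      obtain m where m: "v = (\<Sum>g\<in>carrier G. act N g (m g))" "\<forall>g\<in>carrier G. m g \<in> lev1 N"
        using v unfolding generated0_def by blast
      then show ?thesis using H(2)[of m] F(2)[of "\<lambda>g. h (m g)"] S(4) h(3) by simp
    qed
    show "F (act M g m) = act N g (F m)" if "g \<in> carrier G" "m \<in> lev1 M" for g m
      using Fact[OF that] F1[OF that(2)] by simp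
  qed
qed

lemma rcl_same_relations:
  fixes M :: "('g, 'b, 'k::field) glider" and N :: "('g, 'c, 'k) glider"
  assumes "same_relations G M N f" "is_glider G M" "is_glider G N"
  shows "rcl G M = rcl G N"
  using rcl_iso[OF is_glider_core[OF assms(2)] is_glider_core[OF assms(3)] core_iso[OF assms]]
    rcl_core[OF assms(2)] rcl_core[OF assms(3)] by simp

lemma iso_same_relations:
  assumes "glider_iso G M N" and M: "is_glider G M" and N: "is_glider G N"
  obtains f where "same_relations G M N f"
proof -
  obtain f h where "linear_iso_pair G M N f h" using glider_isoE[OF assms] by blast
  note f = linear_iso_pairD[OF this]
  note D = gliderD[OF M] and E = gliderD[OF N]
  have "(\<Sum>g\<in>carrier G. act M g (m g)) = 0 \<longleftrightarrow> (\<Sum>g\<in>carrier G. act N g (f (m g))) = 0"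
    if m: "\<forall>g\<in>carrier G. m g \<in> lev1 M" for m
  proof -
    have "(\<Sum>g\<in>carrier G. act N g (f (m g))) = f (\<Sum>g\<in>carrier G. act M g (m g))"
      using m f(9) by (simp add: lin_sum[OF f(1)])
    moreover have "(\<Sum>g\<in>carrier G. act M g (m g)) \<in> lev0 M"
      using m by (intro pm.subspace_sum[OF D(3)] D(13)) auto
    ultimately show ?thesis using f(7) lin_zero[OF f(1)] lin_zero[OF f(2)] by metis
  qed
  moreover have "f ` lev1 M = lev1 N"
    using f(3,5,8) E(10) by force
  moreover have "inj_on f (lev1 M)" using f(7) D(10) by (metis inj_onI)
  ultimately show ?thesis using that[of f] f(1) unfolding same_relations_def by blast
qed

end

section \<open>Irreducible gliders\<close>

lemma exists_lin_vector:
  fixes v :: "'a \<Rightarrow>\<^sub>0 'k::field" and w :: "'b \<Rightarrow>\<^sub>0 'k"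
  assumes "v \<noteq> 0"
  obtains f where "lin f" "f v = w"
proof -
  obtain a where a: "lookup v a \<noteq> 0" using assms by (metis poly_mapping_eqI lookup_zero)
  let ?f = "\<lambda>u. pscale (lookup u a / lookup v a) w"
  have "lin ?f"
    by (rule linI) (simp_all add: lookup_add lookup_pscale add_divide_distrib pscale_add_left pscale_pscale)
  then show ?thesis using that[of ?f] a by simp
qed

lemma span_singletonE:
  assumes "u \<in> pm.span {v}" obtains c where "u = pscale c v"
  using assms by (auto simp: pm.span_singleton)

lemma in_span_singleton: "pscale c v \<in> pm.span {v}"
  by (simp add: pm.span_base pm.span_scale)

lemma span_singleton_pscale:
  assumes "c \<noteq> 0" shows "pm.span {pscale c v} = pm.span {v}"
proof
  show "pm.span {pscale c v} \<subseteq> pm.span {v}"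
    by (rule pm.span_minimal) (simp_all add: in_span_singleton)
  have "v = pscale (1 / c) (pscale c v)" using assms by (simp add: pscale_pscale)
  then have "v \<in> pm.span {pscale c v}" by (metis in_span_singleton)
  then show "pm.span {v} \<subseteq> pm.span {pscale c v}" by (intro pm.span_minimal) simp_all
qed

lemma dim_subset_zero:
  assumes "pm.subspace V" "V \<subseteq> {0}" shows "pm.dim V = 0"
proof -
  have "V = pm.span {}" using assms pm.subspace_0[OF assms(1)] by (auto simp: pm.span_empty)
  then show ?thesis using pm.dim_span_eq_card_independent[of "{}"] by (simp add: pm.independent_empty)
qed

lemma subglider_iff:
  assumes "pm.subspace N0"
  shows "subglider G M N1 N0 \<longleftrightarrow> pm.subspace N1 \<and> N1 \<subseteq> lev1 M \<and> N0 \<subseteq> lev0 M \<and> N1 \<subseteq> N0 \<and>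
     (\<forall>m\<in>N1. \<forall>g\<in>carrier G. act M g m \<in> N0)"
  unfolding subglider_def using assms kg_act_closed_iff[OF assms, of G "act M"] by blast

context finite_group
begin

text \<open>
  If \<open>v\<close> is a nonzero vector of the lower level, its span below level 0 is a subglider, and so is the
  lower level below the submodule it generates. Irreducibility forces both to be the whole glider.
\<close>

lemma irreducible_iff:
  fixes M :: "('g, 'b, 'k::field) glider"
  shows "irreducible_glider G M \<longleftrightarrow>
    is_glider G M \<and> (\<exists>v. v \<noteq> 0 \<and> lev1 M = pm.span {v}) \<and> lev0 M = generated0 G M"
proof
  assume irr: "irreducible_glider G M"
  then have M: "is_glider G M" unfolding irreducible_glider_def by blast
  note D = gliderD[OF M]
  have min: "N1 = {0}" if "subglider G M N1 N0" "(N1, N0) \<noteq> (lev1 M, lev0 M)" for N1 N0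
    using irr that unfolding irreducible_glider_def by blast
  have "lev1 M \<noteq> {0}" using irr unfolding irreducible_glider_def length_one_def by blast
  then obtain v where v: "v \<in> lev1 M" "v \<noteq> 0" using pm.subspace_0[OF D(2)] by blast
  have sv: "pm.span {v} \<subseteq> lev1 M" by (rule pm.span_minimal) (simp_all add: v D)
  have "subglider G M (pm.span {v}) (lev0 M)"
    unfolding subglider_iff[OF D(3)] using sv subsetD[OF sv] D(10,13) by auto
  moreover have "pm.span {v} \<noteq> {0}" using pm.span_base[of v "{v}"] v(2) by blast
  ultimately have "lev1 M = pm.span {v}" using min by blast
  moreover have "subglider G M (lev1 M) (generated0 G M)"
    unfolding subglider_iff[OF generated0_subspace[OF M]]
    by (simp add: generated0_in_lev0[OF M] D(2) subsetI lev1_in_generated0[OF M] act_in_generated0[OF M])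
  then have "lev0 M = generated0 G M" using min \<open>lev1 M \<noteq> {0}\<close> by blast
  ultimately show "is_glider G M \<and> (\<exists>v. v \<noteq> 0 \<and> lev1 M = pm.span {v}) \<and> lev0 M = generated0 G M"
    using M v(2) by blast
next
  assume "is_glider G M \<and> (\<exists>v. v \<noteq> 0 \<and> lev1 M = pm.span {v}) \<and> lev0 M = generated0 G M"
  then obtain v where M: "is_glider G M" and v: "v \<noteq> 0" "lev1 M = pm.span {v}" and gen: "lev0 M = generated0 G M"
    by blast
  note D = gliderD[OF M]
  show "irreducible_glider G M"
    unfolding irreducible_glider_def
  proof (intro conjI allI impI M)
    show "length_one M" unfolding length_one_def v(2) using pm.span_base[of v "{v}"] v(1) by blast
    fix N1 N0 assume N: "subglider G M N1 N0 \<and> (N1, N0) \<noteq> (lev1 M, lev0 M)"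
    then have sub: "pm.subspace N1" "pm.subspace N0" "N1 \<subseteq> lev1 M" "N0 \<subseteq> lev0 M"
      unfolding subglider_def by blast+
    have kg: "\<forall>m\<in>N1. \<forall>g\<in>carrier G. act M g m \<in> N0"
      using N unfolding subglider_iff[OF sub(2)] by blast
    show "N1 = {0}"
    proof (rule ccontr)
      assume "N1 \<noteq> {0}"
      then obtain u where u: "u \<in> N1" "u \<noteq> 0" using pm.subspace_0[OF sub(1)] by blast
      then obtain c where c: "u = pscale c v" using sub(3) v(2) span_singletonE by blast
      have "c \<noteq> 0" using c u(2) by auto
      then have "pm.span {v} \<subseteq> N1"
        using span_singleton_pscale[of c v] pm.span_minimal[OF _ sub(1), of "{u}"] u(1) c by simp
      then have N1: "N1 = lev1 M" using sub(3) v(2) by blast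
      have "act M g m \<in> N0" if "g \<in> carrier G" "m \<in> lev1 M" for g m
        using kg that N1 by blast
      then have "generated0 G M \<subseteq> N0"
        unfolding generated0_def by (auto intro!: pm.subspace_sum[OF sub(2)])
      then show False using N N1 sub(4) gen by blast
    qed
  qed
qed

text \<open>
  The core is irreducible. This is how products, restrictions and inductions of irreducible classes
  are seen to be irreducible.
\<close>

lemma rcl_line:
  fixes M :: "('g, 'b, 'k::field) glider"
  assumes M: "is_glider G M" and v: "v \<noteq> 0" "lev1 M = pm.span {v}"
  shows "rcl G M \<in> reduced_class G ` irr1_classes TYPE('k) G"
proof -
  note C = is_glider_core[OF M]
  obtain N :: "('g, nat, 'k) glider" where N: "is_glider G N" "glider_iso G (core G M) N"
    using nat_representative[OF C] glider_iso_sym by metis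
  obtain f h where "linear_iso_pair G (core G M) N f h" using glider_isoE[OF N(2) C N(1)] by blast
  note f = linear_iso_pairD[OF this, unfolded core_simps]
  have vl: "v \<in> lev1 M" using v(2) pm.span_base by blast
  have "f ` lev1 M = lev1 N" using f(3,5,8) gliderD(10)[OF N(1)] by force
  then have "lev1 N = pm.span {f v}" using pmp.linear_span_image[OF f(1), of "{v}"] v(2) by simp
  moreover have "f v \<noteq> 0" using f(7)[OF lev1_in_generated0[OF M vl]] lin_zero[OF f(2)] v(1) by auto
  moreover have "lev0 N = generated0 G N"
  proof
    show "generated0 G N \<subseteq> lev0 N" by (rule generated0_in_lev0[OF N(1)])
    show "lev0 N \<subseteq> generated0 G N"
    proof
      fix w assume w: "w \<in> lev0 N"
      obtain m where m: "h w = (\<Sum>g\<in>carrier G. act M g (m g))" "\<forall>g\<in>carrier G. m g \<in> lev1 M"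
        using f(6)[OF w] unfolding generated0_def by blast
      have "w = f (\<Sum>g\<in>carrier G. act M g (m g))" using f(8)[OF w] m(1) by simp
      also have "\<dots> = (\<Sum>g\<in>carrier G. act N g (f (m g)))" using m(2) f(9) by (simp add: lin_sum[OF f(1)])
      finally show "w \<in> generated0 G N"
        unfolding generated0_def mem_Collect_eq using m(2) f(3) by (intro exI[of _ "\<lambda>g. f (m g)"]) simp
    qed
  qed
  ultimately have "irreducible_glider G N" using N(1) by (auto simp: irreducible_iff)
  then have "iso_class G N \<in> irr1_classes TYPE('k) G" unfolding irr1_classes_def by blast
  moreover have "rcl G N = rcl G M" using rcl_iso[OF C N(1,2)] rcl_core[OF M] by simp
  ultimately show ?thesis by (metis imageI)
qed

lemma irr1_classE:
  assumes "c \<in> irr1_classes TYPE('k::field) G"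
  obtains M :: "('g, nat, 'k::field) glider" and v where "is_glider G M" "v \<noteq> 0" "lev1 M = pm.span {v}"
    "lev0 M = generated0 G M" "c = iso_class G M"
proof -
  obtain M :: "('g, nat, 'k) glider" where M: "c = iso_class G M" "irreducible_glider G M"
    using assms unfolding irr1_classes_def by auto
  then obtain v where "v \<noteq> 0" "lev1 M = pm.span {v}" by (auto simp: irreducible_iff)
  with M show ?thesis by (intro that[of M v]) (simp_all add: irreducible_iff)
qed

lemma irr1_classes_carrier: "irr1_classes TYPE('k::field) G \<subseteq> carrier (iso_class_monoid TYPE('k) G)"
  by (auto elim!: irr1_classE intro: iso_class_in_carrier)

text \<open>
  On a line \<open>Kv\<close> a family of vectors is \<open>m g = x g v\<close>, and it is a relation if \<open>x\<close> annihilates \<open>v\<close>.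
\<close>

lemma ann_same_relations:
  fixes M :: "('g, 'b, 'k::field) glider" and N :: "('g, 'c, 'k) glider"
  assumes M: "is_glider G M" and N: "is_glider G N" and v: "v \<noteq> 0" "lev1 M = pm.span {v}"
    and w: "w \<noteq> 0" "lev1 N = pm.span {w}" and eq: "ann G M v = ann G N w"
  obtains f where "same_relations G M N f"
proof -
  obtain f where f: "lin f" "f v = w" using exists_lin_vector[OF v(1)] by blast
  have "f ` lev1 M = lev1 N" unfolding v(2) w(2) using pmp.linear_span_image[OF f(1), of "{v}"] f(2) by simp
  moreover have "inj_on f (lev1 M)"
  proof (rule inj_onI)
    fix x y assume xy: "x \<in> lev1 M" "y \<in> lev1 M" "f x = f y"
    then obtain a b where ab: "x = pscale a v" "y = pscale b v" unfolding v(2) by (metis span_singletonE)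
    then have "pscale a w = pscale b w" using xy(3) f by (simp add: lin_scale)
    then show "x = y" using ab w(1) by simp
  qed
  moreover have "(\<Sum>g\<in>carrier G. act M g (m g)) = 0 \<longleftrightarrow> (\<Sum>g\<in>carrier G. act N g (f (m g))) = 0"
    if m: "\<forall>g\<in>carrier G. m g \<in> lev1 M" for m
  proof -
    have "\<forall>g\<in>carrier G. \<exists>c. m g = pscale c v" using m v(2) by (metis span_singletonE)
    then obtain x where x: "\<forall>g\<in>carrier G. m g = pscale (x g) v" by metis
    have "(\<Sum>g\<in>carrier G. act M g (m g)) = (\<Sum>g\<in>carrier G. pscale (x g) (act M g v))"
      using x by (intro sum.cong) (auto simp: lin_scale[OF gliderD(6)[OF M]])
    moreover have "(\<Sum>g\<in>carrier G. act N g (f (m g))) = (\<Sum>g\<in>carrier G. pscale (x g) (act N g w))"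
      using x f by (intro sum.cong) (auto simp: lin_scale[OF gliderD(6)[OF N]] lin_scale[OF f(1)])
    moreover have "x \<in> ann G M v \<longleftrightarrow> x \<in> ann G N w" using eq by simp
    ultimately show ?thesis by (simp add: ann_def)
  qed
  ultimately show ?thesis using that f(1) unfolding same_relations_def by blast
qed

lemma ann_iso_class:
  fixes M :: "('g, 'b, 'k::field) glider" and N :: "('g, 'c, 'k) glider"
  assumes M: "is_glider G M" "lev0 M = generated0 G M" and N: "is_glider G N" "lev0 N = generated0 G N"
    and v: "v \<noteq> 0" "lev1 M = pm.span {v}"
    and w: "w \<noteq> 0" "lev1 N = pm.span {w}" and eq: "ann G M v = ann G N w"
  shows "iso_class G M = iso_class G N"
proof -
  have cM: "core G M = M" and cN: "core G N = N"
    unfolding core_def M(2)[symmetric] N(2)[symmetric] by simp_all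
  obtain f where "same_relations G M N f" using ann_same_relations[OF M(1) N(1) v w eq] .
  from core_iso[OF this M(1) N(1)] show ?thesis
    using M(1) N(1) by (simp add: iso_class_eq_iff cM cN)
qed

section \<open>Additive invariants\<close>

text \<open>
  The action of \<open>x\<close> is linear, the scalars being central.
\<close>

lemma annihilated_subspace:
  assumes M: "is_glider G M"
  shows "pm.subspace (annihilated G A M)"
proof (rule pm.subspaceI)
  note D = gliderD[OF M]
  have sum: "(\<Sum>g\<in>carrier G. pscale (x g) (act M g (u + v)))
    = (\<Sum>g\<in>carrier G. pscale (x g) (act M g u)) + (\<Sum>g\<in>carrier G. pscale (x g) (act M g v))" for x u v
    by (simp add: lin_add[OF D(6)] pscale_add_right sum.distrib)
  have scale: "(\<Sum>g\<in>carrier G. pscale (x g) (act M g (pscale c v)))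
    = pscale c (\<Sum>g\<in>carrier G. pscale (x g) (act M g v))" for x c v
    by (simp add: lin_scale[OF D(6)] pscale_sum pscale_pscale mult.commute)
  show "0 \<in> annihilated G A M"
    by (auto simp: annihilated_def ann_def pm.subspace_0[OF D(2)] lin_zero[OF D(6)])
  show "u + v \<in> annihilated G A M" if "u \<in> annihilated G A M" "v \<in> annihilated G A M" for u v
    using that by (auto simp: annihilated_def ann_def pm.subspace_add[OF D(2)] sum subset_iff)
  show "pscale c v \<in> annihilated G A M" if "v \<in> annihilated G A M" for c v
    using that by (auto simp: annihilated_def ann_def pm.subspace_scale[OF D(2)] scale subset_iff)
qed

lemma annihilated_findim: "is_glider G M \<Longrightarrow> findim (annihilated G A M)"
  by (rule findim_subspace[OF gliderD(4) annihilated_subspace]) (auto simp: annihilated_def)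

lemma ann_image:
  assumes f: "same_relations G M N f" and M: "is_glider G M" and N: "is_glider G N" and v: "v \<in> lev1 M"
  shows "ann G N (f v) = ann G M v"
proof -
  note R = same_relationsD[OF f]
  have "(\<Sum>g\<in>carrier G. pscale (x g) (act M g v)) = 0 \<longleftrightarrow> (\<Sum>g\<in>carrier G. pscale (x g) (act N g (f v))) = 0" for x
    using R(5)[of "\<lambda>g. pscale (x g) v"] v
    by (simp add: lin_scale[OF R(1)] lin_scale[OF gliderD(6)[OF M]] lin_scale[OF gliderD(6)[OF N]]
        pm.subspace_scale[OF gliderD(2)[OF M]])
  then show ?thesis unfolding ann_def by blast
qed

lemma dim_annihilated_iso:
  assumes iso: "glider_iso G M N" and M: "is_glider G M" and N: "is_glider G N"
  shows "pm.dim (annihilated G A N) = pm.dim (annihilated G A M)"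
proof -
  obtain f where f: "same_relations G M N f" using iso_same_relations[OF assms] .
  note R = same_relationsD[OF f]
  have "annihilated G A N = f ` annihilated G A M"
    unfolding annihilated_def using ann_image[OF f M N] R(2,4) by force
  moreover have "inj_on f (annihilated G A M)"
    using R(3) by (rule inj_on_subset) (auto simp: annihilated_def)
  ultimately show ?thesis using dim_lin_image[OF R(1) annihilated_subspace[OF M]] by simp
qed

lemma dim_annihilated_dsum:
  assumes M: "is_glider G M" and N: "is_glider G N"
  shows "pm.dim (annihilated G A (glider_dsum M N)) = pm.dim (annihilated G A M) + pm.dim (annihilated G A N)"
proof -
  note D = gliderD[OF M] and E = gliderD[OF N]
  have ann: "ann G (glider_dsum M N) (pm_inl v + pm_inr w) = ann G M v \<inter> ann G N w" for v w
  proof -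
    have "(\<Sum>g\<in>carrier G. pscale (x g) (act (glider_dsum M N) g (pm_inl v + pm_inr w)))
      = pm_inl (\<Sum>g\<in>carrier G. pscale (x g) (act M g v)) + pm_inr (\<Sum>g\<in>carrier G. pscale (x g) (act N g w))" for x
      by (simp add: dsum_case_sum lin_comp[OF lin_pm_inl D(6)] lin_comp[OF lin_pm_inr E(6)] pscale_add_right
          sum.distrib lin_sum[OF lin_pm_inl] lin_scale[OF lin_pm_inl] lin_sum[OF lin_pm_inr] lin_scale[OF lin_pm_inr])
    then have "(\<Sum>g\<in>carrier G. pscale (x g) (act (glider_dsum M N) g (pm_inl v + pm_inr w))) = 0 \<longleftrightarrow>
      (\<Sum>g\<in>carrier G. pscale (x g) (act M g v)) = 0 \<and> (\<Sum>g\<in>carrier G. pscale (x g) (act N g w)) = 0" for x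
      using pm_sum_eq_iff[of _ _ 0 0] by (simp add: lin_zero[OF lin_pm_inl] lin_zero[OF lin_pm_inr])
    then show ?thesis unfolding ann_def by blast
  qed
  have "annihilated G A (glider_dsum M N) = dsum_space (annihilated G A M) (annihilated G A N)"
  proof (intro equalityI subsetI)
    fix z assume z: "z \<in> annihilated G A (glider_dsum M N)"
    then have "z \<in> dsum_space (lev1 M) (lev1 N)" by (simp add: annihilated_def)
    then obtain v w where "z = pm_inl v + pm_inr w" "v \<in> lev1 M" "w \<in> lev1 N" by (rule dsum_spaceE)
    then show "z \<in> dsum_space (annihilated G A M) (annihilated G A N)"
      using z by (auto simp: annihilated_def ann intro!: dsum_spaceI)
  next
    fix z assume "z \<in> dsum_space (annihilated G A M) (annihilated G A N)"
    then obtain v w where "z = pm_inl v + pm_inr w" "v \<in> annihilated G A M" "w \<in> annihilated G A N"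
      by (rule dsum_spaceE)
    then show "z \<in> annihilated G A (glider_dsum M N)"
      by (auto simp: annihilated_def ann intro!: dsum_spaceI)
  qed
  then show ?thesis
    using dim_dsum_space[OF annihilated_findim[OF M] annihilated_subspace[OF M]
        annihilated_findim[OF N] annihilated_subspace[OF N]] by simp
qed

lemma dim_annihilated_length_zero:
  assumes M: "is_glider G M" "length_zero M"
  shows "pm.dim (annihilated G A M) = 0"
proof -
  have "annihilated G A M \<subseteq> {0}" using M(2) by (auto simp: annihilated_def length_zero_def)
  then show ?thesis by (rule dim_subset_zero[OF annihilated_subspace[OF M(1)]])
qed

text \<open>
  All of the line is annihilated or only zero.
\<close>

lemma dim_annihilated_line:
  assumes M: "is_glider G M" and v: "v \<noteq> 0" "lev1 M = pm.span {v}"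
  shows "pm.dim (annihilated G A M) = (if A \<subseteq> ann G M v then 1 else 0)"
proof (cases "A \<subseteq> ann G M v")
  case True
  have "pm.span {v} \<subseteq> annihilated G A M"
    by (rule pm.span_minimal[OF _ annihilated_subspace[OF M]])
      (use True v(2) in \<open>simp add: annihilated_def pm.span_base\<close>)
  then have "annihilated G A M = pm.span {v}" using v(2) by (auto simp: annihilated_def)
  then show ?thesis using True v(1) pm.dim_span_eq_card_independent[of "{v}"] by simp
next
  case False
  have "u = 0" if u: "u \<in> annihilated G A M" for u
  proof (rule ccontr)
    assume "u \<noteq> 0"
    obtain c where c: "u = pscale c v" using u v(2) span_singletonE unfolding annihilated_def by blast
    then have "c \<noteq> 0" using \<open>u \<noteq> 0\<close> by auto
    then have "v = pscale (1 / c) u" by (simp add: c pscale_pscale)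
    then have "v \<in> annihilated G A M" using pm.subspace_scale[OF annihilated_subspace[OF M] u] by metis
    then show False using False by (simp add: annihilated_def)
  qed
  then have "annihilated G A M \<subseteq> {0}" by blast
  then show ?thesis using False dim_subset_zero[OF annihilated_subspace[OF M]] by simp
qed

definition class_dim :: "('g \<Rightarrow> 'k::field) set \<Rightarrow> ('g, nat, 'k) glider set \<Rightarrow> int" where
  "class_dim A c = int (pm.dim (annihilated G A (SOME M. M \<in> c)))"

lemma class_dim_eq:
  fixes M :: "('g, 'b, 'k::field) glider"
  assumes M: "is_glider G M"
  shows "class_dim A (iso_class G M) = int (pm.dim (annihilated G A M))"
proof -
  obtain N :: "('g, nat, 'k) glider" where N: "is_glider G N" "glider_iso G N M"
    using nat_representative[OF M] .
  then have "N \<in> iso_class G M" unfolding iso_class_def by blast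
  then have "(SOME N. N \<in> iso_class G M) \<in> iso_class G M" by (rule someI)
  then show ?thesis
    unfolding class_dim_def iso_class_def using dim_annihilated_iso M
    by (metis (mono_tags, lifting) mem_Collect_eq)
qed

text \<open>
  The additive extension of the invariant to the free abelian group on the classes.
\<close>

definition dim_form :: "('g \<Rightarrow> 'k::field) set \<Rightarrow> (('g, nat, 'k) glider set \<Rightarrow>\<^sub>0 int) \<Rightarrow> int" where
  "dim_form A x = (\<Sum>c\<in>keys x. lookup x c * class_dim A c)"

lemma dim_form_superset:
  assumes "finite C" "keys x \<subseteq> C"
  shows "dim_form A x = (\<Sum>c\<in>C. lookup x c * class_dim A c)"
  unfolding dim_form_def
  by (rule sum.mono_neutral_left) (use assms in \<open>auto simp: in_keys_iff\<close>)

lemma dim_form_diff: "dim_form A (x - y) = dim_form A x - dim_form A y"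
proof -
  let ?C = "keys x \<union> keys y"
  have "dim_form A z = (\<Sum>c\<in>?C. lookup z c * class_dim A c)" if "z \<in> {x, y, x - y}" for z
    using that keys_diff_subset[of x ?C y] by (intro dim_form_superset) auto
  then show ?thesis by (simp add: lookup_minus left_diff_distrib sum_subtractf)
qed

lemma dim_form_bv: "dim_form A (bv c) = class_dim A c"
  by (subst dim_form_superset[of "{c}"]) simp_all

lemma dim_form_eq:
  fixes A :: "('g \<Rightarrow> 'k::field) set"
  assumes "x \<in> carrier (free_groth_ring TYPE('k) G)" "y \<in> carrier (free_groth_ring TYPE('k) G)"
    and "groth_proj G x = groth_proj G y"
  shows "dim_form A x = dim_form A y"
proof (rule groth_proj_factor[OF group_integer_group _ _ _ assms])
  have "dim_form A (u + v) = dim_form A u + dim_form A v" for u v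
    using dim_form_diff[of A "u + v" v] by simp
  then show "dim_form A \<in> hom (add_monoid (free_groth_ring TYPE('k) G)) integer_group"
    by (intro homI) (simp_all add: integer_group_def free_groth_ring_def)
  fix z :: "('g, nat, 'k) glider set \<Rightarrow>\<^sub>0 int"
  show "dim_form A z = \<one>\<^bsub>integer_group\<^esub>" if "z \<in> split_gens G"
  proof -
    obtain M N :: "('g, nat, 'k) glider" where MN: "is_glider G M" "is_glider G N"
      and z: "z = bv (iso_class G (glider_dsum M N)) - bv (iso_class G M) - bv (iso_class G N)"
      using \<open>z \<in> split_gens G\<close> unfolding split_gens_def by auto
    show ?thesis
      unfolding z by (simp add: integer_group_def dim_form_diff dim_form_bv class_dim_eq MN is_glider_dsum
          dim_annihilated_dsum)
  qed
  show "dim_form A z = \<one>\<^bsub>integer_group\<^esub>" if "z \<in> length_zero_gens G"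
    using that unfolding length_zero_gens_def
    by (auto simp: integer_group_def dim_form_bv class_dim_eq dim_annihilated_length_zero)
qed

text \<open>
  The invariant for \<open>A\<close> tells whether \<open>A\<close> lies in the annihilator, for every \<open>A\<close>.
\<close>

lemma rcl_eq_imp_ann_eq:
  fixes M :: "('g, 'b, 'k::field) glider" and N :: "('g, 'c, 'k) glider"
  assumes M: "is_glider G M" and v: "v \<noteq> 0" "lev1 M = pm.span {v}"
    and N: "is_glider G N" and w: "w \<noteq> 0" "lev1 N = pm.span {w}" and eq: "rcl G M = rcl G N"
  shows "ann G M v = ann G N w"
proof -
  have iff: "(A \<subseteq> ann G M v) = (A \<subseteq> ann G N w)" for A
  proof -
    have "dim_form A (bv (iso_class G M)) = dim_form A (bv (iso_class G N))"
      using eq unfolding reduced_class_eq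
      by (rule dim_form_eq[OF bv_in_free_groth[OF M] bv_in_free_groth[OF N]])
    then have "pm.dim (annihilated G A M) = pm.dim (annihilated G A N)"
      unfolding dim_form_bv class_dim_eq[OF M] class_dim_eq[OF N] by linarith
    then show ?thesis
      unfolding dim_annihilated_line[OF M v] dim_annihilated_line[OF N w] by (metis zero_neq_one)
  qed
  from iff[of "ann G M v"] iff[of "ann G N w"] show ?thesis by blast
qed

lemma reduced_class_inj_on: "inj_on (reduced_class G) (irr1_classes TYPE('k::field) G)"
proof (rule inj_onI)
  fix c d :: "('g, nat, 'k) glider set"
  assume cd: "c \<in> irr1_classes TYPE('k) G" "d \<in> irr1_classes TYPE('k) G" "reduced_class G c = reduced_class G d"
  obtain M :: "('g, nat, 'k) glider" and v where M: "is_glider G M" "v \<noteq> 0" "lev1 M = pm.span {v}"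
    "lev0 M = generated0 G M" "c = iso_class G M" by (rule irr1_classE[OF cd(1)])
  obtain N :: "('g, nat, 'k) glider" and w where N: "is_glider G N" "w \<noteq> 0" "lev1 N = pm.span {w}"
    "lev0 N = generated0 G N" "d = iso_class G N" by (rule irr1_classE[OF cd(2)])
  show "c = d"
    unfolding M(5) N(5)
    by (rule ann_iso_class[OF M(1,4) N(1,4) M(2,3) N(2,3)
          rcl_eq_imp_ann_eq[OF M(1-3) N(1-3) cd(3)[unfolded M(5) N(5)]]])
qed

text \<open>
  The values of the invariants at the irreducible classes form a unitriangular matrix with respect
  to inclusion of annihilators. At a maximal annihilator only one term of a combination survives.
\<close>

lemma irreducible_independent:
  assumes x: "keys x \<subseteq> irr1_classes TYPE('k::field) G"
    and zero: "groth_proj G x = \<zero>\<^bsub>reduced_groth_ring TYPE('k) G\<^esub>"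
  shows "x = 0"
proof (rule ccontr)
  assume "x \<noteq> 0"
  let ?F = "free_groth_ring TYPE('k) G"
  interpret q: group_hom "add_monoid ?F" "add_monoid (reduced_groth_ring TYPE('k) G)" "groth_proj G"
    by (rule groth_proj_group_hom)
  have xc: "x \<in> carrier ?F" using x irr1_classes_carrier by (auto simp: free_groth_ring_def)
  have "groth_proj G 0 = \<zero>\<^bsub>reduced_groth_ring TYPE('k) G\<^esub>"
    using q.hom_one by (simp add: free_groth_ring_def)
  then have form0: "dim_form A x = 0" for A
    using dim_form_eq[OF xc, of 0 A] zero by (simp add: free_groth_ring_def dim_form_def)
  define P where "P c I \<longleftrightarrow> (\<exists>(M :: ('g, nat, 'k) glider) v. is_glider G M \<and> v \<noteq> 0 \<and> lev1 M = pm.span {v} \<and>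
    lev0 M = generated0 G M \<and> c = iso_class G M \<and> I = ann G M v)" for c I
  have "\<exists>I. P c I" if "c \<in> irr1_classes TYPE('k) G" for c
    using irr1_classE[OF that] unfolding P_def by metis
  then obtain I where PI: "\<And>c. c \<in> irr1_classes TYPE('k) G \<Longrightarrow> P c (I c)"
    by metis
  have I: "class_dim A c = (if A \<subseteq> I c then 1 else 0)" if c: "c \<in> irr1_classes TYPE('k) G" for c A
  proof -
    obtain M :: "('g, nat, 'k) glider" and v where M: "is_glider G M" "v \<noteq> 0" "lev1 M = pm.span {v}"
      "c = iso_class G M" "I c = ann G M v" using PI[OF c] unfolding P_def by blast
    show ?thesis unfolding M(4) class_dim_eq[OF M(1)] dim_annihilated_line[OF M(1-3)] M(5)[unfolded M(4)] by simp
  qed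
  have inj: "c = d" if cd: "c \<in> irr1_classes TYPE('k) G" "d \<in> irr1_classes TYPE('k) G" "I c = I d" for c d
  proof -
    obtain M :: "('g, nat, 'k) glider" and v where M: "is_glider G M" "v \<noteq> 0" "lev1 M = pm.span {v}"
      "lev0 M = generated0 G M" "c = iso_class G M" "I c = ann G M v" using PI[OF cd(1)] unfolding P_def by blast
    obtain N :: "('g, nat, 'k) glider" and w where N: "is_glider G N" "w \<noteq> 0" "lev1 N = pm.span {w}"
      "lev0 N = generated0 G N" "d = iso_class G N" "I d = ann G N w" using PI[OF cd(2)] unfolding P_def by blast
    have "ann G M v = ann G N w" using cd(3) M(6) N(6) by simp
    then show ?thesis unfolding M(5) N(5) by (rule ann_iso_class[OF M(1,4) N(1,4) M(2,3) N(2,3)])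
  qed
  have "I ` keys x \<noteq> {}" using \<open>x \<noteq> 0\<close> by simp
  from finite_has_maximal[OF _ this] obtain c where c: "c \<in> keys x"
    and max: "\<And>d. d \<in> keys x \<Longrightarrow> I c \<subseteq> I d \<Longrightarrow> I c = I d" by auto
  have ev: "class_dim (I c) d = (if d = c then 1 else 0)" if d: "d \<in> keys x" for d
  proof (cases "I c \<subseteq> I d")
    case True
    then have "I c = I d" by (rule max[OF d])
    then have "c = d" using inj[of c d] c d x by blast
    then show ?thesis using I[of c "I c"] c x by auto
  next
    case False
    then show ?thesis using I[of d "I c"] d x by auto
  qed
  have "dim_form (I c) x = (\<Sum>d\<in>keys x. if d = c then lookup x c else 0)"
    unfolding dim_form_def by (rule sum.cong) (auto simp: ev)
  also have "\<dots> = lookup x c" using c by simp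
  finally show False using form0[of "I c"] c by (simp add: in_keys_iff)
qed

end

section \<open>The ring spanned by the irreducible gliders\<close>

lemma additive_eq_on_generate:
  assumes "group A" "group B" "f \<in> hom A B" "f' \<in> hom A B" "S \<subseteq> carrier A"
    and eq: "\<And>s. s \<in> S \<Longrightarrow> f s = f' s" and x: "x \<in> generate A S"
  shows "f x = f' x"
proof -
  interpret f: group_hom A B f using assms by (simp add: group_hom_def group_hom_axioms_def)
  interpret f': group_hom A B f' using assms by (simp add: group_hom_def group_hom_axioms_def)
  show ?thesis
    using x
  proof (induction rule: generate.induct)
    case (inv s)
    then show ?case using assms(5) eq by (auto simp: subset_iff)
  next
    case (eng a b)
    then show ?case using f.G.generate_in_carrier[OF assms(5)] by simp
  qed (use eq in simp_all)
qed

lemma irr1_monoid_simps [simp]: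
  "carrier (irr1_monoid K G) = reduced_class G ` irr1_classes K G"
  "monoid.mult (irr1_monoid K G) = monoid.mult (reduced_groth_ring K G)"
  "monoid.one (irr1_monoid K G) = monoid.one (reduced_groth_ring K G)"
  by (simp_all add: irr1_monoid_def R1bar_def)

lemma R1bar_simps [simp]:
  "monoid.mult (R1bar K G) = monoid.mult (reduced_groth_ring K G)"
  "monoid.one (R1bar K G) = monoid.one (reduced_groth_ring K G)"
  "zero (R1bar K G) = zero (reduced_groth_ring K G)"
  "add (R1bar K G) = add (reduced_groth_ring K G)"
  by (simp_all add: R1bar_def)

lemma tensor_space_line: "tensor_space (pm.span {v}) (pm.span {w}) = pm.span {pure_tensor v w}"
  by (simp add: tensor_space_span)

context finite_group
begin

text \<open>
  The tensor product of two lines is a line.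
\<close>

lemma irreducible_mult_closed:
  assumes "a \<in> reduced_class G ` irr1_classes TYPE('k::field) G" "b \<in> reduced_class G ` irr1_classes TYPE('k) G"
  shows "a \<otimes>\<^bsub>reduced_groth_ring TYPE('k) G\<^esub> b \<in> reduced_class G ` irr1_classes TYPE('k) G"
proof -
  obtain c d where cd: "c \<in> irr1_classes TYPE('k) G" "a = reduced_class G c"
    "d \<in> irr1_classes TYPE('k) G" "b = reduced_class G d" using assms by blast
  obtain M :: "('g, nat, 'k) glider" and v where M: "is_glider G M" "v \<noteq> 0" "lev1 M = pm.span {v}"
    "lev0 M = generated0 G M" "c = iso_class G M" by (rule irr1_classE[OF cd(1)])
  obtain N :: "('g, nat, 'k) glider" and w where N: "is_glider G N" "w \<noteq> 0" "lev1 N = pm.span {w}"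
    "lev0 N = generated0 G N" "d = iso_class G N" by (rule irr1_classE[OF cd(3)])
  have "rcl G (glider_tensor M N) \<in> reduced_class G ` irr1_classes TYPE('k) G"
    by (rule rcl_line[OF is_glider_tensor[OF M(1) N(1)], of "pure_tensor v w"])
      (simp_all add: M N pure_tensor_eq_0_iff tensor_space_line)
  then show ?thesis unfolding cd M(5) N(5) by (simp add: rcl_tensor[OF M(1) N(1)])
qed

lemma one_irreducible: "\<one>\<^bsub>reduced_groth_ring TYPE('k::field) G\<^esub> \<in> reduced_class G ` irr1_classes TYPE('k) G"
proof -
  have one: "\<one>\<^bsub>free_groth_ring TYPE('k) G\<^esub> = bv (iso_class G (glider_unit :: ('g, unit, 'k) glider))"
    by (simp add: free_groth_ring_def iso_class_monoid_def)
  have "v \<in> pm.span {bv ()}" for v :: "unit \<Rightarrow>\<^sub>0 'k"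
  proof -
    have "v = pscale (lookup v ()) (bv ())"
      by (auto intro!: poly_mapping_eqI simp: lookup_pscale)
    then show ?thesis by (metis in_span_singleton)
  qed
  then have "lev1 (glider_unit :: ('g, unit, 'k) glider) = pm.span {bv ()}"
    unfolding glider_unit_def by auto
  moreover have "bv () \<noteq> (0 :: unit \<Rightarrow>\<^sub>0 'k)"
    using lookup_single_eq[of "()" "1 :: 'k"] by force
  ultimately have "rcl G (glider_unit :: ('g, unit, 'k) glider) \<in> reduced_class G ` irr1_classes TYPE('k) G"
    by (intro rcl_line[OF is_glider_unit, of "bv ()"])
  then show ?thesis
    using ring_hom_one[OF groth_proj_hom, where ?'k1 = 'k] by (simp add: one reduced_class_eq)
qed

lemma irreducible_carrier:
  "reduced_class G ` irr1_classes TYPE('k::field) G \<subseteq> carrier (reduced_groth_ring TYPE('k) G)"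
  by (auto elim!: irr1_classE intro: rcl_closed)

lemma irreducible_span:
  "groth_proj G ` {x. keys x \<subseteq> irr1_classes TYPE('k::field) G}
     = generate (add_monoid (reduced_groth_ring TYPE('k) G)) (reduced_class G ` irr1_classes TYPE('k) G)"
proof -
  let ?F = "free_groth_ring TYPE('k) G" and ?irr = "irr1_classes TYPE('k) G"
  interpret F: cring ?F by (rule free_groth_cring)
  interpret q: group_hom "add_monoid ?F" "add_monoid (reduced_groth_ring TYPE('k) G)" "groth_proj G"
    by (rule groth_proj_group_hom)
  have sub: "subgroup {x. keys x \<subseteq> ?irr} (add_monoid ?F)"
  proof (rule F.add.subgroupI)
    show "{x. keys x \<subseteq> ?irr} \<subseteq> carrier ?F"
      using irr1_classes_carrier by (auto simp: free_groth_ring_def)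
    show "{x :: _ \<Rightarrow>\<^sub>0 int. keys x \<subseteq> ?irr} \<noteq> {}" by (auto intro: exI[of _ 0])
    show "\<ominus>\<^bsub>?F\<^esub> x \<in> {x. keys x \<subseteq> ?irr}" if "x \<in> {x. keys x \<subseteq> ?irr}" for x
      using that monoid_algebra_a_inv[OF free_groth_cring[unfolded free_groth_ring_def], of x] irr1_classes_carrier[where ?'k = 'k]
      by (simp add: free_groth_ring_def subset_trans)
    show "x \<oplus>\<^bsub>?F\<^esub> y \<in> {x. keys x \<subseteq> ?irr}"
      if "x \<in> {x. keys x \<subseteq> ?irr}" "y \<in> {x. keys x \<subseteq> ?irr}" for x y
      using that by (simp add: free_groth_ring_def keys_add_subset)
  qed
  have "generate (add_monoid ?F) (bv ` ?irr) = {x. keys x \<subseteq> ?irr}"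
  proof
    show "generate (add_monoid ?F) (bv ` ?irr) \<subseteq> {x. keys x \<subseteq> ?irr}"
      by (rule F.add.generate_subgroup_incl[OF _ sub]) auto
    show "{x. keys x \<subseteq> ?irr} \<subseteq> generate (add_monoid ?F) (bv ` ?irr)"
      using monoid_algebra_generated[OF free_groth_cring[unfolded free_groth_ring_def] _ irr1_classes_carrier]
      by (auto simp: free_groth_ring_def)
  qed
  moreover have "generate (add_monoid (reduced_groth_ring TYPE('k) G)) (groth_proj G ` (bv ` ?irr))
     = groth_proj G ` generate (add_monoid ?F) (bv ` ?irr)"
    by (rule q.generate_img) (use irr1_classes_carrier in \<open>auto simp: free_groth_ring_def\<close>)
  ultimately show ?thesis by (simp add: image_image reduced_class_eq)
qed

text \<open>
  The irreducible classes contain the unit and are closed under products, so their additive span is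
  already a subring.
\<close>

lemma carrier_R1bar:
  "carrier (R1bar TYPE('k::field) G)
     = generate (add_monoid (reduced_groth_ring TYPE('k) G)) (reduced_class G ` irr1_classes TYPE('k) G)"
proof -
  let ?R = "reduced_groth_ring TYPE('k) G" and ?S = "reduced_class G ` irr1_classes TYPE('k) G"
  interpret R: cring ?R by (rule reduced_groth_cring)
  have sub: "subgroup (generate (add_monoid ?R) ?S) (add_monoid ?R)"
    by (rule R.add.generate_is_subgroup) (use irreducible_carrier in simp)
  have "subring (generate (add_monoid ?R) ?S) ?R"
  proof (rule R.subringI)
    show "generate (add_monoid ?R) ?S \<subseteq> carrier ?R" using subgroup.subset[OF sub] by simp
    show "\<one>\<^bsub>?R\<^esub> \<in> generate (add_monoid ?R) ?S" by (rule generate.incl[OF one_irreducible])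
    show "\<ominus>\<^bsub>?R\<^esub> h \<in> generate (add_monoid ?R) ?S" if "h \<in> generate (add_monoid ?R) ?S" for h
      using subgroup.m_inv_closed[OF sub that] by (simp add: a_inv_def)
    show "a \<otimes>\<^bsub>?R\<^esub> b \<in> generate (add_monoid ?R) ?S"
      if "a \<in> generate (add_monoid ?R) ?S" "b \<in> generate (add_monoid ?R) ?S" for a b
      by (rule R.generate_mult[OF irreducible_carrier irreducible_carrier generate.incl[OF irreducible_mult_closed] that])
    show "a \<oplus>\<^bsub>?R\<^esub> b \<in> generate (add_monoid ?R) ?S"
      if "a \<in> generate (add_monoid ?R) ?S" "b \<in> generate (add_monoid ?R) ?S" for a b
      using subgroup.m_closed[OF sub that] by simp
  qed
  then have "generate_ring ?R ?S \<subseteq> generate (add_monoid ?R) ?S"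
    by (rule R.generate_ring_min_subring1[OF irreducible_carrier]) (auto intro: generate.incl)
  moreover have "x \<in> generate_ring ?R ?S" if "x \<in> generate (add_monoid ?R) ?S" for x
    using that
  proof (induction rule: generate.induct)
    case (inv h)
    show ?case using generate_ring.a_inv[OF generate_ring.incl[OF inv], of ?R] by (simp only: a_inv_def)
  qed (auto intro: generate_ring.incl generate_ring.eng_add R.zero_in_generate)
  ultimately show ?thesis by (auto simp: R1bar_def)
qed

lemma R1bar_subset: "carrier (R1bar TYPE('k::field) G) \<subseteq> carrier (reduced_groth_ring TYPE('k) G)"
proof -
  interpret R: cring "reduced_groth_ring TYPE('k) G" by (rule reduced_groth_cring)
  show ?thesis unfolding carrier_R1bar using R.add.generate_incl irreducible_carrier by simp
qed

lemma R1bar_cring: "cring (R1bar TYPE('k::field) G)"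
proof -
  interpret R: cring "reduced_groth_ring TYPE('k) G" by (rule reduced_groth_cring)
  have "subring (generate_ring (reduced_groth_ring TYPE('k) G) (reduced_class G ` irr1_classes TYPE('k) G))
     (reduced_groth_ring TYPE('k) G)"
    by (rule R.generate_ring_is_subring[OF irreducible_carrier])
  then show ?thesis
    using R.subcring_iff[OF subringE(1)] R.subcringI' unfolding R1bar_def by blast
qed

lemma R1bar_generated:
  "carrier (R1bar TYPE('k::field) G)
     = generate (add_monoid (R1bar TYPE('k) G)) (reduced_class G ` irr1_classes TYPE('k) G)"
proof -
  let ?R = "reduced_groth_ring TYPE('k) G" and ?S = "reduced_class G ` irr1_classes TYPE('k) G"
  interpret R: cring ?R by (rule reduced_groth_cring)
  have sub: "subgroup (generate (add_monoid ?R) ?S) (add_monoid ?R)"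
    by (rule R.add.generate_is_subgroup) (use irreducible_carrier in simp)
  have "add_monoid (R1bar TYPE('k) G) = add_monoid ?R \<lparr>carrier := generate (add_monoid ?R) ?S\<rparr>"
    by (simp add: carrier_R1bar)
  then show ?thesis
    using R.add.generate_consistent[OF _ sub, of ?S] carrier_R1bar by (simp add: generate.incl subsetI)
qed

lemma groth_proj_inj_on: "inj_on (groth_proj G) {x. keys x \<subseteq> irr1_classes TYPE('k::field) G}"
proof (rule inj_onI)
  fix x y :: "('g, nat, 'k) glider set \<Rightarrow>\<^sub>0 int"
  let ?F = "free_groth_ring TYPE('k) G" and ?R = "reduced_groth_ring TYPE('k) G"
  assume xy: "x \<in> {x. keys x \<subseteq> irr1_classes TYPE('k) G}"
    "y \<in> {x. keys x \<subseteq> irr1_classes TYPE('k) G}" "groth_proj G x = groth_proj G y"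
  interpret R: cring ?R by (rule reduced_groth_cring)
  interpret q: group_hom "add_monoid ?F" "add_monoid ?R" "groth_proj G" by (rule groth_proj_group_hom)
  have d: "keys (x - y) \<subseteq> irr1_classes TYPE('k) G" using xy by (simp add: keys_diff_subset)
  have c: "x - y \<in> carrier ?F" "y \<in> carrier ?F"
    using d xy irr1_classes_carrier by (auto simp: free_groth_ring_def)
  have "groth_proj G x = groth_proj G (x - y) \<oplus>\<^bsub>?R\<^esub> groth_proj G y"
    using q.hom_mult[of "x - y" y] c by (simp add: free_groth_ring_def)
  then have "groth_proj G (x - y) = \<zero>\<^bsub>?R\<^esub>"
    using xy(3) c q.hom_closed[of "x - y"] q.hom_closed[of y]
      R.add.r_cancel_one[of "groth_proj G y" "groth_proj G (x - y)"] by simp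
  then show "x = y" using irreducible_independent[OF d] by simp
qed

lemma irr1_comm_monoid: "comm_monoid (irr1_monoid TYPE('k::field) G)"
proof -
  interpret R: cring "reduced_groth_ring TYPE('k) G" by (rule reduced_groth_cring)
  have c: "x \<in> carrier (reduced_groth_ring TYPE('k) G)" if "x \<in> reduced_class G ` irr1_classes TYPE('k) G" for x
    using that irreducible_carrier by blast
  show ?thesis
  proof (rule comm_monoidI, unfold irr1_monoid_simps)
    fix x y z
    assume xyz: "x \<in> reduced_class G ` irr1_classes TYPE('k) G" "y \<in> reduced_class G ` irr1_classes TYPE('k) G"
      "z \<in> reduced_class G ` irr1_classes TYPE('k) G"
    show "x \<otimes>\<^bsub>reduced_groth_ring TYPE('k) G\<^esub> y \<otimes>\<^bsub>reduced_groth_ring TYPE('k) G\<^esub> z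
      = x \<otimes>\<^bsub>reduced_groth_ring TYPE('k) G\<^esub> (y \<otimes>\<^bsub>reduced_groth_ring TYPE('k) G\<^esub> z)"
      by (rule R.m_assoc[OF c c c, OF xyz])
  qed (rule irreducible_mult_closed one_irreducible R.l_one[OF c] R.m_comm[OF c c]; assumption)+
qed

text \<open>
  The isomorphism sends a formal combination of elements of the monoid to the image of the
  corresponding combination of isomorphism classes; it is injective by linear independence.
\<close>

lemma R1bar_monoid_algebra:
  "\<exists>\<phi> \<in> ring_iso (monoid_algebra TYPE(int) (irr1_monoid TYPE('k::field) G)) (R1bar TYPE('k) G).
     \<forall>a\<in>carrier (irr1_monoid TYPE('k) G). \<phi> (single a 1) = a"
proof -
  let ?irr = "irr1_classes TYPE('k) G" and ?M = "irr1_monoid TYPE('k) G" and ?R1 = "R1bar TYPE('k) G"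
  let ?A = "monoid_algebra TYPE(int) ?M"
  let ?F = "free_groth_ring TYPE('k) G"
  define e where "e = inv_into ?irr (reduced_class G)"
  define \<phi> where "\<phi> y = groth_proj G (relabel e y)" for y
  note inj = reduced_class_inj_on[where ?'k = 'k]
  have e1: "e (reduced_class G c) = c" if "c \<in> ?irr" for c
    unfolding e_def using inv_into_f_f[OF inj that] .
  have e2: "e a \<in> ?irr" "reduced_class G (e a) = a" if "a \<in> reduced_class G ` ?irr" for a
    using that e1 by auto
  interpret M: comm_monoid ?M by (rule irr1_comm_monoid)
  have A: "cring ?A" by (rule M.monoid_algebra_cring)
  have R1: "cring ?R1" by (rule R1bar_cring)
  interpret q: group_hom "add_monoid ?F" "add_monoid (reduced_groth_ring TYPE('k) G)" "groth_proj G"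
    by (rule groth_proj_group_hom)
  have keys: "keys (relabel e y) \<subseteq> ?irr" if "y \<in> carrier ?A" for y
  proof -
    have "keys (relabel e y) \<subseteq> e ` (reduced_class G ` ?irr)"
      by (rule keys_relabel) (use that in simp)
    then show ?thesis using e2 by auto
  qed
  have keysF: "relabel e y \<in> carrier ?F" if "y \<in> carrier ?A" for y
    using keys[OF that] irr1_classes_carrier by (auto simp: free_groth_ring_def)
  have single: "\<phi> (bv a) = a" if "a \<in> carrier ?M" for a
    using e2[of a] that by (simp add: \<phi>_def reduced_class_eq)
  have image: "carrier ?R1 = groth_proj G ` {x. keys x \<subseteq> ?irr}"
    unfolding carrier_R1bar irreducible_span ..
  have closed: "\<phi> y \<in> carrier ?R1" if "y \<in> carrier ?A" for y
    unfolding \<phi>_def image using keys[OF that] by blast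
  have add: "\<phi> (x + y) = \<phi> x \<oplus>\<^bsub>?R1\<^esub> \<phi> y" if "x \<in> carrier ?A" "y \<in> carrier ?A" for x y
    using q.hom_mult[of "relabel e x" "relabel e y"] keysF[OF that(1)] keysF[OF that(2)]
    by (simp add: \<phi>_def relabel_add free_groth_ring_def)
  have hom: "\<phi> \<in> hom (add_monoid ?A) (add_monoid ?R1)"
    using closed add by (simp add: hom_def del: R1bar_simps monoid_algebra_simps(1))
  have gen: "carrier ?A = generate (add_monoid ?A) (bv ` carrier ?M)"
  proof
    interpret A: cring ?A by (rule A)
    have gens: "bv ` carrier ?M \<subseteq> carrier ?A" by auto
    show "carrier ?A \<subseteq> generate (add_monoid ?A) (bv ` carrier ?M)"
      using monoid_algebra_generated[OF A, of _ "carrier ?M"] by auto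
    show "generate (add_monoid ?A) (bv ` carrier ?M) \<subseteq> carrier ?A"
      using A.add.generate_incl[of "bv ` carrier ?M"] gens by simp
  qed
  have mult: "\<phi> (x \<otimes>\<^bsub>?A\<^esub> y) = \<phi> x \<otimes>\<^bsub>?R1\<^esub> \<phi> y" if "x \<in> carrier ?A" "y \<in> carrier ?A" for x y
  proof (rule mult_hom_from_generators[OF A R1 hom gen _ that])
    fix a b :: "_ \<Rightarrow>\<^sub>0 int" assume "a \<in> bv ` carrier ?M" "b \<in> bv ` carrier ?M"
    then obtain a' b' where ab: "a = bv a'" "b = bv b'" "a' \<in> carrier ?M" "b' \<in> carrier ?M" by blast
    then have "a' \<otimes>\<^bsub>?M\<^esub> b' \<in> carrier ?M" by blast
    from single[OF this] show "\<phi> (a \<otimes>\<^bsub>?A\<^esub> b) = \<phi> a \<otimes>\<^bsub>?R1\<^esub> \<phi> b"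
      unfolding ab ma_mult_single using single[OF ab(3)] single[OF ab(4)] by simp
  qed
  have "\<phi> \<in> ring_hom ?A ?R1"
  proof (rule ring_hom_memI)
    show "\<phi> \<one>\<^bsub>?A\<^esub> = \<one>\<^bsub>?R1\<^esub>" using single[OF M.one_closed] by simp
    show "\<phi> (x \<oplus>\<^bsub>?A\<^esub> y) = \<phi> x \<oplus>\<^bsub>?R1\<^esub> \<phi> y" if "x \<in> carrier ?A" "y \<in> carrier ?A" for x y
      using add[OF that] by simp
  qed (use closed mult in auto)
  moreover have "bij_betw \<phi> (carrier ?A) (carrier ?R1)"
  proof (rule bij_betw_imageI)
    show "inj_on \<phi> (carrier ?A)"
    proof (rule inj_onI)
      fix x y assume xy: "x \<in> carrier ?A" "y \<in> carrier ?A" "\<phi> x = \<phi> y"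
      have "relabel e x = relabel e y"
        using inj_onD[OF groth_proj_inj_on xy(3)[unfolded \<phi>_def]] keys xy by blast
      moreover have "relabel (reduced_class G) (relabel e z) = z" if "z \<in> carrier ?A" for z
        by (rule relabel_inverse) (use that e2 in auto)
      ultimately show "x = y" using xy by metis
    qed
    show "\<phi> ` carrier ?A = carrier ?R1"
    proof
      show "\<phi> ` carrier ?A \<subseteq> carrier ?R1" using closed by blast
      show "carrier ?R1 \<subseteq> \<phi> ` carrier ?A"
      proof
        fix X assume "X \<in> carrier ?R1"
        then obtain x where x: "keys x \<subseteq> ?irr" "X = groth_proj G x" unfolding image by blast
        have "relabel e (relabel (reduced_class G) x) = x"
          by (rule relabel_inverse) (use x(1) e1 in auto)
        then have "X = \<phi> (relabel (reduced_class G) x)" by (simp add: \<phi>_def x(2))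
        moreover have "relabel (reduced_class G) x \<in> carrier ?A" using keys_relabel[OF x(1)] by simp
        ultimately show "X \<in> \<phi> ` carrier ?A" by blast
      qed
    qed
  qed
  ultimately show ?thesis using single unfolding ring_iso_def by blast
qed

end

text \<open>
  Choosing preimages of the values \<open>t M\<close> lifts \<open>t\<close> to the free abelian groups. Composed with the
  projection the lift is additive and kills the relations, hence factors through the reduced ring.
\<close>

lemma descend_additive:
  fixes t :: "('g, nat, 'k::field) glider \<Rightarrow> (('g, nat, 'k) glider set \<Rightarrow>\<^sub>0 int) set set"
  assumes A: "finite_group A" and B: "finite_group B"
    and closed: "\<And>M. is_glider A M \<Longrightarrow> t M \<in> carrier (reduced_groth_ring TYPE('k) B)"
    and iso: "\<And>M N. is_glider A M \<Longrightarrow> is_glider A N \<Longrightarrow> glider_iso A M N \<Longrightarrow> t M = t N"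
    and dsum: "\<And>M N P. is_glider A M \<Longrightarrow> is_glider A N \<Longrightarrow> is_glider A P \<Longrightarrow> glider_iso A P (glider_dsum M N) \<Longrightarrow>
        t P = t M \<oplus>\<^bsub>reduced_groth_ring TYPE('k) B\<^esub> t N"
    and zero: "\<And>M. is_glider A M \<Longrightarrow> length_zero M \<Longrightarrow> t M = \<zero>\<^bsub>reduced_groth_ring TYPE('k) B\<^esub>"
  obtains \<Phi> where "\<Phi> \<in> hom (add_monoid (reduced_groth_ring TYPE('k) A)) (add_monoid (reduced_groth_ring TYPE('k) B))"
    "\<And>M. is_glider A M \<Longrightarrow> \<Phi> (rcl A M) = t M"
proof -
  interpret A: finite_group A by fact
  interpret B: finite_group B by fact
  let ?FA = "free_groth_ring TYPE('k) A" and ?FB = "free_groth_ring TYPE('k) B"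
  let ?RA = "reduced_groth_ring TYPE('k) A" and ?RB = "reduced_groth_ring TYPE('k) B"
  let ?CA = "carrier (iso_class_monoid TYPE('k) A)" and ?CB = "carrier (iso_class_monoid TYPE('k) B)"
  interpret FA: cring ?FA by (rule A.free_groth_cring)
  interpret RA: cring ?RA by (rule A.reduced_groth_cring)
  interpret RB: cring ?RB by (rule B.reduced_groth_cring)
  interpret qA: group_hom "add_monoid ?FA" "add_monoid ?RA" "groth_proj A" by (rule A.groth_proj_group_hom)
  interpret qB: group_hom "add_monoid ?FB" "add_monoid ?RB" "groth_proj B" by (rule B.groth_proj_group_hom)
  define t' where "t' c = t (SOME M. M \<in> c)" for c
  have t': "t' (iso_class A M) = t M" if M: "is_glider A M" for M
  proof -
    have "M \<in> iso_class A M" using M glider_iso_refl by (simp add: iso_class_def)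
    then have "(SOME N. N \<in> iso_class A M) \<in> iso_class A M" by (rule someI)
    then show ?thesis unfolding t'_def iso_class_def using iso M by blast
  qed
  have "\<exists>y. y \<in> carrier ?FB \<and> groth_proj B y = t' c" if c: "c \<in> ?CA" for c
  proof -
    obtain M :: "('g, nat, 'k) glider" where M: "is_glider A M" "c = iso_class A M"
      by (rule A.iso_class_carrierE[OF c])
    then have "t' c \<in> groth_proj B ` carrier ?FB" using closed t' B.groth_proj_image by metis
    then show ?thesis by (auto simp del: monoid_algebra_simps)
  qed
  then obtain s where s: "\<And>c. c \<in> ?CA \<Longrightarrow> s c \<in> carrier ?FB" "\<And>c. c \<in> ?CA \<Longrightarrow> groth_proj B (s c) = t' c"
    by metis
  define \<psi> where "\<psi> = basis_extend s"
  have keys_pscale: "keys (pscale k v) \<subseteq> keys v" for k :: int and v :: "_ \<Rightarrow>\<^sub>0 int"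
    by (auto simp: in_keys_iff lookup_pscale)
  have \<psi>c: "\<psi> x \<in> carrier ?FB" if "x \<in> carrier ?FA" for x
  proof -
    have "keys x \<subseteq> ?CA" using that by (simp add: free_groth_ring_def)
    then have "keys (\<psi> x) \<subseteq> ?CB"
    proof (induction rule: supported_induct)
      case (add a k f)
      have "keys (pscale k (s a)) \<subseteq> ?CB"
        using keys_pscale[of k "s a"] s(1)[OF add(1)] by (auto simp: free_groth_ring_def)
      with add show ?case by (simp add: \<psi>_def basis_extend_add keys_add_subset)
    qed (simp add: \<psi>_def)
    then show ?thesis by (simp add: free_groth_ring_def)
  qed
  have \<psi>a: "\<psi> (x + y) = \<psi> x + \<psi> y" for x y by (simp add: \<psi>_def basis_extend_add)
  define T where "T x = groth_proj B (\<psi> x)" for x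
  have Tc: "T x \<in> carrier ?RB" if "x \<in> carrier ?FA" for x
    unfolding T_def using qB.hom_closed \<psi>c[OF that] by simp
  have Ta: "T (x + y) = T x \<oplus>\<^bsub>?RB\<^esub> T y" if "x \<in> carrier ?FA" "y \<in> carrier ?FA" for x y
    unfolding T_def \<psi>a using qB.hom_mult[of "\<psi> x" "\<psi> y"] \<psi>c that by (simp add: free_groth_ring_def)
  have T_bv: "T (bv (iso_class A M)) = t M" if M: "is_glider A M" for M
    using s(2)[OF A.iso_class_in_carrier[OF M]] t'[OF M] by (simp add: T_def \<psi>_def)
  have hom: "T \<in> hom (add_monoid ?FA) (add_monoid ?RB)"
    using Tc Ta by (intro homI) (simp_all add: free_groth_ring_def)
  interpret T: group_hom "add_monoid ?FA" "add_monoid ?RB" T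
    using hom FA.a_group RB.a_group by (simp add: group_hom_def group_hom_axioms_def)
  have gens: "T z = \<zero>\<^bsub>?RB\<^esub>" if z: "z \<in> split_gens A" for z
  proof -
    obtain M N :: "('g, nat, 'k) glider" where MN: "is_glider A M" "is_glider A N"
      and zz: "z = bv (iso_class A (glider_dsum M N)) - bv (iso_class A M) - bv (iso_class A N)"
      using z unfolding split_gens_def by auto
    obtain P :: "('g, nat, 'k) glider" where P: "is_glider A P" "glider_iso A P (glider_dsum M N)"
      using A.nat_representative[OF A.is_glider_dsum[OF MN]] .
    have eq: "iso_class A (glider_dsum M N) = iso_class A P"
      using P MN by (simp add: A.iso_class_eq_iff A.is_glider_dsum glider_iso_sym)
    note bM = A.bv_in_free_groth[OF MN(1)] and bN = A.bv_in_free_groth[OF MN(2)]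
    have d: "bv (iso_class A M) + bv (iso_class A N) \<in> carrier ?FA"
      using FA.a_closed[OF bM bN] by (simp add: free_groth_ring_def)
    have zc: "z \<in> carrier ?FA" using z A.split_gens_carrier by blast
    have "T (z + (bv (iso_class A M) + bv (iso_class A N))) = T (bv (iso_class A M) + bv (iso_class A N))"
      using dsum[OF MN P] unfolding Ta[OF bM bN] T_bv[OF MN(1)] T_bv[OF MN(2)] by (simp add: zz eq T_bv[OF P(1)])
    then show ?thesis
      using Ta[OF zc d] RB.add.r_cancel_one[OF _ Tc[OF zc], of "T (bv (iso_class A M) + bv (iso_class A N))"] Tc[OF d]
      by simp
  qed
  have lz: "T z = \<zero>\<^bsub>?RB\<^esub>" if "z \<in> length_zero_gens A" for z
    using that unfolding length_zero_gens_def by (auto simp only: T_bv zero)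
  have well: "T x = T y" if xy: "x \<in> carrier ?FA" "y \<in> carrier ?FA" "groth_proj A x = groth_proj A y" for x y
    by (rule A.groth_proj_factor[OF RB.a_group hom _ _ xy]) (simp_all add: gens lz)
  define rep where "rep X = (SOME x. x \<in> carrier ?FA \<and> groth_proj A x = X)" for X
  have rep: "rep X \<in> carrier ?FA" "groth_proj A (rep X) = X" if X: "X \<in> carrier ?RA" for X
  proof -
    have "X \<in> groth_proj A ` carrier ?FA" using X by (simp only: A.groth_proj_image)
    then have "\<exists>x. x \<in> carrier ?FA \<and> groth_proj A x = X" by (rule imageE) (rule exI, rule conjI, assumption, rule sym, assumption)
    then have "rep X \<in> carrier ?FA \<and> groth_proj A (rep X) = X" unfolding rep_def by (rule someI_ex)
    then show "rep X \<in> carrier ?FA" "groth_proj A (rep X) = X" by (rule conjunct1, rule conjunct2)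
  qed
  define \<Phi> where "\<Phi> X = T (rep X)" for X
  have \<Phi>: "\<Phi> (groth_proj A x) = T x" if x: "x \<in> carrier ?FA" for x
  proof -
    have "groth_proj A x \<in> carrier ?RA" using imageI[OF x, of "groth_proj A"] by (simp only: A.groth_proj_image)
    then show ?thesis unfolding \<Phi>_def using rep x by (intro well) auto
  qed
  show ?thesis
  proof (rule that[of \<Phi>])
    show "\<Phi> \<in> hom (add_monoid ?RA) (add_monoid ?RB)"
    proof (rule homI)
      show "\<Phi> X \<in> carrier (add_monoid ?RB)" if "X \<in> carrier (add_monoid ?RA)" for X
        using that rep Tc by (simp add: \<Phi>_def)
      show "\<Phi> (X \<otimes>\<^bsub>add_monoid ?RA\<^esub> Y) = \<Phi> X \<otimes>\<^bsub>add_monoid ?RB\<^esub> \<Phi> Y"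
        if "X \<in> carrier (add_monoid ?RA)" "Y \<in> carrier (add_monoid ?RA)" for X Y
      proof -
        have XY: "rep X \<in> carrier ?FA" "rep Y \<in> carrier ?FA" "groth_proj A (rep X) = X" "groth_proj A (rep Y) = Y"
          using that rep by simp_all
        have sum: "rep X + rep Y \<in> carrier ?FA"
          using FA.a_closed[OF XY(1,2)] by (simp add: free_groth_ring_def)
        have "X \<oplus>\<^bsub>?RA\<^esub> Y = groth_proj A (rep X + rep Y)"
          using qA.hom_mult[of "rep X" "rep Y"] XY by (simp add: free_groth_ring_def)
        then show ?thesis using \<Phi>[OF sum] Ta[OF XY(1,2)] by (simp add: \<Phi>_def)
      qed
    qed
    show "\<Phi> (rcl A M) = t M" if "is_glider A M" for M
      unfolding reduced_class_eq using \<Phi>[OF A.bv_in_free_groth[OF that]] T_bv[OF that] by simp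
  qed
qed

section \<open>Induced gliders\<close>

text \<open>
  What has to be known about \<open>N = K[G] \<otimes>\<^bsub>K[H]\<^esub> M\<close>: the map \<open>\<iota> m = 1 \<otimes> m\<close>, and for every \<open>t\<close> the projection
  \<open>E t\<close> to the summand \<open>t \<otimes> M\<close>, identified with \<open>M\<close>. The conditions concern only the submodule that the
  lower level generates. Hence they also hold when \<open>N\<close> is the tensor product of two induced gliders, which
  is in general larger than the glider induced from the tensor product.
\<close>

definition induced_by ::
  "('g, 'x) monoid_scheme \<Rightarrow> 'g set \<Rightarrow> ('g, 'a, 'k::field) glider \<Rightarrow> ('g, 'b, 'k) glider \<Rightarrow>
   (('a \<Rightarrow>\<^sub>0 'k) \<Rightarrow> ('b \<Rightarrow>\<^sub>0 'k)) \<Rightarrow> ('g \<Rightarrow> ('b \<Rightarrow>\<^sub>0 'k) \<Rightarrow> ('a \<Rightarrow>\<^sub>0 'k)) \<Rightarrow> bool" where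
  "induced_by G H M N \<iota> E \<longleftrightarrow> lin \<iota> \<and> (\<forall>t. lin (E t)) \<and> lev1 N = \<iota> ` lev1 M \<and>
     (\<forall>g\<in>carrier G. \<forall>h\<in>H. \<forall>m\<in>lev1 M. act N g (\<iota> (act M h m)) = act N (g \<otimes>\<^bsub>G\<^esub> h) (\<iota> m)) \<and>
     (\<forall>t\<in>carrier G. \<forall>g\<in>carrier G. \<forall>m\<in>lev1 M. E t (act N g (\<iota> m)) =
        (if inv\<^bsub>G\<^esub> t \<otimes>\<^bsub>G\<^esub> g \<in> H then act M (inv\<^bsub>G\<^esub> t \<otimes>\<^bsub>G\<^esub> g) m else 0))"

lemma induced_byD:
  assumes "induced_by G H M N \<iota> E"
  shows "lin \<iota>" "\<And>t. lin (E t)" "lev1 N = \<iota> ` lev1 M"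
    "\<And>g h m. g \<in> carrier G \<Longrightarrow> h \<in> H \<Longrightarrow> m \<in> lev1 M \<Longrightarrow> act N g (\<iota> (act M h m)) = act N (g \<otimes>\<^bsub>G\<^esub> h) (\<iota> m)"
    "\<And>t g m. t \<in> carrier G \<Longrightarrow> g \<in> carrier G \<Longrightarrow> m \<in> lev1 M \<Longrightarrow> E t (act N g (\<iota> m)) =
        (if inv\<^bsub>G\<^esub> t \<otimes>\<^bsub>G\<^esub> g \<in> H then act M (inv\<^bsub>G\<^esub> t \<otimes>\<^bsub>G\<^esub> g) m else 0)"
  using assms unfolding induced_by_def by blast+

lemma sum_const_pscale:
  "finite A \<Longrightarrow> (\<Sum>_\<in>A. v) = pscale (of_nat (card A) :: 'k::field) v"
  by (induction A rule: finite_induct) (simp_all add: pscale_add_left)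

locale finite_subgroup = finite_group G for G :: "('g, 'x) monoid_scheme" (structure) +
  fixes H :: "'g set"
  assumes sub: "subgroup H G"
begin

abbreviation GH :: "('g, 'x) monoid_scheme" where "GH \<equiv> G\<lparr>carrier := H\<rparr>"

lemma HG: "h \<in> H \<Longrightarrow> h \<in> carrier G"
  using subgroup.subset[OF sub] by blast

lemma finite_H: "finite H"
  using fin subgroup.subset[OF sub] finite_subset by blast

lemma finite_group_H: "finite_group GH"
  using subgroup.subgroup_is_group[OF sub is_group] finite_H
  by (simp add: finite_group_def finite_group_axioms_def)

sublocale H: finite_group GH by (rule finite_group_H)

lemma card_H: "of_nat (card H) \<noteq> (0 :: 'k::field_char_0)"
  using finite_H subgroup.one_closed[OF sub] by auto

text \<open>
  One direction applies the projections \<open>E t\<close>. The other writes the sum over \<open>G\<close> as an average, over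
  all \<open>t\<close>, of sums over the cosets \<open>t H\<close>; this divides by the order of \<open>H\<close>, which is
  invertible in characteristic zero.
\<close>

lemma induced_relations:
  fixes M :: "('g, 'a, 'k::field_char_0) glider"
  assumes ind: "induced_by G H M N \<iota> E" and M: "is_glider GH M" and N: "is_glider G N"
    and m: "\<And>g. g \<in> carrier G \<Longrightarrow> m g \<in> lev1 M"
  shows "(\<Sum>g\<in>carrier G. act N g (\<iota> (m g))) = 0 \<longleftrightarrow> (\<forall>t\<in>carrier G. (\<Sum>h\<in>H. act M h (m (t \<otimes> h))) = 0)"
proof
  note I = induced_byD[OF ind]
  assume zero: "(\<Sum>g\<in>carrier G. act N g (\<iota> (m g))) = 0"
  show "\<forall>t\<in>carrier G. (\<Sum>h\<in>H. act M h (m (t \<otimes> h))) = 0"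
  proof
    fix t assume t: "t \<in> carrier G"
    have "0 = E t (\<Sum>g\<in>carrier G. act N g (\<iota> (m g)))" using zero lin_zero[OF I(2)] by simp
    also have "\<dots> = (\<Sum>g\<in>carrier G. if inv t \<otimes> g \<in> H then act M (inv t \<otimes> g) (m g) else 0)"
      by (simp add: lin_sum[OF I(2)] I(5) t m)
    also have "\<dots> = (\<Sum>g\<in>{g \<in> carrier G. inv t \<otimes> g \<in> H}. act M (inv t \<otimes> g) (m g))"
      using fin by (simp add: sum.inter_filter)
    also have "\<dots> = (\<Sum>h\<in>H. act M h (m (t \<otimes> h)))"
      by (rule sum.reindex_bij_witness[where i = "\<lambda>h. t \<otimes> h" and j = "\<lambda>g. inv t \<otimes> g"])
        (use t HG in \<open>auto simp: m_assoc[symmetric]\<close>)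
    finally show "(\<Sum>h\<in>H. act M h (m (t \<otimes> h))) = 0" by simp
  qed
next
  note I = induced_byD[OF ind] and D = gliderD[OF N]
  assume zero: "\<forall>t\<in>carrier G. (\<Sum>h\<in>H. act M h (m (t \<otimes> h))) = 0"
  let ?s = "\<lambda>g. act N g (\<iota> (m g))"
  \<comment> \<open>Every element of \<open>G\<close> is \<open>t \<otimes> h\<close> for exactly \<open>card H\<close> pairs.\<close>
  have "pscale (of_nat (card H)) (\<Sum>g\<in>carrier G. ?s g) = (\<Sum>h\<in>H. \<Sum>g\<in>carrier G. ?s g)"
    using finite_H by (simp add: sum_const_pscale)
  also have "\<dots> = (\<Sum>h\<in>H. \<Sum>t\<in>carrier G. ?s (t \<otimes> h))"
  proof (rule sum.cong[OF refl])
    fix h assume h: "h \<in> H"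
    show "(\<Sum>g\<in>carrier G. ?s g) = (\<Sum>t\<in>carrier G. ?s (t \<otimes> h))"
      by (rule sum.reindex_bij_witness[where i = "\<lambda>t. t \<otimes> h" and j = "\<lambda>g. g \<otimes> inv h"])
        (use HG[OF h] in \<open>auto simp: m_assoc\<close>)
  qed
  also have "\<dots> = (\<Sum>t\<in>carrier G. \<Sum>h\<in>H. ?s (t \<otimes> h))" by (rule sum.swap)
  also have "\<dots> = (\<Sum>t\<in>carrier G. act N t (\<iota> (\<Sum>h\<in>H. act M h (m (t \<otimes> h)))))"
  proof (rule sum.cong[OF refl])
    fix t assume t: "t \<in> carrier G"
    show "(\<Sum>h\<in>H. ?s (t \<otimes> h)) = act N t (\<iota> (\<Sum>h\<in>H. act M h (m (t \<otimes> h))))"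
      by (simp add: lin_sum[OF I(1)] lin_sum[OF D(6)[OF t]] I(4)[OF t] m t HG)
  qed
  also have "\<dots> = 0"
    using zero by (simp add: lin_zero[OF I(1)] lin_zero[OF D(6)])
  finally show "(\<Sum>g\<in>carrier G. ?s g) = 0" using card_H by simp
qed

lemma induced_retract:
  assumes ind: "induced_by G H M N \<iota> E" and M: "is_glider GH M" and N: "is_glider G N" and m: "m \<in> lev1 M"
  shows "E \<one> (\<iota> m) = m"
proof -
  note I = induced_byD[OF ind]
  have "\<iota> m \<in> lev1 N" using I(3) m by blast
  then have "\<iota> m = act N \<one> (\<iota> m)" using gliderD(8,12)[OF N] by simp
  then have "E \<one> (\<iota> m) = E \<one> (act N \<one> (\<iota> m))" by simp
  also have "\<dots> = act M \<one> m" using I(5)[of \<one> \<one> m] m subgroup.one_closed[OF sub] by simp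
  also have "\<dots> = m" using gliderD(8,12)[OF M] m by simp
  finally show ?thesis .
qed

text \<open>
  By the previous lemmas the relations upstairs are expressed by those over \<open>H\<close>. The map is \<open>f\<close>
  transported along \<open>\<iota>\<close>, which \<open>E \<one>\<close> inverts.
\<close>

lemma induced_same_relations:
  fixes M :: "('g, 'a, 'k::field_char_0) glider" and M' :: "('g, 'b, 'k) glider"
    and N :: "('g, 'c, 'k) glider" and N' :: "('g, 'd, 'k) glider"
  assumes ind: "induced_by G H M N \<iota> E" and M: "is_glider GH M" and N: "is_glider G N"
    and ind': "induced_by G H M' N' \<iota>' E'" and M': "is_glider GH M'" and N': "is_glider G N'"
    and f: "same_relations GH M M' f"
  obtains k where "same_relations G N N' k"
proof -
  note I = induced_byD[OF ind] and I' = induced_byD[OF ind'] and R = H.same_relationsD[OF f, simplified]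
  define k where "k = (\<lambda>u. \<iota>' (f (E \<one> u)))"
  have k: "k (\<iota> m) = \<iota>' (f m)" if "m \<in> lev1 M" for m
    by (simp add: k_def induced_retract[OF ind M N that])
  have lk: "lin k" unfolding k_def by (rule lin_comp[OF I'(1) lin_comp[OF R(1) I(2)]])
  have "k ` lev1 N = lev1 N'"
    unfolding I(3) I'(3) R(2)[symmetric] image_image using k by simp
  moreover have "inj_on k (lev1 N)"
  proof (rule inj_onI)
    fix x y assume xy: "x \<in> lev1 N" "y \<in> lev1 N" "k x = k y"
    then obtain a b where ab: "x = \<iota> a" "y = \<iota> b" "a \<in> lev1 M" "b \<in> lev1 M" unfolding I(3) by blast
    then have "\<iota>' (f a) = \<iota>' (f b)" using xy(3) k by simp
    then have "E' \<one> (\<iota>' (f a)) = E' \<one> (\<iota>' (f b))" by simp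
    then have "f a = f b"
      unfolding induced_retract[OF ind' M' N' R(4)[OF ab(3)]] induced_retract[OF ind' M' N' R(4)[OF ab(4)]] .
    then show "x = y" using inj_onD[OF R(3) _ ab(3,4)] ab(1,2) by simp
  qed
  moreover have "(\<Sum>g\<in>carrier G. act N g (n g)) = 0 \<longleftrightarrow> (\<Sum>g\<in>carrier G. act N' g (k (n g))) = 0"
    if n: "\<forall>g\<in>carrier G. n g \<in> lev1 N" for n
  proof -
    define m where "m g = E \<one> (n g)" for g
    have m: "m g \<in> lev1 M" "n g = \<iota> (m g)" if g: "g \<in> carrier G" for g
    proof -
      have "n g \<in> \<iota> ` lev1 M" using n g unfolding I(3) by (rule bspec)
      then obtain a where "n g = \<iota> a" "a \<in> lev1 M" by (rule imageE)
      then show "m g \<in> lev1 M" "n g = \<iota> (m g)" by (simp_all add: m_def induced_retract[OF ind M N])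
    qed
    have "(\<Sum>g\<in>carrier G. act N g (n g)) = 0 \<longleftrightarrow> (\<Sum>g\<in>carrier G. act N g (\<iota> (m g))) = 0"
      using m by simp
    also have "\<dots> \<longleftrightarrow> (\<forall>t\<in>carrier G. (\<Sum>h\<in>H. act M h (m (t \<otimes> h))) = 0)"
      by (rule induced_relations[OF ind M N m(1)])
    also have "\<dots> \<longleftrightarrow> (\<forall>t\<in>carrier G. (\<Sum>h\<in>H. act M' h (f (m (t \<otimes> h)))) = 0)"
      using R(5)[of "\<lambda>h. m (_ \<otimes> h)"] m(1) HG by simp
    also have "\<dots> \<longleftrightarrow> (\<Sum>g\<in>carrier G. act N' g (\<iota>' (f (m g)))) = 0"
      by (rule induced_relations[OF ind' M' N', symmetric]) (use m(1) R(4) in simp)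
    also have "\<dots> \<longleftrightarrow> (\<Sum>g\<in>carrier G. act N' g (k (n g))) = 0"
      using m k by simp
    finally show ?thesis .
  qed
  ultimately show ?thesis using that[of k] lk unfolding same_relations_def by blast
qed

text \<open>
  A pure tensor \<open>g (\<iota> v) \<otimes> g (\<iota>' w)\<close> lies in the product of the summands that belong to the same coset
  \<open>g H\<close>, which is what the tensor products of the projections detect.
\<close>

lemma induced_tensor:
  assumes ind: "induced_by G H M N \<iota> E" and M: "is_glider GH M" and N: "is_glider G N"
    and ind': "induced_by G H M' N' \<iota>' E'" and M': "is_glider GH M'" and N': "is_glider G N'"
  shows "induced_by G H (glider_tensor M M') (glider_tensor N N') (tensor_map \<iota> \<iota>') (\<lambda>t. tensor_map (E t) (E' t))"
proof -
  note I = induced_byD[OF ind] and I' = induced_byD[OF ind'] 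
  note D = gliderD(6)[OF M, simplified] gliderD(6)[OF M', simplified] gliderD(6)[OF N] gliderD(6)[OF N']
  have pure: "tensor_map \<iota> \<iota>' (pure_tensor v w) = pure_tensor (\<iota> v) (\<iota>' w)" for v w
    by (rule tensor_map_pure[OF I(1) I'(1)])
  show ?thesis
    unfolding induced_by_def glider_tensor_simps
  proof (intro conjI allI ballI)
    show "tensor_space (lev1 N) (lev1 N') = tensor_map \<iota> \<iota>' ` tensor_space (lev1 M) (lev1 M')"
    proof -
      have "{pure_tensor v w |v w. v \<in> lev1 N \<and> w \<in> lev1 N'}
        = tensor_map \<iota> \<iota>' ` {pure_tensor v w |v w. v \<in> lev1 M \<and> w \<in> lev1 M'}"
        unfolding I(3) I'(3) by (auto simp: pure image_iff) (metis pure)+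
      then show ?thesis unfolding tensor_space_def by (simp add: pmp.linear_span_image[OF lin_tensor_map])
    qed
    show "tensor_map (act N g) (act N' g) (tensor_map \<iota> \<iota>' (tensor_map (act M h) (act M' h) m))
       = tensor_map (act N (g \<otimes> h)) (act N' (g \<otimes> h)) (tensor_map \<iota> \<iota>' m)"
      if g: "g \<in> carrier G" and h: "h \<in> H" and m: "m \<in> tensor_space (lev1 M) (lev1 M')" for g h m
      by (rule lin_eq_on_tensor[OF lin_comp[OF lin_tensor_map lin_comp[OF lin_tensor_map lin_tensor_map]]
            lin_comp[OF lin_tensor_map lin_tensor_map] _ m])
        (simp add: pure tensor_map_pure D g h HG I(4) I'(4))
    show "tensor_map (E t) (E' t) (tensor_map (act N g) (act N' g) (tensor_map \<iota> \<iota>' m))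
       = (if inv t \<otimes> g \<in> H then tensor_map (act M (inv t \<otimes> g)) (act M' (inv t \<otimes> g)) m else 0)"
      if t: "t \<in> carrier G" and g: "g \<in> carrier G" and m: "m \<in> tensor_space (lev1 M) (lev1 M')" for t g m
    proof -
      have 1: "tensor_map (E t) (E' t) (tensor_map (act N g) (act N' g) (tensor_map \<iota> \<iota>' (pure_tensor v w)))
        = pure_tensor (E t (act N g (\<iota> v))) (E' t (act N' g (\<iota>' w)))" for v w
        by (simp add: pure tensor_map_pure D g I(2) I'(2))
      show ?thesis
      proof (cases "inv t \<otimes> g \<in> H")
        case True
        have "tensor_map (E t) (E' t) (tensor_map (act N g) (act N' g) (tensor_map \<iota> \<iota>' m))
          = tensor_map (act M (inv t \<otimes> g)) (act M' (inv t \<otimes> g)) m"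
          by (rule lin_eq_on_tensor[OF lin_comp[OF lin_tensor_map lin_comp[OF lin_tensor_map lin_tensor_map]]
                lin_tensor_map _ m])
            (simp add: 1 tensor_map_pure D True I(5)[OF t g] I'(5)[OF t g])
        then show ?thesis using True by simp
      next
        case False
        have "tensor_map (E t) (E' t) (tensor_map (act N g) (act N' g) (tensor_map \<iota> \<iota>' m)) = (\<lambda>_. 0) m"
          by (rule lin_eq_on_tensor[OF lin_comp[OF lin_tensor_map lin_comp[OF lin_tensor_map lin_tensor_map]]
                _ _ m])
            (simp_all add: 1 False I(5)[OF t g] I'(5)[OF t g] pure_tensor_eq_0_iff linI)
        then show ?thesis using False by simp
      qed
    qed
  qed (simp_all add: lin_tensor_map)
qed

lemma induced_dsum:
  assumes ind: "induced_by G H M N \<iota> E" and M: "is_glider GH M" and N: "is_glider G N"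
    and ind': "induced_by G H M' N' \<iota>' E'" and M': "is_glider GH M'" and N': "is_glider G N'"
  shows "induced_by G H (glider_dsum M M') (glider_dsum N N')
    (dsum_case (\<lambda>v. pm_inl (\<iota> v)) (\<lambda>v. pm_inr (\<iota>' v)))
    (\<lambda>t. dsum_case (\<lambda>v. pm_inl (E t v)) (\<lambda>v. pm_inr (E' t v)))"
proof -
  note I = induced_byD[OF ind] and I' = induced_byD[OF ind'] 
  note D = gliderD(6)[OF M, simplified] gliderD(6)[OF M', simplified] gliderD(6)[OF N] gliderD(6)[OF N']
  note ev = dsum_case_sum lin_comp[OF lin_pm_inl] lin_comp[OF lin_pm_inr]
  show ?thesis
    unfolding induced_by_def glider_dsum_simps
  proof (intro conjI allI ballI)
    show "dsum_space (lev1 N) (lev1 N')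
      = dsum_case (\<lambda>v. pm_inl (\<iota> v)) (\<lambda>v. pm_inr (\<iota>' v)) ` dsum_space (lev1 M) (lev1 M')"
      unfolding dsum_space_eq_image I(3) I'(3) image_image
      by (force simp: ev I(1) I'(1))
    show "dsum_case (\<lambda>v. pm_inl (act N g v)) (\<lambda>v. pm_inr (act N' g v)) (dsum_case (\<lambda>v. pm_inl (\<iota> v)) (\<lambda>v. pm_inr (\<iota>' v))
          (dsum_case (\<lambda>v. pm_inl (act M h v)) (\<lambda>v. pm_inr (act M' h v)) m))
       = dsum_case (\<lambda>v. pm_inl (act N (g \<otimes> h) v)) (\<lambda>v. pm_inr (act N' (g \<otimes> h) v))
          (dsum_case (\<lambda>v. pm_inl (\<iota> v)) (\<lambda>v. pm_inr (\<iota>' v)) m)"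
      if g: "g \<in> carrier G" and h: "h \<in> H" and m: "m \<in> dsum_space (lev1 M) (lev1 M')" for g h m
      by (rule dsum_spaceE[OF m]) (simp add: ev I(1,4) I'(1,4) D g h HG)
    show "dsum_case (\<lambda>v. pm_inl (E t v)) (\<lambda>v. pm_inr (E' t v)) (dsum_case (\<lambda>v. pm_inl (act N g v)) (\<lambda>v. pm_inr (act N' g v))
          (dsum_case (\<lambda>v. pm_inl (\<iota> v)) (\<lambda>v. pm_inr (\<iota>' v)) m))
       = (if inv t \<otimes> g \<in> H then dsum_case (\<lambda>v. pm_inl (act M (inv t \<otimes> g) v)) (\<lambda>v. pm_inr (act M' (inv t \<otimes> g) v)) m
          else 0)"
      if t: "t \<in> carrier G" and g: "g \<in> carrier G" and m: "m \<in> dsum_space (lev1 M) (lev1 M')" for t g m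
      by (rule dsum_spaceE[OF m])
        (simp add: ev I(1,2,5) I'(1,2,5) D t g lin_zero[OF lin_pm_inl] lin_zero[OF lin_pm_inr])
  qed (simp_all add: lin_dsum_case I'(2) I(2))
qed

lemma induced_line:
  assumes ind: "induced_by G H M N \<iota> E" and M: "is_glider GH M" and N: "is_glider G N"
    and v: "v \<noteq> 0" "lev1 M = pm.span {v}"
  shows "\<iota> v \<noteq> 0" "lev1 N = pm.span {\<iota> v}"
proof -
  note I = induced_byD[OF ind]
  have "v \<in> lev1 M" using v(2) pm.span_base by blast
  then show "\<iota> v \<noteq> 0" using induced_retract[OF ind M N] v(1) lin_zero[OF I(2)] by metis
  show "lev1 N = pm.span {\<iota> v}" unfolding I(3) v(2) using pmp.linear_span_image[OF I(1), of "{v}"] by simp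
qed

text \<open>
  A combination of the vectors \<open>h (\<iota> v) = \<iota> (h v)\<close> is \<open>\<iota>\<close> of the combination over \<open>H\<close>, and \<open>E \<one>\<close> recovers
  the latter.
\<close>

lemma induced_ann:
  assumes ind: "induced_by G H M N \<iota> E" and M: "is_glider GH M" and N: "is_glider G N" and v: "v \<in> lev1 M"
  shows "x \<in> ann GH M v \<longleftrightarrow> (\<lambda>g. if g \<in> H then x g else 0) \<in> ann G N (\<iota> v)"
proof -
  note I = induced_byD[OF ind] and D = gliderD[OF M, simplified] and F = gliderD[OF N]
  let ?S = "\<Sum>g\<in>carrier G. pscale (if g \<in> H then x g else 0) (act N g (\<iota> v))"
  let ?T = "\<Sum>h\<in>H. pscale (x h) (act M h v)"
  have S: "?S = (\<Sum>h\<in>H. pscale (x h) (act N h (\<iota> v)))"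
    by (rule sum.mono_neutral_cong_right) (use fin HG in auto)
  have eqS: "?S = act N \<one> (\<iota> ?T)"
    unfolding S by (simp add: lin_sum[OF I(1)] lin_scale[OF I(1)] lin_sum[OF F(6)] lin_scale[OF F(6)] I(4) v HG)
  have eqT: "E \<one> ?S = ?T"
    unfolding S by (simp add: lin_sum[OF I(2)] lin_scale[OF I(2)] I(5) v HG)
  have "?S = 0" if "?T = 0"
    unfolding eqS that by (simp add: lin_zero[OF I(1)] lin_zero[OF F(6)])
  moreover have "?T = 0" if "?S = 0"
    unfolding eqT[symmetric] that by (rule lin_zero[OF I(2)])
  ultimately have "?S = 0 \<longleftrightarrow> ?T = 0" by blast
  then show ?thesis by (simp add: ann_def)
qed

section \<open>The tensor product with the group algebra\<close>

lemma lin_left_mult: "lin (left_mult G g)"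
  unfolding left_mult_def by (rule lin_basis_extend)

lemma left_mult_pure: "left_mult G g (pure_tensor (bv a) w) = pure_tensor (bv (g \<otimes> a)) w"
  by (rule lin_eqI[OF lin_comp[OF lin_left_mult lin_pure_tensor_right] lin_pure_tensor_right])
    (simp add: pure_tensor_bv left_mult_def)

text \<open>
  The balancing relations are bilinear in \<open>x\<close> and \<open>y\<close>, so group elements suffice.
\<close>

lemma balancing_space_eq:
  fixes M :: "('g, 'b, 'k::field) glider"
  assumes M: "is_glider GH M"
  shows "balancing_space G H M = pm.span {pure_tensor (bv (a \<otimes> h)) m - pure_tensor (bv a) (act M h m)
     | a h m. a \<in> carrier G \<and> h \<in> H \<and> m \<in> lev0 M}" (is "_ = pm.span ?B")
proof
  define b where "b x y m = pure_tensor (ma_mult G x y) m - pure_tensor x (kg_act (act M) y m)"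
    for x y :: "'g \<Rightarrow>\<^sub>0 'k" and m :: "'b \<Rightarrow>\<^sub>0 'k"
  have mono: "b (single a c) (single h d) m
     = pscale (c * d) (pure_tensor (bv (a \<otimes> h)) m - pure_tensor (bv a) (act M h m))" for a c h d m
  proof -
    have left: "pure_tensor (single u r) w = pscale r (pure_tensor (bv u) w)" for u r and w :: "'b \<Rightarrow>\<^sub>0 'k"
      using lin_scale[OF lin_pure_tensor_left, of r "bv u" w] by (simp add: pscale_single)
    show ?thesis
      by (simp add: b_def kg_act_def left[of "a \<otimes> h" "c * d"] left[of a c] lin_scale[OF lin_pure_tensor_right]
          pscale_pscale pm.scale_right_diff_distrib)
  qed
  have add1: "b (x + x') y m = b x y m + b x' y m" for x x' y m
    by (simp add: b_def ma_mult_add_left lin_add[OF lin_pure_tensor_left])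
  have add2: "b x (y + y') m = b x y m + b x y' m" for x y y' m
    by (simp add: b_def ma_mult_add_right lin_add[OF lin_pure_tensor_left] lin_add[OF lin_pure_tensor_right]
        kg_act_def basis_extend_add)
  have b0: "b 0 y m = 0" "b x 0 m = 0" for x y m
    by (simp_all add: b_def kg_act_def lin_zero[OF lin_pure_tensor_left] lin_zero[OF lin_pure_tensor_right])
  have in_span: "b x y m \<in> pm.span ?B"
    if x: "keys x \<subseteq> carrier G" and y: "keys y \<subseteq> H" and m: "m \<in> lev0 M" for x y m
    using x
  proof (induction rule: supported_induct)
    case (add a c f)
    have "b (single a c) y m \<in> pm.span ?B"
      using y
    proof (induction rule: supported_induct)
      case (add h d y')
      have "b (single a c) (single h d) m \<in> pm.span ?B"
        unfolding mono using add(1) \<open>a \<in> carrier G\<close> m by (intro pm.span_scale pm.span_base) blast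
      with add show ?case by (simp add: add2 pm.span_add)
    qed (simp add: b0 pm.span_zero)
    with add show ?case by (simp add: add1 pm.span_add)
  qed (simp add: b0 pm.span_zero)
  show "balancing_space G H M \<subseteq> pm.span ?B"
    unfolding balancing_space_def
    by (rule pm.span_minimal[OF _ pm.subspace_span]) (use in_span in \<open>auto simp: b_def\<close>)
  show "pm.span ?B \<subseteq> balancing_space G H M"
    unfolding balancing_space_def
  proof (rule pm.span_mono, rule subsetI)
    fix z assume "z \<in> ?B"
    then obtain a h m where z: "z = pure_tensor (bv (a \<otimes> h)) m - pure_tensor (bv a) (act M h m)"
      "a \<in> carrier G" "h \<in> H" "m \<in> lev0 M" by blast
    then show "z \<in> {pure_tensor (x \<otimes>\<^bsub>monoid_algebra TYPE('k) G\<^esub> y) m - pure_tensor x (kg_act (act M) y m) |x y m.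
        x \<in> carrier (monoid_algebra TYPE('k) G) \<and> y \<in> carrier (monoid_algebra TYPE('k) (G\<lparr>carrier := H\<rparr>)) \<and> m \<in> lev0 M}"
      by (intro CollectI exI[of _ "bv a"] exI[of _ "bv h"] exI[of _ m]) simp
  qed
qed

lemma kg_span: "carrier (monoid_algebra TYPE('k::field) G) = pm.span (bv ` carrier G)"
proof
  show "carrier (monoid_algebra TYPE('k) G) \<subseteq> pm.span (bv ` carrier G)"
  proof
    fix x :: "'g \<Rightarrow>\<^sub>0 'k" assume "x \<in> carrier (monoid_algebra TYPE('k) G)"
    then have "keys x \<subseteq> carrier G" by simp
    then show "x \<in> pm.span (bv ` carrier G)"
    proof (induction rule: supported_induct)
      case (add a c f)
      have "single a c = pscale c (bv a)" by (simp add: pscale_single)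
      with add show ?case by (simp add: pm.span_add pm.span_scale pm.span_base)
    qed (simp add: pm.span_zero)
  qed
  have "pm.subspace {f :: 'g \<Rightarrow>\<^sub>0 'k. keys f \<subseteq> carrier G}"
    unfolding pm.subspace_def by (auto simp: keys_add_subset) (auto simp: subset_iff in_keys_iff lookup_pscale)
  then show "pm.span (bv ` carrier G) \<subseteq> carrier (monoid_algebra TYPE('k) G)"
    by (intro pm.span_minimal) auto
qed

lemma kg_tensor_span:
  assumes "pm.subspace V"
  shows "tensor_space (carrier (monoid_algebra TYPE('k::field) G)) V
     = pm.span {pure_tensor (bv a) m | a m. a \<in> carrier G \<and> m \<in> V}"
proof -
  have "pm.span V = V" using assms by (rule pm.span_eq_iff[THEN iffD2])
  then have "tensor_space (carrier (monoid_algebra TYPE('k) G)) V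
    = pm.span {pure_tensor b c |b c. b \<in> bv ` carrier G \<and> c \<in> V}"
    using tensor_space_span[of "bv ` carrier G" V] by (simp only: kg_span)
  moreover have "{pure_tensor b c |b c. b \<in> bv ` carrier G \<and> c \<in> V} = {pure_tensor (bv a) m | a m. a \<in> carrier G \<and> m \<in> V}"
    by blast
  ultimately show ?thesis by simp
qed

text \<open>
  Left multiplication preserves the balancing relations and so commutes with the projection modulo
  them. The map \<open>E t\<close> sends \<open>a \<otimes> m\<close> to \<open>(t\<inverse> a) m\<close> if \<open>a\<close> lies in \<open>t H\<close> and to zero otherwise; it kills
  the balancing relations because \<open>a h\<close> and \<open>a\<close> lie in the same coset.
\<close>

lemma glider_ind_induced:
  fixes M :: "('g, 'b, 'k::field) glider"
  assumes M: "is_glider GH M"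
  shows "is_glider G (glider_ind G H M)"
    and "\<exists>\<iota> E. induced_by G H M (glider_ind G H M) \<iota> E"
proof -
  note D = gliderD[OF M, simplified]
  let ?R = "balancing_space G H M"
  let ?T = "tensor_space (carrier (monoid_algebra TYPE('k) G)) (lev0 M)"
  let ?I = "glider_ind G H M"
  define \<pi> where "\<pi> = quotient_proj ?R"
  have "pm.subspace ?R" unfolding balancing_space_def by (rule pm.subspace_span)
  then have \<pi>: "lin \<pi>" "\<And>v. \<pi> (\<pi> v) = \<pi> v" "\<And>v. \<pi> v = 0 \<longleftrightarrow> v \<in> ?R"
    unfolding \<pi>_def using quotient_proj by blast+
  have R: "?R = pm.span {pure_tensor (bv (a \<otimes> h)) m - pure_tensor (bv a) (act M h m)
     | a h m. a \<in> carrier G \<and> h \<in> H \<and> m \<in> lev0 M}" by (rule balancing_space_eq[OF M])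
  have T: "?T = pm.span {pure_tensor (bv a) m | a m. a \<in> carrier G \<and> m \<in> lev0 M}"
    by (rule kg_tensor_span[OF D(3)])
  have ind: "Omega ?I = \<pi> ` ?T" "lev0 ?I = \<pi> ` ?T" "act ?I g v = \<pi> (left_mult G g v)"
    "lev1 ?I = (\<lambda>m. \<pi> (pure_tensor (bv \<one>) m)) ` lev1 M" for g v
    by (auto simp: glider_ind_def \<pi>_def Let_def)
  have diff: "v - \<pi> v \<in> ?R" for v using \<pi> by (metis lin_diff right_minus_eq)
  have left_R: "left_mult G g z \<in> ?R" if g: "g \<in> carrier G" and z: "z \<in> ?R" for g z
  proof (rule lin_span_subset[OF lin_left_mult \<open>pm.subspace ?R\<close> _ z[unfolded R]])
    fix b assume "b \<in> {pure_tensor (bv (a \<otimes> h)) m - pure_tensor (bv a) (act M h m)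
     | a h m. a \<in> carrier G \<and> h \<in> H \<and> m \<in> lev0 M}"
    then obtain a h m where b: "b = pure_tensor (bv (a \<otimes> h)) m - pure_tensor (bv a) (act M h m)"
      "a \<in> carrier G" "h \<in> H" "m \<in> lev0 M" by blast
    have "left_mult G g b = pure_tensor (bv ((g \<otimes> a) \<otimes> h)) m - pure_tensor (bv (g \<otimes> a)) (act M h m)"
      using b g HG by (simp add: lin_diff[OF lin_left_mult] left_mult_pure m_assoc)
    then show "left_mult G g b \<in> ?R"
      unfolding R using b g by (intro pm.span_base) blast
  qed
  have left_\<pi>: "\<pi> (left_mult G g (\<pi> z)) = \<pi> (left_mult G g z)" if g: "g \<in> carrier G" for g z
  proof -
    have "left_mult G g z - left_mult G g (\<pi> z) \<in> ?R"
      using left_R[OF g diff[of z]] by (simp add: lin_diff[OF lin_left_mult])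
    then have "\<pi> (left_mult G g z - left_mult G g (\<pi> z)) = 0" using \<pi>(3) by blast
    then show ?thesis by (simp add: lin_diff[OF \<pi>(1)])
  qed
  have sT: "pm.subspace ?T" by (rule subspace_tensor_space)
  have pT: "pure_tensor (bv a) m \<in> ?T" if "a \<in> carrier G" "m \<in> lev0 M" for a m
    using that by (intro pure_in_tensor_space) simp_all
  have left_T: "left_mult G g z \<in> ?T" if g: "g \<in> carrier G" and z: "z \<in> ?T" for g z
  proof (rule lin_span_subset[OF lin_left_mult sT _ z[unfolded T]])
    fix b assume "b \<in> {pure_tensor (bv a) m | a m. a \<in> carrier G \<and> m \<in> lev0 M}"
    then obtain a m where "b = pure_tensor (bv a) m" "a \<in> carrier G" "m \<in> lev0 M" by blast
    then show "left_mult G g b \<in> ?T" using pT[of "g \<otimes> a" m] g by (simp only: left_mult_pure m_closed)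
  qed
  define \<iota> where "\<iota> = (\<lambda>m. \<pi> (pure_tensor (bv \<one>) m))"
  have l\<iota>: "lin \<iota>" unfolding \<iota>_def by (rule lin_comp[OF \<pi>(1) lin_pure_tensor_right])
  have act_\<iota>: "act ?I g (\<iota> m) = \<pi> (pure_tensor (bv g) m)" if "g \<in> carrier G" for g m
    using that by (simp add: ind \<iota>_def left_\<pi> left_mult_pure)
  show "is_glider G ?I"
  proof (rule is_gliderI)
    show "pm.subspace (Omega ?I)" "pm.subspace (lev0 ?I)"
      unfolding ind by (rule subspace_lin_image[OF \<pi>(1) sT])+
    show "pm.subspace (lev1 ?I)"
      unfolding ind by (rule subspace_lin_image[OF lin_comp[OF \<pi>(1) lin_pure_tensor_right] D(2)])
    show "lin (act ?I g)" for g
      unfolding ind[abs_def] by (rule lin_comp[OF \<pi>(1) lin_left_mult])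
    show "findim (lev0 ?I)"
      unfolding ind
      by (rule findim_image[OF \<pi>(1) findim_tensor[OF _ D(5)]]) (simp add: kg_span findim_span fin del: monoid_algebra_simps)
    show "act ?I g v \<in> Omega ?I" if "g \<in> carrier G" "v \<in> Omega ?I" for g v
      using that left_T by (auto simp: ind left_\<pi>)
    show "act ?I \<one> v = v" if v: "v \<in> Omega ?I" for v
    proof -
      obtain z where z: "z \<in> ?T" "v = \<pi> z" using v ind(1) by blast
      have "left_mult G \<one> z = z"
        by (rule lin_eq_on_span[OF lin_left_mult lin_id _ z(1)[unfolded T]]) (auto simp: left_mult_pure)
      then show ?thesis using z by (simp add: ind left_\<pi>)
    qed
    show "act ?I (g \<otimes> h) v = act ?I g (act ?I h v)" if g: "g \<in> carrier G" and h: "h \<in> carrier G" and v: "v \<in> Omega ?I"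
      for g h v
    proof -
      obtain z where z: "z \<in> ?T" "v = \<pi> z" using v ind(1) by blast
      have "left_mult G (g \<otimes> h) z = left_mult G g (left_mult G h z)"
        by (rule lin_eq_on_span[OF lin_left_mult lin_comp[OF lin_left_mult lin_left_mult] _ z(1)[unfolded T]])
          (use g h in \<open>auto simp: left_mult_pure m_assoc\<close>)
      then show ?thesis using z g h by (simp add: ind left_\<pi>)
    qed
    show "v \<in> lev0 ?I" if "v \<in> lev1 ?I" for v
      using that pT[OF one_closed] D(10) by (auto simp: ind)
    show "v \<in> lev0 ?I \<Longrightarrow> v \<in> Omega ?I" for v by (simp add: ind)
    show "act ?I g m \<in> lev0 ?I" if "g \<in> carrier G" "m \<in> lev1 ?I" for g m
      using that act_\<iota> pT D(10) by (auto simp: ind(2,4) \<iota>_def)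
  qed
  define E where "E t = basis_extend (\<lambda>(a, b). if inv t \<otimes> a \<in> H then act M (inv t \<otimes> a) (bv b) else 0)" for t
  have lE: "lin (E t)" for t unfolding E_def by (rule lin_basis_extend)
  have E_pure: "E t (pure_tensor (bv a) m) = (if inv t \<otimes> a \<in> H then act M (inv t \<otimes> a) m else 0)" for t a m
  proof (cases "inv t \<otimes> a \<in> H")
    case True
    have "E t (pure_tensor (bv a) m) = act M (inv t \<otimes> a) m"
      by (rule lin_eqI[OF lin_comp[OF lE lin_pure_tensor_right] D(6)[OF True]])
        (simp add: pure_tensor_bv E_def True)
    then show ?thesis using True by simp
  next
    case False
    have "E t (pure_tensor (bv a) m) = (\<lambda>_. 0) m"
      by (rule lin_eqI[OF lin_comp[OF lE lin_pure_tensor_right]]) (simp_all add: pure_tensor_bv E_def False linI)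
    then show ?thesis using False by simp
  qed
  have E_R: "E t z = 0" if t: "t \<in> carrier G" and z: "z \<in> ?R" for t z
  proof -
    have "E t z = (\<lambda>_. 0) z"
    proof (rule lin_eq_on_span[OF lE _ _ z[unfolded R]])
      fix b assume "b \<in> {pure_tensor (bv (a \<otimes> h)) m - pure_tensor (bv a) (act M h m)
       | a h m. a \<in> carrier G \<and> h \<in> H \<and> m \<in> lev0 M}"
      then obtain a h m where b: "b = pure_tensor (bv (a \<otimes> h)) m - pure_tensor (bv a) (act M h m)"
        "a \<in> carrier G" "h \<in> H" "m \<in> lev0 M" by blast
      have as: "inv t \<otimes> (a \<otimes> h) = (inv t \<otimes> a) \<otimes> h" using b t HG by (simp add: m_assoc)
      have iff: "inv t \<otimes> a \<otimes> h \<in> H \<longleftrightarrow> inv t \<otimes> a \<in> H"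
      proof
        assume "inv t \<otimes> a \<otimes> h \<in> H"
        then have "inv t \<otimes> a \<otimes> h \<otimes> inv h \<in> H"
          using b(3) subgroup.m_closed[OF sub] subgroup.m_inv_closed[OF sub] by blast
        then show "inv t \<otimes> a \<in> H" using b t HG by (simp add: m_assoc)
      qed (use b(3) subgroup.m_closed[OF sub] in blast)
      show "E t b = 0"
        unfolding b(1) using b(3,4) D(9,11) by (simp add: lin_diff[OF lE] E_pure as iff)
    qed (simp add: linI)
    then show ?thesis by simp
  qed
  have E_\<pi>: "E t (\<pi> z) = E t z" if t: "t \<in> carrier G" for t z
    using E_R[OF t diff[of z]] by (simp add: lin_diff[OF lE])
  have "induced_by G H M ?I \<iota> E"
    unfolding induced_by_def
  proof (intro conjI allI ballI)
    show "lin \<iota>" by (rule l\<iota>)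
    show "lin (E t)" for t by (rule lE)
    show "lev1 ?I = \<iota> ` lev1 M" by (simp add: ind \<iota>_def)
    show "act ?I g (\<iota> (act M h m)) = act ?I (g \<otimes> h) (\<iota> m)"
      if g: "g \<in> carrier G" and h: "h \<in> H" and m: "m \<in> lev1 M" for g h m
    proof -
      have "pure_tensor (bv (g \<otimes> h)) m - pure_tensor (bv g) (act M h m) \<in> ?R"
        unfolding R using g h D(10)[OF m] by (intro pm.span_base) blast
      then have "\<pi> (pure_tensor (bv (g \<otimes> h)) m - pure_tensor (bv g) (act M h m)) = 0" using \<pi>(3) by blast
      then show ?thesis using g h HG by (simp add: act_\<iota> lin_diff[OF \<pi>(1)])
    qed
    show "E t (act ?I g (\<iota> m)) = (if inv t \<otimes> g \<in> H then act M (inv t \<otimes> g) m else 0)"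
      if "t \<in> carrier G" "g \<in> carrier G" "m \<in> lev1 M" for t g m
      using that by (simp add: act_\<iota> E_\<pi> E_pure)
  qed
  then show "\<exists>\<iota> E. induced_by G H M ?I \<iota> E" by blast
qed

end

section \<open>Additive maps between the rings of irreducible gliders\<close>

context finite_group
begin

lemma irreducible_in_R1bar: "reduced_class G ` irr1_classes TYPE('k::field) G \<subseteq> carrier (R1bar TYPE('k) G)"
  unfolding carrier_R1bar by (auto intro: generate.incl)

text \<open>
  Translating a sum \<open>\<Sum>g (m g)\<close> by \<open>h\<close> permutes the group elements in it.
\<close>

lemma generated0_lev0_module:
  fixes M :: "('g, 'b, 'k::field) glider"
  assumes M: "is_glider G M" and gen: "lev0 M = generated0 G M"
  shows "lev0_module G M"
proof -
  note D = gliderD[OF M]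
  have "act M h v \<in> lev0 M" if h: "h \<in> carrier G" and v: "v \<in> lev0 M" for h v
  proof -
    obtain m where m: "v = (\<Sum>g\<in>carrier G. act M g (m g))" "\<forall>g\<in>carrier G. m g \<in> lev1 M"
      using v unfolding gen generated0_def by blast
    have "act M h v = (\<Sum>g\<in>carrier G. act M (h \<otimes> g) (m g))"
      unfolding m(1) lin_sum[OF D(6)[OF h]] using m(2) h by (intro sum.cong) (auto simp: D(9,12))
    also have "\<dots> \<in> lev0 M"
      by (rule pm.subspace_sum[OF D(3)]) (use m(2) h D(13) in auto)
    finally show ?thesis .
  qed
  then show ?thesis
    unfolding lev0_module_def using kg_act_closed_iff[OF D(3), of G "act M"] by blast
qed

end

lemma R1bar_additive_group:
  assumes "finite_group A" shows "group (add_monoid (R1bar TYPE('k::field) A))"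
proof -
  interpret A: finite_group A by fact
  interpret R: cring "R1bar TYPE('k) A" by (rule A.R1bar_cring)
  show ?thesis by (rule R.a_group)
qed

text \<open>
  The irreducible classes generate the ring additively.
\<close>

lemma R1bar_hom_unique:
  assumes A: "finite_group A" and B: "finite_group B"
    and F: "F \<in> extensional (carrier (R1bar TYPE('k::field) A))" "F \<in> hom (add_monoid (R1bar TYPE('k) A)) (add_monoid (R1bar TYPE('k) B))"
    and F': "F' \<in> extensional (carrier (R1bar TYPE('k) A))" "F' \<in> hom (add_monoid (R1bar TYPE('k) A)) (add_monoid (R1bar TYPE('k) B))"
    and eq: "\<And>c. c \<in> irr1_classes TYPE('k) A \<Longrightarrow> F (reduced_class A c) = F' (reduced_class A c)"
  shows "F = F'"
proof (rule extensionalityI[OF F(1) F'(1)])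
  interpret A: finite_group A by fact
  fix X assume X: "X \<in> carrier (R1bar TYPE('k) A)"
  show "F X = F' X"
  proof (rule additive_eq_on_generate[OF R1bar_additive_group[OF A] R1bar_additive_group[OF B] F(2) F'(2)])
    show "reduced_class A ` irr1_classes TYPE('k) A \<subseteq> carrier (add_monoid (R1bar TYPE('k) A))"
      using A.irreducible_in_R1bar by simp
    show "X \<in> generate (add_monoid (R1bar TYPE('k) A)) (reduced_class A ` irr1_classes TYPE('k) A)"
      using X by (simp only: A.R1bar_generated[symmetric])
  qed (use eq in blast)
qed

text \<open>
  The properties common to restriction and induction. They are stated on the whole reduced ring,
  where both maps are obtained, and on generators of the ring of irreducible gliders.
\<close>

definition respects_irreducibles ::
  "('g, 'x) monoid_scheme \<Rightarrow> ('g, 'x) monoid_scheme \<Rightarrow>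
   ((('g, nat, 'k::field) glider set \<Rightarrow>\<^sub>0 int) set set \<Rightarrow> (('g, nat, 'k) glider set \<Rightarrow>\<^sub>0 int) set set) \<Rightarrow> bool" where
  "respects_irreducibles A B \<Phi> \<longleftrightarrow>
     \<Phi> \<in> hom (add_monoid (reduced_groth_ring TYPE('k) A)) (add_monoid (reduced_groth_ring TYPE('k) B)) \<and>
     (\<forall>c\<in>irr1_classes TYPE('k) A. \<Phi> (reduced_class A c) \<in> reduced_class B ` irr1_classes TYPE('k) B) \<and>
     (\<forall>c\<in>irr1_classes TYPE('k) A. \<forall>d\<in>irr1_classes TYPE('k) A.
        \<Phi> (reduced_class A c \<otimes>\<^bsub>reduced_groth_ring TYPE('k) A\<^esub> reduced_class A d)
          = \<Phi> (reduced_class A c) \<otimes>\<^bsub>reduced_groth_ring TYPE('k) B\<^esub> \<Phi> (reduced_class A d))"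

lemma respects_irreduciblesD:
  fixes \<Phi> :: "(('g, nat, 'k::field) glider set \<Rightarrow>\<^sub>0 int) set set \<Rightarrow> (('g, nat, 'k) glider set \<Rightarrow>\<^sub>0 int) set set"
  assumes "respects_irreducibles A B \<Phi>"
  shows "\<Phi> \<in> hom (add_monoid (reduced_groth_ring TYPE('k) A)) (add_monoid (reduced_groth_ring TYPE('k) B))"
    "\<And>c. c \<in> irr1_classes TYPE('k) A \<Longrightarrow> \<Phi> (reduced_class A c) \<in> reduced_class B ` irr1_classes TYPE('k) B"
    "\<And>c d. c \<in> irr1_classes TYPE('k) A \<Longrightarrow> d \<in> irr1_classes TYPE('k) A \<Longrightarrow>
        \<Phi> (reduced_class A c \<otimes>\<^bsub>reduced_groth_ring TYPE('k) A\<^esub> reduced_class A d)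
          = \<Phi> (reduced_class A c) \<otimes>\<^bsub>reduced_groth_ring TYPE('k) B\<^esub> \<Phi> (reduced_class A d)"
  using assms unfolding respects_irreducibles_def by blast+

text \<open>
  The image of an additive span is the additive span of the images, and multiplicativity extends from
  the irreducible classes by biadditivity.
\<close>

lemma restrict_additive_to_R1bar:
  fixes \<Phi> :: "(('g, nat, 'k::field) glider set \<Rightarrow>\<^sub>0 int) set set \<Rightarrow> (('g, nat, 'k) glider set \<Rightarrow>\<^sub>0 int) set set"
  assumes A: "finite_group A" and B: "finite_group B" and resp: "respects_irreducibles A B \<Phi>"
  defines "F \<equiv> restrict \<Phi> (carrier (R1bar TYPE('k) A))"
  shows "F \<in> hom (add_monoid (R1bar TYPE('k) A)) (add_monoid (R1bar TYPE('k) B))"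
    and "F \<in> nonunital_ring_hom (R1bar TYPE('k) A) (R1bar TYPE('k) B)"
proof -
  note \<Phi> = respects_irreduciblesD(1)[OF resp] and irr = respects_irreduciblesD(2)[OF resp]
    and mult = respects_irreduciblesD(3)[OF resp]
  interpret A: finite_group A by fact
  interpret B: finite_group B by fact
  let ?RA = "reduced_groth_ring TYPE('k) A" and ?RB = "reduced_groth_ring TYPE('k) B"
  let ?A = "R1bar TYPE('k) A" and ?B = "R1bar TYPE('k) B"
  let ?SA = "reduced_class A ` irr1_classes TYPE('k) A" and ?SB = "reduced_class B ` irr1_classes TYPE('k) B"
  interpret RA: cring ?RA by (rule A.reduced_groth_cring)
  interpret RB: cring ?RB by (rule B.reduced_groth_cring)
  interpret R1A: cring ?A by (rule A.R1bar_cring)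
  interpret R1B: cring ?B by (rule B.R1bar_cring)
  interpret \<Phi>: group_hom "add_monoid ?RA" "add_monoid ?RB" \<Phi>
    using \<Phi> RA.a_group RB.a_group by (simp add: group_hom_def group_hom_axioms_def)
  have "\<Phi> ` carrier ?A = generate (add_monoid ?RB) (\<Phi> ` ?SA)"
    unfolding A.carrier_R1bar using \<Phi>.generate_img[of ?SA] A.irreducible_carrier[where ?'k = 'k] by simp
  also have "\<dots> \<subseteq> carrier ?B"
    unfolding B.carrier_R1bar using irr by (intro RB.add.mono_generate) blast
  finally have closed: "\<Phi> X \<in> carrier ?B" if "X \<in> carrier ?A" for X using that by blast
  have F: "F X = \<Phi> X" if "X \<in> carrier ?A" for X using that by (simp add: F_def)
  show hom: "F \<in> hom (add_monoid ?A) (add_monoid ?B)"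
  proof (rule homI)
    show "F X \<in> carrier (add_monoid ?B)" if "X \<in> carrier (add_monoid ?A)" for X
      using that closed F by simp
    show "F (X \<otimes>\<^bsub>add_monoid ?A\<^esub> Y) = F X \<otimes>\<^bsub>add_monoid ?B\<^esub> F Y"
      if "X \<in> carrier (add_monoid ?A)" "Y \<in> carrier (add_monoid ?A)" for X Y
    proof -
      have XY: "X \<in> carrier ?A" "Y \<in> carrier ?A" using that by simp_all
      then have "X \<oplus>\<^bsub>?A\<^esub> Y \<in> carrier ?A" by (rule R1A.a_closed)
      moreover have "X \<in> carrier ?RA" "Y \<in> carrier ?RA" using XY A.R1bar_subset by blast+
      ultimately show ?thesis using XY \<Phi>.hom_mult[of X Y] F[of "X \<oplus>\<^bsub>?A\<^esub> Y"] by (simp add: F)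
    qed
  qed
  have "F (X \<otimes>\<^bsub>?A\<^esub> Y) = F X \<otimes>\<^bsub>?B\<^esub> F Y" if "X \<in> carrier ?A" "Y \<in> carrier ?A" for X Y
  proof (rule mult_hom_from_generators[OF A.R1bar_cring B.R1bar_cring hom A.R1bar_generated _ that])
    fix a b assume ab: "a \<in> ?SA" "b \<in> ?SA"
    then obtain c d where cd: "c \<in> irr1_classes TYPE('k) A" "a = reduced_class A c"
      "d \<in> irr1_classes TYPE('k) A" "b = reduced_class A d" by blast
    have c: "a \<in> carrier ?A" "b \<in> carrier ?A" using ab A.irreducible_in_R1bar by blast+
    have "a \<otimes>\<^bsub>?A\<^esub> b \<in> carrier ?A" using c by (rule R1A.m_closed)
    then show "F (a \<otimes>\<^bsub>?A\<^esub> b) = F a \<otimes>\<^bsub>?B\<^esub> F b"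
      using mult[OF cd(1,3)] cd(2,4) F[of "a \<otimes>\<^bsub>?A\<^esub> b"] F[OF c(1)] F[OF c(2)] by simp
  qed
  moreover have "F X \<in> carrier ?B" if "X \<in> carrier ?A" for X using that closed F by simp
  ultimately have "F \<in> hom ?A ?B" by (intro homI)
  with hom show "F \<in> nonunital_ring_hom ?A ?B" unfolding nonunital_ring_hom_def by blast
qed

text \<open>
  In terms of the bases such a map relabels the basis elements injectively.
\<close>

lemma inj_on_R1bar_from_basis:
  fixes \<Phi> :: "(('g, nat, 'k::field) glider set \<Rightarrow>\<^sub>0 int) set set \<Rightarrow> (('g, nat, 'k) glider set \<Rightarrow>\<^sub>0 int) set set"
  assumes A: "finite_group A" and B: "finite_group B" and resp: "respects_irreducibles A B \<Phi>"
    and inj: "inj_on (\<lambda>c. \<Phi> (reduced_class A c)) (irr1_classes TYPE('k) A)"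
  shows "inj_on \<Phi> (carrier (R1bar TYPE('k) A))"
proof -
  note \<Phi> = respects_irreduciblesD(1)[OF resp] and irr = respects_irreduciblesD(2)[OF resp]
  interpret A: finite_group A by fact
  interpret B: finite_group B by fact
  let ?FA = "free_groth_ring TYPE('k) A" and ?FB = "free_groth_ring TYPE('k) B"
  let ?RA = "reduced_groth_ring TYPE('k) A" and ?RB = "reduced_groth_ring TYPE('k) B"
  let ?irrA = "irr1_classes TYPE('k) A" and ?irrB = "irr1_classes TYPE('k) B"
  interpret FA: cring ?FA by (rule A.free_groth_cring)
  interpret RB: cring ?RB by (rule B.reduced_groth_cring)
  interpret qA: group_hom "add_monoid ?FA" "add_monoid ?RA" "groth_proj A" by (rule A.groth_proj_group_hom)
  interpret qB: group_hom "add_monoid ?FB" "add_monoid ?RB" "groth_proj B" by (rule B.groth_proj_group_hom)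
  interpret MB: comm_monoid "iso_class_monoid TYPE('k) B" by (rule B.iso_class_comm_monoid)
  \<comment> \<open>Off the irreducible classes any value in the carrier will do; the unit is one.\<close>
  define \<tau> where "\<tau> c = (if c \<in> ?irrA then inv_into ?irrB (reduced_class B) (\<Phi> (reduced_class A c))
     else \<one>\<^bsub>iso_class_monoid TYPE('k) B\<^esub>)" for c
  have \<tau>: "\<tau> c \<in> ?irrB" "reduced_class B (\<tau> c) = \<Phi> (reduced_class A c)" if "c \<in> ?irrA" for c
    using irr[OF that] that by (simp_all add: \<tau>_def inv_into_into f_inv_into_f)
  have \<tau>c: "\<tau> c \<in> carrier (iso_class_monoid TYPE('k) B)" for c
    using \<tau>(1)[of c] B.irr1_classes_carrier MB.one_closed by (cases "c \<in> ?irrA") (auto simp: \<tau>_def)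
  have \<tau>_inj: "inj_on \<tau> ?irrA"
    using inj \<tau>(2) by (metis (no_types, lifting) inj_on_def)
  have hom1: "(\<lambda>x. \<Phi> (groth_proj A x)) \<in> hom (add_monoid ?FA) (add_monoid ?RB)"
    using Group.hom_compose[OF qA.homh \<Phi>] by (simp add: comp_def)
  have rF: "relabel \<tau> x \<in> carrier ?FB" if "x \<in> carrier ?FA" for x :: "_ \<Rightarrow>\<^sub>0 int"
    using keys_relabel[of x "carrier (iso_class_monoid TYPE('k) A)" \<tau>] that \<tau>c
    by (auto simp: free_groth_ring_def)
  have hom2: "(\<lambda>x. groth_proj B (relabel \<tau> x)) \<in> hom (add_monoid ?FA) (add_monoid ?RB)"
  proof (rule homI)
    show "groth_proj B (relabel \<tau> x) \<in> carrier (add_monoid ?RB)" if "x \<in> carrier (add_monoid ?FA)" for x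
      using that rF qB.hom_closed by simp
    show "groth_proj B (relabel \<tau> (x \<otimes>\<^bsub>add_monoid ?FA\<^esub> y))
       = groth_proj B (relabel \<tau> x) \<otimes>\<^bsub>add_monoid ?RB\<^esub> groth_proj B (relabel \<tau> y)"
      if "x \<in> carrier (add_monoid ?FA)" "y \<in> carrier (add_monoid ?FA)" for x y
      using that qB.hom_mult[of "relabel \<tau> x" "relabel \<tau> y"] rF[of x] rF[of y]
      by (simp add: free_groth_ring_def relabel_add)
  qed
  have eq: "\<Phi> (groth_proj A x) = groth_proj B (relabel \<tau> x)" if x: "keys x \<subseteq> ?irrA" for x
  proof (rule additive_eq_on_generate[OF FA.a_group RB.a_group hom1 hom2])
    show "bv ` ?irrA \<subseteq> carrier (add_monoid ?FA)"
      using A.irr1_classes_carrier by (auto simp: free_groth_ring_def)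
    show "\<Phi> (groth_proj A s) = groth_proj B (relabel \<tau> s)" if "s \<in> bv ` ?irrA" for s
      using that \<tau>(2) by (auto simp: reduced_class_eq)
    show "x \<in> generate (add_monoid ?FA) (bv ` ?irrA)"
      using monoid_algebra_generated[OF A.free_groth_cring[unfolded free_groth_ring_def] x A.irr1_classes_carrier]
      by (simp add: free_groth_ring_def)
  qed
  show ?thesis
  proof (rule inj_onI)
    fix X Y assume XY: "X \<in> carrier (R1bar TYPE('k) A)" "Y \<in> carrier (R1bar TYPE('k) A)" "\<Phi> X = \<Phi> Y"
    obtain x where x: "keys x \<subseteq> ?irrA" "X = groth_proj A x"
      using XY(1) unfolding A.carrier_R1bar A.irreducible_span[symmetric] by blast
    obtain y where y: "keys y \<subseteq> ?irrA" "Y = groth_proj A y"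
      using XY(2) unfolding A.carrier_R1bar A.irreducible_span[symmetric] by blast
    have keys: "keys (relabel \<tau> z) \<subseteq> ?irrB" if "keys z \<subseteq> ?irrA" for z :: "_ \<Rightarrow>\<^sub>0 int"
      using keys_relabel[OF that, of \<tau>] \<tau>(1) by auto
    have "groth_proj B (relabel \<tau> x) = groth_proj B (relabel \<tau> y)"
      using XY(3) eq[OF x(1)] eq[OF y(1)] x(2) y(2) by simp
    then have "relabel \<tau> x = relabel \<tau> y"
      using keys[OF x(1)] keys[OF y(1)] by (intro inj_onD[OF B.groth_proj_inj_on]) auto
    moreover have "relabel (inv_into ?irrA \<tau>) (relabel \<tau> z) = z" if "keys z \<subseteq> ?irrA" for z :: "_ \<Rightarrow>\<^sub>0 int"
      by (intro relabel_inverse inv_into_f_f[OF \<tau>_inj]) (use that in blast)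
    ultimately show "X = Y" using x y by metis
  qed
qed

text \<open>
  The conditions that specify restriction and induction have the form \<open>P\<close>. The values prescribed on
  irreducible gliders force uniqueness; existence holds since \<open>\<Phi>\<close> has the prescribed value at every
  admissible glider, irreducible or not.
\<close>

lemma map_on_irreducibles:
  fixes \<Phi> :: "(('g, nat, 'k::field) glider set \<Rightarrow>\<^sub>0 int) set set \<Rightarrow> (('g, nat, 'k) glider set \<Rightarrow>\<^sub>0 int) set set"
  assumes A: "finite_group A" and B: "finite_group B" and resp: "respects_irreducibles A B \<Phi>"
    and t: "\<And>M. Q M \<Longrightarrow> rcl A M \<in> carrier (R1bar TYPE('k) A) \<Longrightarrow> \<Phi> (rcl A M) = t M"
    and Q: "\<And>M :: ('g, nat, 'k) glider. is_glider A M \<Longrightarrow> lev0_module A M \<Longrightarrow> Q M"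
    and P: "\<And>F. P F \<longleftrightarrow> F \<in> extensional (carrier (R1bar TYPE('k) A)) \<and>
       F \<in> hom (add_monoid (R1bar TYPE('k) A)) (add_monoid (R1bar TYPE('k) B)) \<and>
       (\<forall>M. Q M \<and> rcl A M \<in> carrier (R1bar TYPE('k) A) \<longrightarrow> F (rcl A M) = t M)"
  shows "\<exists>!F. P F" and "(THE F. P F) = restrict \<Phi> (carrier (R1bar TYPE('k) A))"
    and "(THE F. P F) \<in> nonunital_ring_hom (R1bar TYPE('k) A) (R1bar TYPE('k) B)"
    and "(THE F. P F) ` carrier (irr1_monoid TYPE('k) A) \<subseteq> carrier (irr1_monoid TYPE('k) B)"
proof -
  interpret A: finite_group A by fact
  define F where "F = restrict \<Phi> (carrier (R1bar TYPE('k) A))"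
  note hom = restrict_additive_to_R1bar[OF A B resp, folded F_def]
  have ext: "F \<in> extensional (carrier (R1bar TYPE('k) A))" unfolding F_def by simp
  have PF: "P F" unfolding P using hom(1) ext t by (simp add: F_def)
  have uniq: "F' = F" if F': "P F'" for F'
  proof (rule R1bar_hom_unique[OF A B])
    fix c assume c: "c \<in> irr1_classes TYPE('k) A"
    obtain M :: "('g, nat, 'k) glider" and v where M: "is_glider A M" "v \<noteq> 0" "lev1 M = pm.span {v}"
      "lev0 M = generated0 A M" "c = iso_class A M" by (rule A.irr1_classE[OF c])
    have "rcl A M \<in> carrier (R1bar TYPE('k) A)" using A.irreducible_in_R1bar c M(5) by blast
    moreover have "Q M" using Q A.generated0_lev0_module[OF M(1,4)] M(1) by blast
    ultimately show "F' (reduced_class A c) = F (reduced_class A c)"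
      using PF F' unfolding P M(5) by simp
  qed (use ext hom(1) F' in \<open>simp_all add: P\<close>)
  show "\<exists>!F. P F" using PF uniq by blast
  have eq: "(THE F. P F) = F" by (intro the_equality PF uniq)
  show "(THE F. P F) = restrict \<Phi> (carrier (R1bar TYPE('k) A))" unfolding eq F_def ..
  show "(THE F. P F) \<in> nonunital_ring_hom (R1bar TYPE('k) A) (R1bar TYPE('k) B)"
    unfolding eq by (rule hom(2))
  show "(THE F. P F) ` carrier (irr1_monoid TYPE('k) A) \<subseteq> carrier (irr1_monoid TYPE('k) B)"
    unfolding eq using respects_irreduciblesD(2)[OF resp] A.irreducible_in_R1bar
    by (auto simp: F_def subset_iff)
qed

section \<open>Restriction and induction\<close>

context finite_subgroup
begin

lemma restrict_glider: "is_glider G M \<Longrightarrow> is_glider GH M"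
  by (rule is_gliderI) (simp_all add: gliderD HG)

lemma restrict_glider_iso:
  assumes "glider_iso G M N" and M: "is_glider G M" and N: "is_glider G N"
  shows "glider_iso GH M N"
proof -
  obtain f h where "linear_iso_pair G M N f h" using glider_isoE[OF assms] by blast
  note f = linear_iso_pairD[OF this]
  show ?thesis
    by (rule glider_isoI[OF restrict_glider[OF M] restrict_glider[OF N] f(1,2)]) (simp_all add: f HG)
qed

text \<open>
  A glider over \<open>G\<close> is one over \<open>H\<close> with the same data, and this is compatible with isomorphisms,
  direct sums and tensor products.
\<close>

lemma restriction_map:
  obtains \<Phi> where "respects_irreducibles G GH \<Phi>"
    "\<And>M :: ('g, nat, 'k::field) glider. is_glider G M \<Longrightarrow> \<Phi> (rcl G M) = rcl GH M"
proof -
  have dsum: "rcl GH P = rcl GH M \<oplus>\<^bsub>reduced_groth_ring TYPE('k) GH\<^esub> rcl GH N"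
    if "is_glider G M" "is_glider G N" "is_glider G P" "glider_iso G P (glider_dsum M N)"
    for M N P :: "('g, nat, 'k) glider"
    using that H.rcl_iso[OF _ _ restrict_glider_iso[OF that(4)]]
    by (simp add: restrict_glider is_glider_dsum H.rcl_dsum)
  have iso: "rcl GH M = rcl GH N" if "is_glider G M" "is_glider G N" "glider_iso G M N"
    for M N :: "('g, nat, 'k) glider"
    using that by (intro H.rcl_iso restrict_glider restrict_glider_iso)
  have zero: "rcl GH M = \<zero>\<^bsub>reduced_groth_ring TYPE('k) GH\<^esub>" if "is_glider G M" "length_zero M"
    for M :: "('g, nat, 'k) glider"
    by (rule H.rcl_length_zero[OF restrict_glider[OF that(1)] that(2)])
  have closed: "rcl GH M \<in> carrier (reduced_groth_ring TYPE('k) GH)" if "is_glider G M" for M :: "('g, nat, 'k) glider"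
    by (rule H.rcl_closed[OF restrict_glider[OF that]])
  obtain \<Phi> where \<Phi>: "\<Phi> \<in> hom (add_monoid (reduced_groth_ring TYPE('k) G)) (add_monoid (reduced_groth_ring TYPE('k) GH))"
    "\<And>M :: ('g, nat, 'k) glider. is_glider G M \<Longrightarrow> \<Phi> (rcl G M) = rcl GH M"
    by (rule descend_additive[OF finite_group_axioms finite_group_H closed iso dsum zero]) blast+
  have "respects_irreducibles G GH \<Phi>"
    unfolding respects_irreducibles_def
  proof (intro conjI ballI \<Phi>(1))
    fix c assume c: "c \<in> irr1_classes TYPE('k) G"
    obtain M :: "('g, nat, 'k) glider" and v where M: "is_glider G M" "v \<noteq> 0" "lev1 M = pm.span {v}"
      "lev0 M = generated0 G M" "c = iso_class G M" by (rule irr1_classE[OF c])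
    show "\<Phi> (reduced_class G c) \<in> reduced_class GH ` irr1_classes TYPE('k) GH"
      unfolding M(5) \<Phi>(2)[OF M(1)] by (rule H.rcl_line[OF restrict_glider[OF M(1)] M(2,3)])
    fix d assume d: "d \<in> irr1_classes TYPE('k) G"
    obtain N :: "('g, nat, 'k) glider" and w where N: "is_glider G N" "w \<noteq> 0" "lev1 N = pm.span {w}"
      "lev0 N = generated0 G N" "d = iso_class G N" by (rule irr1_classE[OF d])
    have T: "is_glider G (glider_tensor M N)" by (rule is_glider_tensor[OF M(1) N(1)])
    obtain P :: "('g, nat, 'k) glider" where P: "is_glider G P" "glider_iso G P (glider_tensor M N)"
      using nat_representative[OF T] .
    have "rcl G M \<otimes>\<^bsub>reduced_groth_ring TYPE('k) G\<^esub> rcl G N = rcl G P"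
      using rcl_tensor[OF M(1) N(1)] rcl_iso[OF P(1) T P(2)] by simp
    moreover have "rcl GH P = rcl GH M \<otimes>\<^bsub>reduced_groth_ring TYPE('k) GH\<^esub> rcl GH N"
      using H.rcl_iso[OF restrict_glider[OF P(1)] restrict_glider[OF T] restrict_glider_iso[OF P(2) P(1) T]]
        H.rcl_tensor[OF restrict_glider[OF M(1)] restrict_glider[OF N(1)]] by simp
    ultimately show "\<Phi> (reduced_class G c \<otimes>\<^bsub>reduced_groth_ring TYPE('k) G\<^esub> reduced_class G d)
          = \<Phi> (reduced_class G c) \<otimes>\<^bsub>reduced_groth_ring TYPE('k) GH\<^esub> \<Phi> (reduced_class G d)"
      unfolding M(5) N(5) using \<Phi>(2) M(1) N(1) P(1) by simp
  qed
  then show ?thesis using that \<Phi>(2) by blast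
qed

text \<open>
  An induced glider may be replaced by any glider of the same description.
\<close>

lemma rcl_induced:
  fixes M :: "('g, 'a, 'k::field_char_0) glider" and M' :: "('g, 'b, 'k) glider" and N :: "('g, 'c, 'k) glider"
  assumes M: "is_glider GH M" and M': "is_glider GH M'" and N: "is_glider G N"
    and ind: "induced_by G H M' N \<iota> E" and f: "same_relations GH M M' f"
  shows "rcl G (glider_ind G H M) = rcl G N"
proof -
  obtain \<iota>0 E0 where I: "induced_by G H M (glider_ind G H M) \<iota>0 E0" using glider_ind_induced(2)[OF M] by blast
  obtain k where "same_relations G (glider_ind G H M) N k"
    using induced_same_relations[OF I M glider_ind_induced(1)[OF M] ind M' N f] .
  then show ?thesis by (rule rcl_same_relations[OF _ glider_ind_induced(1)[OF M] N])
qed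

text \<open>
  Each property follows by comparing induced gliders through \<open>rcl_induced\<close>, with the descriptions of
  \<open>induced_dsum\<close> and \<open>induced_tensor\<close>; injectivity follows from \<open>induced_ann\<close>.
\<close>

lemma induction_map:
  obtains \<Phi> where "respects_irreducibles GH G \<Phi>"
    "\<And>M :: ('g, nat, 'k::field_char_0) glider. is_glider GH M \<Longrightarrow> \<Phi> (rcl GH M) = rcl G (glider_ind G H M)"
    "inj_on (\<lambda>c. \<Phi> (reduced_class GH c)) (irr1_classes TYPE('k) GH)"
proof -
  have iso: "rcl G (glider_ind G H M) = rcl G (glider_ind G H N)"
    if M: "is_glider GH M" and N: "is_glider GH N" and iso: "glider_iso GH M N" for M N :: "('g, nat, 'k) glider"
  proof -
    obtain f where "same_relations GH M N f" using H.iso_same_relations[OF iso M N] .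
    moreover obtain \<iota> E where "induced_by G H N (glider_ind G H N) \<iota> E" using glider_ind_induced(2)[OF N] by blast
    ultimately show ?thesis using rcl_induced[OF M N glider_ind_induced(1)[OF N]] by blast
  qed
  have dsum: "rcl G (glider_ind G H P) = rcl G (glider_ind G H M) \<oplus>\<^bsub>reduced_groth_ring TYPE('k) G\<^esub> rcl G (glider_ind G H N)"
    if M: "is_glider GH M" and N: "is_glider GH N" and P: "is_glider GH P" "glider_iso GH P (glider_dsum M N)"
    for M N P :: "('g, nat, 'k) glider"
  proof -
    note S = H.is_glider_dsum[OF M N] and iM = glider_ind_induced(1)[OF M] and iN = glider_ind_induced(1)[OF N]
    obtain f where f: "same_relations GH P (glider_dsum M N) f" using H.iso_same_relations[OF P(2,1) S] .
    obtain \<iota> E \<iota>' E' where "induced_by G H M (glider_ind G H M) \<iota> E" "induced_by G H N (glider_ind G H N) \<iota>' E'"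
      using glider_ind_induced(2)[OF M] glider_ind_induced(2)[OF N] by blast
    from rcl_induced[OF P(1) S is_glider_dsum[OF iM iN] induced_dsum[OF this(1) M iM this(2) N iN] f]
    show ?thesis using rcl_dsum[OF iM iN] by simp
  qed
  have tensor: "rcl G (glider_ind G H P) = rcl G (glider_ind G H M) \<otimes>\<^bsub>reduced_groth_ring TYPE('k) G\<^esub> rcl G (glider_ind G H N)"
    if M: "is_glider GH M" and N: "is_glider GH N" and P: "is_glider GH P" "glider_iso GH P (glider_tensor M N)"
    for M N P :: "('g, nat, 'k) glider"
  proof -
    note S = H.is_glider_tensor[OF M N] and iM = glider_ind_induced(1)[OF M] and iN = glider_ind_induced(1)[OF N]
    obtain f where f: "same_relations GH P (glider_tensor M N) f" using H.iso_same_relations[OF P(2,1) S] .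
    obtain \<iota> E \<iota>' E' where "induced_by G H M (glider_ind G H M) \<iota> E" "induced_by G H N (glider_ind G H N) \<iota>' E'"
      using glider_ind_induced(2)[OF M] glider_ind_induced(2)[OF N] by blast
    from rcl_induced[OF P(1) S is_glider_tensor[OF iM iN] induced_tensor[OF this(1) M iM this(2) N iN] f]
    show ?thesis using rcl_tensor[OF iM iN] by simp
  qed
  have zero: "rcl G (glider_ind G H M) = \<zero>\<^bsub>reduced_groth_ring TYPE('k) G\<^esub>"
    if M: "is_glider GH M" and z: "length_zero M" for M :: "('g, nat, 'k) glider"
  proof -
    obtain \<iota> E where I: "induced_by G H M (glider_ind G H M) \<iota> E" using glider_ind_induced(2)[OF M] by blast
    have "length_zero (glider_ind G H M)"
      using z unfolding length_zero_def induced_byD(3)[OF I] by (simp add: lin_zero[OF induced_byD(1)[OF I]])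
    then show ?thesis by (rule rcl_length_zero[OF glider_ind_induced(1)[OF M]])
  qed
  have closed: "rcl G (glider_ind G H M) \<in> carrier (reduced_groth_ring TYPE('k) G)" if "is_glider GH M"
    for M :: "('g, nat, 'k) glider"
    by (rule rcl_closed[OF glider_ind_induced(1)[OF that]])
  obtain \<Phi> where \<Phi>: "\<Phi> \<in> hom (add_monoid (reduced_groth_ring TYPE('k) GH)) (add_monoid (reduced_groth_ring TYPE('k) G))"
    "\<And>M :: ('g, nat, 'k) glider. is_glider GH M \<Longrightarrow> \<Phi> (rcl GH M) = rcl G (glider_ind G H M)"
    by (rule descend_additive[OF finite_group_H finite_group_axioms closed iso dsum zero]) blast+
  have "respects_irreducibles GH G \<Phi>"
    unfolding respects_irreducibles_def
  proof (intro conjI ballI \<Phi>(1))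
    fix c assume c: "c \<in> irr1_classes TYPE('k) GH"
    obtain M :: "('g, nat, 'k) glider" and v where M: "is_glider GH M" "v \<noteq> 0" "lev1 M = pm.span {v}"
      "lev0 M = generated0 GH M" "c = iso_class GH M" by (rule H.irr1_classE[OF c])
    obtain \<iota> E where I: "induced_by G H M (glider_ind G H M) \<iota> E" using glider_ind_induced(2)[OF M(1)] by blast
    note iM = glider_ind_induced(1)[OF M(1)]
    show "\<Phi> (reduced_class GH c) \<in> reduced_class G ` irr1_classes TYPE('k) G"
      unfolding M(5) \<Phi>(2)[OF M(1)]
      by (rule rcl_line[OF iM induced_line[OF I M(1) iM M(2,3)]])
    fix d assume d: "d \<in> irr1_classes TYPE('k) GH"
    obtain N :: "('g, nat, 'k) glider" and w where N: "is_glider GH N" "w \<noteq> 0" "lev1 N = pm.span {w}"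
      "lev0 N = generated0 GH N" "d = iso_class GH N" by (rule H.irr1_classE[OF d])
    have T: "is_glider GH (glider_tensor M N)" by (rule H.is_glider_tensor[OF M(1) N(1)])
    obtain P :: "('g, nat, 'k) glider" where P: "is_glider GH P" "glider_iso GH P (glider_tensor M N)"
      using H.nat_representative[OF T] .
    have "rcl GH M \<otimes>\<^bsub>reduced_groth_ring TYPE('k) GH\<^esub> rcl GH N = rcl GH P"
      using H.rcl_tensor[OF M(1) N(1)] H.rcl_iso[OF P(1) T P(2)] by simp
    then show "\<Phi> (reduced_class GH c \<otimes>\<^bsub>reduced_groth_ring TYPE('k) GH\<^esub> reduced_class GH d)
          = \<Phi> (reduced_class GH c) \<otimes>\<^bsub>reduced_groth_ring TYPE('k) G\<^esub> \<Phi> (reduced_class GH d)"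
      unfolding M(5) N(5) using \<Phi>(2)[OF M(1)] \<Phi>(2)[OF N(1)] \<Phi>(2)[OF P(1)] tensor[OF M(1) N(1) P] by simp
  qed
  moreover have "inj_on (\<lambda>c. \<Phi> (reduced_class GH c)) (irr1_classes TYPE('k) GH)"
  proof (rule inj_onI)
    fix c d assume cd: "c \<in> irr1_classes TYPE('k) GH" "d \<in> irr1_classes TYPE('k) GH"
      "\<Phi> (reduced_class GH c) = \<Phi> (reduced_class GH d)"
    obtain M :: "('g, nat, 'k) glider" and v where M: "is_glider GH M" "v \<noteq> 0" "lev1 M = pm.span {v}"
      "lev0 M = generated0 GH M" "c = iso_class GH M" by (rule H.irr1_classE[OF cd(1)])
    obtain N :: "('g, nat, 'k) glider" and w where N: "is_glider GH N" "w \<noteq> 0" "lev1 N = pm.span {w}"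
      "lev0 N = generated0 GH N" "d = iso_class GH N" by (rule H.irr1_classE[OF cd(2)])
    obtain \<iota> E where I: "induced_by G H M (glider_ind G H M) \<iota> E" using glider_ind_induced(2)[OF M(1)] by blast
    obtain \<iota>' E' where I': "induced_by G H N (glider_ind G H N) \<iota>' E'" using glider_ind_induced(2)[OF N(1)] by blast
    note iM = glider_ind_induced(1)[OF M(1)] and iN = glider_ind_induced(1)[OF N(1)]
    have "rcl G (glider_ind G H M) = rcl G (glider_ind G H N)"
      using cd(3) unfolding M(5) N(5) \<Phi>(2)[OF M(1)] \<Phi>(2)[OF N(1)] .
    then have ann: "ann G (glider_ind G H M) (\<iota> v) = ann G (glider_ind G H N) (\<iota>' w)"
      by (rule rcl_eq_imp_ann_eq[OF iM induced_line[OF I M(1) iM M(2,3)] iN induced_line[OF I' N(1) iN N(2,3)]])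
    have "v \<in> lev1 M" "w \<in> lev1 N" unfolding M(3) N(3) by (simp_all add: pm.span_base)
    then have "ann GH M v = ann GH N w"
      using induced_ann[OF I M(1) iM] induced_ann[OF I' N(1) iN] ann by blast
    then show "c = d" unfolding M(5) N(5) by (rule H.ann_iso_class[OF M(1,4) N(1,4) M(2,3) N(2,3)])
  qed
  ultimately show ?thesis using that \<Phi>(2) by blast
qed

lemma Res_map_properties:
  shows "\<exists>!F. is_Res_map TYPE('k::field) G H F"
    and "Res_map TYPE('k) G H \<in> nonunital_ring_hom (R1bar TYPE('k) G) (R1bar TYPE('k) GH)"
    and "Res_map TYPE('k) G H ` carrier (irr1_monoid TYPE('k) G) \<subseteq> carrier (irr1_monoid TYPE('k) GH)"
proof -
  obtain \<Phi> where \<Phi>: "respects_irreducibles G GH \<Phi>"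
    "\<And>M :: ('g, nat, 'k) glider. is_glider G M \<Longrightarrow> \<Phi> (rcl G M) = rcl GH M"
    by (rule restriction_map) blast
  note props = map_on_irreducibles[OF finite_group_axioms finite_group_H \<Phi>(1), of
      "\<lambda>M. is_glider G M \<and> lev0_module G M" "rcl GH" "is_Res_map TYPE('k) G H"]
  show "\<exists>!F. is_Res_map TYPE('k) G H F"
    "Res_map TYPE('k) G H \<in> nonunital_ring_hom (R1bar TYPE('k) G) (R1bar TYPE('k) GH)"
    "Res_map TYPE('k) G H ` carrier (irr1_monoid TYPE('k) G) \<subseteq> carrier (irr1_monoid TYPE('k) GH)"
    unfolding Res_map_def
    by (rule props(1,3,4); simp add: \<Phi>(2) is_Res_map_def)+
qed

lemma Ind_map_properties:
  shows "\<exists>!F. is_Ind_map TYPE('k::field_char_0) G H F"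
    and "Ind_map TYPE('k) G H \<in> nonunital_ring_hom (R1bar TYPE('k) GH) (R1bar TYPE('k) G)"
    and "Ind_map TYPE('k) G H ` carrier (irr1_monoid TYPE('k) GH) \<subseteq> carrier (irr1_monoid TYPE('k) G)"
    and "inj_on (Ind_map TYPE('k) G H) (carrier (R1bar TYPE('k) GH))"
proof -
  obtain \<Phi> where \<Phi>: "respects_irreducibles GH G \<Phi>"
    "\<And>M :: ('g, nat, 'k) glider. is_glider GH M \<Longrightarrow> \<Phi> (rcl GH M) = rcl G (glider_ind G H M)"
    "inj_on (\<lambda>c. \<Phi> (reduced_class GH c)) (irr1_classes TYPE('k) GH)"
    by (rule induction_map) blast
  note props = map_on_irreducibles[OF finite_group_H finite_group_axioms \<Phi>(1), of
      "\<lambda>M. is_glider GH M \<and> lev0_module GH M" "\<lambda>M. rcl G (glider_ind G H M)" "is_Ind_map TYPE('k) G H"]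
  show "\<exists>!F. is_Ind_map TYPE('k) G H F"
    "Ind_map TYPE('k) G H \<in> nonunital_ring_hom (R1bar TYPE('k) GH) (R1bar TYPE('k) G)"
    "Ind_map TYPE('k) G H ` carrier (irr1_monoid TYPE('k) GH) \<subseteq> carrier (irr1_monoid TYPE('k) G)"
    unfolding Ind_map_def
    by (rule props(1,3,4); simp add: \<Phi>(2) is_Ind_map_def)+
  have "Ind_map TYPE('k) G H = restrict \<Phi> (carrier (R1bar TYPE('k) GH))"
    unfolding Ind_map_def by (rule props(2); simp add: \<Phi>(2) is_Ind_map_def)
  then show "inj_on (Ind_map TYPE('k) G H) (carrier (R1bar TYPE('k) GH))"
    using inj_on_R1bar_from_basis[OF finite_group_H finite_group_axioms \<Phi>(1,3)] by (simp add: inj_on_restrict_eq)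
qed

end

text \<open>
  The argument \<open>K\<close> only carries the type of the field, so all constants may be taken at \<open>TYPE('k)\<close>.
\<close>

lemma free_groth_ring_itself: "free_groth_ring (K :: 'k::field itself) G = free_groth_ring TYPE('k) G"
  by (simp add: free_groth_ring_def iso_class_monoid_def)

lemma reduced_groth_ring_itself: "reduced_groth_ring (K :: 'k::field itself) G = reduced_groth_ring TYPE('k) G"
  by (simp add: reduced_groth_ring_def length_zero_ideal_def split_groth_ring_def split_relations_def
      free_groth_ring_itself[of K])

lemma irr1_classes_itself: "irr1_classes (K :: 'k::field itself) G = irr1_classes TYPE('k) G"
  by (simp add: irr1_classes_def)

lemma R1bar_itself: "R1bar (K :: 'k::field itself) G = R1bar TYPE('k) G"
  by (simp add: R1bar_def reduced_groth_ring_itself[of K] irr1_classes_itself[of K])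

lemma irr1_monoid_itself: "irr1_monoid (K :: 'k::field itself) G = irr1_monoid TYPE('k) G"
  by (simp add: irr1_monoid_def R1bar_itself[of K] irr1_classes_itself[of K])

lemma is_Ind_map_itself: "is_Ind_map (K :: 'k::field itself) G H F = is_Ind_map TYPE('k) G H F"
  by (simp add: is_Ind_map_def R1bar_itself[of K])

lemma is_Res_map_itself: "is_Res_map (K :: 'k::field itself) G H F = is_Res_map TYPE('k) G H F"
  by (simp add: is_Res_map_def R1bar_itself[of K])

lemma Ind_map_itself: "Ind_map (K :: 'k::field itself) G H = Ind_map TYPE('k) G H"
  by (simp add: Ind_map_def is_Ind_map_itself[of K])

lemma Res_map_itself: "Res_map (K :: 'k::field itself) G H = Res_map TYPE('k) G H"
  by (simp add: Res_map_def is_Res_map_itself[of K])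

theorem proposition4p5:
  fixes K :: "'k::{alg_closed_field, field_char_0} itself"
    and G :: "('g, 'x) monoid_scheme" and H :: "'g set"
  assumes "group G" and "finite (carrier G)" and "subgroup H G"
  shows
    "inj_on (reduced_class G) (irr1_classes K G) \<and>
     monoid (irr1_monoid K G) \<and>
     (\<exists>\<phi> \<in> ring_iso (monoid_algebra TYPE(int) (irr1_monoid K G)) (R1bar K G).
       \<forall>a\<in>carrier (irr1_monoid K G). \<phi> (Poly_Mapping.single a 1) = a) \<and>
     (\<exists>!F. is_Ind_map K G H F) \<and>
     (\<exists>!F. is_Res_map K G H F) \<and>
     Ind_map K G H \<in> nonunital_ring_hom (R1bar K (G\<lparr>carrier := H\<rparr>)) (R1bar K G) \<and>
     Res_map K G H \<in> nonunital_ring_hom (R1bar K G) (R1bar K (G\<lparr>carrier := H\<rparr>)) \<and>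
     Ind_map K G H ` carrier (irr1_monoid K (G\<lparr>carrier := H\<rparr>)) \<subseteq> carrier (irr1_monoid K G) \<and>
     Res_map K G H ` carrier (irr1_monoid K G) \<subseteq> carrier (irr1_monoid K (G\<lparr>carrier := H\<rparr>)) \<and>
     inj_on (Ind_map K G H) (carrier (R1bar K (G\<lparr>carrier := H\<rparr>)))"
proof -
  interpret finite_subgroup G H
    using assms by (simp add: finite_subgroup_def finite_subgroup_axioms_def finite_group_def finite_group_axioms_def)
  have monoid: "monoid (irr1_monoid TYPE('k) G)"
    using irr1_comm_monoid by (rule comm_monoid.axioms(1))
  show ?thesis
    unfolding irr1_classes_itself[of K] irr1_monoid_itself[of K] R1bar_itself[of K] is_Ind_map_itself[of K]
      is_Res_map_itself[of K] Ind_map_itself[of K] Res_map_itself[of K]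
    by (intro conjI reduced_class_inj_on monoid R1bar_monoid_algebra Ind_map_properties Res_map_properties)
qed

end
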